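(* Let $n>1$, let $O\sqcup C=P\setminus A$ be any partition and let $\lambda$ be an integral dominant weight of $\mathfrak{sl}_n(\mathbb C)$. Let $\tau=(w_O)^{-1}\in\mathcal S_n$ and let $\xi$ be the linear operator on $\mathbb R^P$ given on the basis vectors by $$\xi(\varepsilon_{i,i})=\varepsilon_{i,\tau(r(i,i))},\qquad \xi(\varepsilon_{i,j})=\varepsilon_{i,\tau(r(i,j))}-\varepsilon_{i,\tau(r(i,j'))}\quad\text{for } i<j,$$ where, for $i<j$, $j'$ is the largest integer with $j'<j$ and $(i,j')\in O\cup A$. Then $\xi$ is a unimodular transformation of $\mathbb R^P$, and, denoting $\Pi^{O,C}_\lambda=\xi(\mathcal O_{O,C}(\lambda))$, the set of vectors $f^cv_\lambda$ with $c\in\Pi^{O,C}_\lambda\cap\mathbb Z^P$ (equivalently, the set of vectors $f^{\xi(x)}v_\lambda$ with $x\in\mathcal O_{O,C}(\lambda)\cap\mathbb Z^P$) is a basis in $V_\lambda$.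
   Context: **Poset and permutations.** $P=\{(i,j):1\le i\le j\le n\}$ is ordered by $(i,j)\preceq(i',j')$ iff $i\le i'$ and $j\le j'$. $A=\{(1,1),\dots,(n,n)\}$. $\varepsilon_{i,j}$, $(i,j)\in P$, are the standard basis vectors of $\mathbb R^P$. $\mathcal J$ is the set of order ideals (lower sets) of $(P,\prec)$, $\mathcal J_k=\{J\in\mathcal J:|J\cap A|=k\}$. For $J\in\mathcal J$ put $M_{O,C}(J)=(J\cap(O\cup A))\cup\max_\prec(J)$, where $\max_\prec(J)$ is the set of $\prec$-maximal elements of $J$, and let $x_{O,C}(J)\in\mathbb R^P$ be the indicator vector of $M_{O,C}(J)$. For $M\subset P$ let $w_M\in\mathcal S_n$ be the product of the transpositions $s_{i,j}=(i\ j)$ over $(i,j)\in M$ (with $s_{i,i}=\mathrm{id}$), ordered by $i$ increasing from left to right and, within a given $i$, by $j$ increasing from left to right; in a product the rightmost factor acts first. Put $w^J=w_{M_{O,C}(J)}$. For $(i,j)\in P$ let $\langle(i,j)\rangle\in\mathcal J$ be the principal order ideal $\{p\preceq(i,j)\}$ and set $r(i,j)=w^{\langle(i,j)\rangle}(i)$ for $1\le i\le j\le n$. One has $\tau(r(i,j))\ge i$ for $i\le j$, so the formulas for $\xi$ make sense. **Polytopes.** Integral dominant weights are tuples $\lambda=(a_1,\dots,a_{n-1})\in\mathbb Z_{\ge0}^{n-1}$, $\lambda=\sum a_i\omega_i$ with $\omega_i$ the fundamental weights. The marked chain-order polytope $\mathcal O_{O,C}(\omega_k)\subset\mathbb R^P$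 is the convex hull of the $x_{O,C}(J)$, $J\in\mathcal J_k$, and $\mathcal O_{O,C}(\lambda)$ is the Minkowski sum $a_1\mathcal O_{O,C}(\omega_1)+\dots+a_{n-1}\mathcal O_{O,C}(\omega_{n-1})$. The polytope $\Pi^{O,C}_{\omega_k}$ is the convex hull of the points $\varepsilon_{1,\tau w^J(1)}+\dots+\varepsilon_{k,\tau w^J(k)}$, $J\in\mathcal J_k$, and $\Pi^{O,C}_\lambda=\sum_k a_k\Pi^{O,C}_{\omega_k}$; so points of $\Pi^{O,C}_\lambda$ have nonnegative coordinates and zero $(n,n)$-coordinate. "Unimodular" means an automorphism of the lattice $\mathbb Z^P$ (determinant $\pm1$ integer matrix). **Representations.** $\mathfrak g=\mathfrak{sl}_n(\mathbb C)$ with simple roots $\alpha_1,\dots,\alpha_{n-1}$; for $1\le i<j\le n$, $f_{i,j}\in\mathfrak g$ is the root vector of the negative root $-(\alpha_i+\dots+\alpha_{j-1})$ (normalized so that in $\mathbb C^n$ it sends $e_i$ to $e_j$ and kills other basis vectors). $V_\lambda$ is the irreducible representation with highest weight $\lambda$ and highest weight vector $v_\lambda$. For $c\in\mathbb Z_{\ge0}^P$ with $c_{n,n}=0$, $f^c=\prod_{1\le i<j\le n}f_{i,j}^{c_{i,j}}\in\mathcal U(\mathfrak g)$, with factors ordered by $i$ increasing from left to right and within a given $i$ by $j$ increasing from left to right (the coordinates $c_{i,i}$ play no role in $f^c$). *)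

theory Defs
  imports
    "HOL-Analysis.Convex"
    "HOL-Library.Function_Algebras"
    "HOL-Library.Set_Algebras"
    "HOL-Library.Indicator_Function"
    "HOL-Combinatorics.Transposition"
    "Jordan_Normal_Form.Matrix"
begin

section \<open>The real vector space of functions\<close>

text \<open>
  Together with \<^theory>\<open>HOL-Library.Function_Algebras\<close> this makes \<^typ>\<open>'a \<Rightarrow> real\<close> a real vector
  space under pointwise operations, so that the library's \<^const>\<open>linear\<close> and convex hull apply.
\<close>

instantiation "fun" :: (type, scaleR) scaleR
begin

definition scaleR_fun :: "real \<Rightarrow> ('a \<Rightarrow> 'b) \<Rightarrow> 'a \<Rightarrow> 'b" where
  "scaleR_fun r f = (\<lambda>x. r *\<^sub>R f x)"

instance ..

end

instance "fun" :: (type, real_vector) real_vector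
  by standard (simp_all add: scaleR_fun_def plus_fun_def fun_eq_iff algebra_simps)


section \<open>The poset and its order ideals\<close>

definition tri :: "nat \<Rightarrow> (nat \<times> nat) set" where
  "tri n = {(i, j). 1 \<le> i \<and> i \<le> j \<and> j \<le> n}"

definition diag :: "nat \<Rightarrow> (nat \<times> nat) set" where
  "diag n = {(i, i) | i. 1 \<le> i \<and> i \<le> n}"

definition tri_le :: "nat \<times> nat \<Rightarrow> nat \<times> nat \<Rightarrow> bool" where
  "tri_le p q \<longleftrightarrow> fst p \<le> fst q \<and> snd p \<le> snd q"

definition ideals :: "nat \<Rightarrow> (nat \<times> nat) set set" where
  "ideals n = {J. J \<subseteq> tri n \<and> (\<forall>q \<in> J. \<forall>p \<in> tri n. tri_le p q \<longrightarrow> p \<in> J)}"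

definition ideals_of :: "nat \<Rightarrow> nat \<Rightarrow> (nat \<times> nat) set set" where
  "ideals_of n k = {J \<in> ideals n. card (J \<inter> diag n) = k}"

definition principal :: "nat \<Rightarrow> nat \<times> nat \<Rightarrow> (nat \<times> nat) set" where
  "principal n q = {p \<in> tri n. tri_le p q}"

definition maximals :: "(nat \<times> nat) set \<Rightarrow> (nat \<times> nat) set" where
  "maximals J = {p \<in> J. \<forall>q \<in> J. tri_le p q \<longrightarrow> q = p}"

text \<open>
  The marking is determined by the set \<open>\<O>\<close> alone, since \<open>\<C>\<close> is the complement
  of \<open>\<O>\<close> in \<open>tri n - diag n\<close>; so only \<open>\<O>\<close> occurs as a parameter below.
\<close>

definition marked :: "nat \<Rightarrow> (nat \<times> nat) set \<Rightarrow> (nat \<times> nat) set \<Rightarrow> (nat \<times> nat) set" where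
  "marked n \<O> J = (J \<inter> (\<O> \<union> diag n)) \<union> maximals J"


section \<open>Products of transpositions\<close>

text \<open>
  Permutations are functions on \<^typ>\<open>nat\<close> fixing everything outside \<open>{1..n}\<close>. The pairs
  of \<open>M\<close> are listed lexicographically, and the last transposition of the list acts first.
\<close>

definition tri_list :: "nat \<Rightarrow> (nat \<times> nat) list" where
  "tri_list n = [(i, j). i \<leftarrow> [1..<Suc n], j \<leftarrow> [i..<Suc n]]"

definition transp_prod :: "nat \<Rightarrow> (nat \<times> nat) set \<Rightarrow> nat \<Rightarrow> nat" where
  "transp_prod n M = foldr (\<lambda>(i, j) g. Transposition.transpose i j \<circ> g)
     (filter (\<lambda>p. p \<in> M) (tri_list n)) id"

definition ideal_perm :: "nat \<Rightarrow> (nat \<times> nat) set \<Rightarrow> (nat \<times> nat) set \<Rightarrow> nat \<Rightarrow> nat" where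
  "ideal_perm n \<O> J = transp_prod n (marked n \<O> J)"

definition r_index :: "nat \<Rightarrow> (nat \<times> nat) set \<Rightarrow> nat \<Rightarrow> nat \<Rightarrow> nat" where
  "r_index n \<O> i j = ideal_perm n \<O> (principal n (i, j)) i"

definition tau :: "nat \<Rightarrow> (nat \<times> nat) set \<Rightarrow> nat \<Rightarrow> nat" where
  "tau n \<O> = inv_into UNIV (transp_prod n \<O>)"


section \<open>Polytopes\<close>

type_synonym point = "nat \<times> nat \<Rightarrow> real"

text \<open>The vector space with coordinates indexed by \<open>tri n\<close>, realised as functions vanishing
  outside \<open>tri n\<close>, and its standard lattice.\<close>

definition coord_space :: "nat \<Rightarrow> point set" where
  "coord_space n = {x. \<forall>p. p \<notin> tri n \<longrightarrow> x p = 0}"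

definition int_lattice :: "nat \<Rightarrow> point set" where
  "int_lattice n = {x \<in> coord_space n. \<forall>p. x p \<in> \<int>}"

definition eps :: "nat \<Rightarrow> nat \<Rightarrow> point" where
  "eps i j = indicator {(i, j)}"

definition fund_chain_order :: "nat \<Rightarrow> (nat \<times> nat) set \<Rightarrow> nat \<Rightarrow> point set" where
  "fund_chain_order n \<O> k = convex hull ((\<lambda>J. indicator (marked n \<O> J)) ` ideals_of n k)"

definition fund_Pi :: "nat \<Rightarrow> (nat \<times> nat) set \<Rightarrow> nat \<Rightarrow> point set" where
  "fund_Pi n \<O> k =
     convex hull ((\<lambda>J. \<Sum>i = 1..k. eps i (tau n \<O> (ideal_perm n \<O> J i))) ` ideals_of n k)"

text \<open>
  The weight \<open>a\<^sub>1 \<omega>\<^sub>1 + \<dots> + a\<^sub>n\<^sub>-\<^sub>1 \<omega>\<^sub>n\<^sub>-\<^sub>1\<close> is given by \<open>a :: nat \<Rightarrow> nat\<close>; values of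
  \<open>a\<close> outside \<open>{1..<n}\<close> are irrelevant. Sums of sets are Minkowski sums.
\<close>

definition chain_order :: "nat \<Rightarrow> (nat \<times> nat) set \<Rightarrow> (nat \<Rightarrow> nat) \<Rightarrow> point set" where
  "chain_order n \<O> a = (\<Sum>k = 1..<n. (\<lambda>x. real (a k) *\<^sub>R x) ` fund_chain_order n \<O> k)"

definition Pi_polytope :: "nat \<Rightarrow> (nat \<times> nat) set \<Rightarrow> (nat \<Rightarrow> nat) \<Rightarrow> point set" where
  "Pi_polytope n \<O> a = (\<Sum>k = 1..<n. (\<lambda>x. real (a k) *\<^sub>R x) ` fund_Pi n \<O> k)"

definition prev_marked :: "nat \<Rightarrow> (nat \<times> nat) set \<Rightarrow> nat \<Rightarrow> nat \<Rightarrow> nat" where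
  "prev_marked n \<O> i j = Max {j'. j' < j \<and> (i, j') \<in> \<O> \<union> diag n}"

definition xi_eps :: "nat \<Rightarrow> (nat \<times> nat) set \<Rightarrow> nat \<Rightarrow> nat \<Rightarrow> point" where
  "xi_eps n \<O> i j =
     (if i = j then eps i (tau n \<O> (r_index n \<O> i i))
      else eps i (tau n \<O> (r_index n \<O> i j)) - eps i (tau n \<O> (r_index n \<O> i (prev_marked n \<O> i j))))"

definition xi :: "nat \<Rightarrow> (nat \<times> nat) set \<Rightarrow> point \<Rightarrow> point" where
  "xi n \<O> x = (\<Sum>(i, j) \<in> tri n. x (i, j) *\<^sub>R xi_eps n \<O> i j)"

text \<open>An operator on \<open>coord_space n\<close> is represented by a linear operator on all functions
  that maps \<open>coord_space n\<close> to itself.\<close>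

definition unimodular :: "nat \<Rightarrow> (point \<Rightarrow> point) \<Rightarrow> bool" where
  "unimodular n T \<longleftrightarrow>
     linear T \<and> T ` coord_space n \<subseteq> coord_space n \<and> bij_betw T (int_lattice n) (int_lattice n)"


section \<open>Irreducible representations of the special linear Lie algebra\<close>

definition sl :: "nat \<Rightarrow> complex mat set" where
  "sl n = {A \<in> carrier_mat n n. (\<Sum>i<n. A $$ (i, i)) = 0}"

text \<open>The matrix unit sending the \<open>j\<close>-th basis vector to the \<open>i\<close>-th one; \<open>i\<close> and \<open>j\<close> range over
  \<open>{1..n}\<close>, whereas the rows and columns of \<^typ>\<open>complex mat\<close> are counted from 0.\<close>

definition mat_unit :: "nat \<Rightarrow> nat \<Rightarrow> nat \<Rightarrow> complex mat" where
  "mat_unit n i j = mat n n (\<lambda>(k, l). if Suc k = i \<and> Suc l = j then 1 else 0)"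

locale sl_rep = vector_space smul
  for smul :: "complex \<Rightarrow> 'v :: ab_group_add \<Rightarrow> 'v" +
  fixes n :: nat and \<rho> :: "complex mat \<Rightarrow> 'v \<Rightarrow> 'v"
  assumes rep_linear: "A \<in> sl n \<Longrightarrow> Vector_Spaces.linear smul smul (\<rho> A)"
    and rep_add: "A \<in> sl n \<Longrightarrow> B \<in> sl n \<Longrightarrow> \<rho> (A + B) u = \<rho> A u + \<rho> B u"
    and rep_smult: "A \<in> sl n \<Longrightarrow> \<rho> (c \<cdot>\<^sub>m A) u = smul c (\<rho> A u)"
    and rep_bracket: "A \<in> sl n \<Longrightarrow> B \<in> sl n \<Longrightarrow>
      \<rho> (A * B - B * A) u = \<rho> A (\<rho> B u) - \<rho> B (\<rho> A u)"

locale irreducible_sl_rep = sl_rep smul n \<rho>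
  for smul :: "complex \<Rightarrow> 'v :: ab_group_add \<Rightarrow> 'v"
    and n :: nat and \<rho> :: "complex mat \<Rightarrow> 'v \<Rightarrow> 'v" +
  assumes nontrivial: "\<exists>u :: 'v. u \<noteq> 0"
    and irreducible: "subspace U \<Longrightarrow> (\<And>A u. A \<in> sl n \<Longrightarrow> u \<in> U \<Longrightarrow> \<rho> A u \<in> U) \<Longrightarrow>
      U = {0} \<or> U = UNIV"

text \<open>
  The diagonal matrices \<open>mat_unit n i i - mat_unit n (Suc i) (Suc i)\<close> are the simple coroots,
  on which \<open>a\<^sub>1 \<omega>\<^sub>1 + \<dots> + a\<^sub>n\<^sub>-\<^sub>1 \<omega>\<^sub>n\<^sub>-\<^sub>1\<close> takes the value \<open>a\<^sub>i\<close>.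
\<close>

locale irreducible_highest_weight_rep = irreducible_sl_rep smul n \<rho>
  for smul :: "complex \<Rightarrow> 'v :: ab_group_add \<Rightarrow> 'v"
    and n :: nat and \<rho> :: "complex mat \<Rightarrow> 'v \<Rightarrow> 'v" +
  fixes a :: "nat \<Rightarrow> nat" and v :: 'v
  assumes hw_nonzero: "v \<noteq> 0"
    and hw_raising: "1 \<le> i \<Longrightarrow> i < j \<Longrightarrow> j \<le> n \<Longrightarrow> \<rho> (mat_unit n i j) v = 0"
    and hw_weight: "1 \<le> i \<Longrightarrow> i < n \<Longrightarrow>
      \<rho> (mat_unit n i i - mat_unit n (Suc i) (Suc i)) v = smul (of_nat (a i)) v"

definition lowering :: "nat \<Rightarrow> nat \<Rightarrow> nat \<Rightarrow> complex mat" where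
  "lowering n i j = mat_unit n j i"

text \<open>The action of \<open>f\<^sup>c\<close> on a vector: the leftmost factor is the outermost operator.\<close>

definition pbw_act ::
  "nat \<Rightarrow> (complex mat \<Rightarrow> 'v \<Rightarrow> 'v) \<Rightarrow> point \<Rightarrow> 'v \<Rightarrow> 'v" where
  "pbw_act n \<rho> c u = foldr (\<lambda>(i, j). \<rho> (lowering n i j) ^^ nat \<lfloor>c (i, j)\<rfloor>)
     (filter (\<lambda>(i, j). i < j) (tri_list n)) u"

text \<open>The family \<open>(b x)\<close>, indexed by \<open>x \<in> I\<close>, is a basis of the whole space.\<close>

definition is_basis_family ::
  "(complex \<Rightarrow> 'v :: ab_group_add \<Rightarrow> 'v) \<Rightarrow> ('i \<Rightarrow> 'v) \<Rightarrow> 'i set \<Rightarrow> bool" where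
  "is_basis_family smul b I \<longleftrightarrow>
     inj_on b I \<and> \<not> module.dependent smul (b ` I) \<and> module.span smul (b ` I) = UNIV"

end

theory Submission
  imports Defs "HOL-Combinatorics.Permutations" "HOL-Library.Product_Plus"
begin

text \<open>
  The product \<open>w\<close> of transpositions over \<open>\<O>\<close> splits into rows as \<open>c\<^sub>1 \<dots> c\<^sub>n\<close>, where \<open>c\<^sub>i\<close> is a
  single cycle: it sends \<open>i\<close> to the last column of \<open>\<O>\<close> in row \<open>i\<close> and each column of \<open>\<O>\<close> in that
  row to the preceding one. For an order ideal \<open>J\<close> the rows before row \<open>i\<close> reach at least as far to
  the right as row \<open>i\<close>, so on the values that matter its cycles agree with the \<open>c\<^sub>l\<close>. Hence \<open>w\<^sup>J\<close> sends \<open>i\<close> to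
  \<open>c\<^sub>1 \<dots> c\<^sub>i\<^sub>-\<^sub>1\<close> applied to \<open>m\<close>, the last column of row \<open>i\<close> in \<open>marked n \<O> J\<close>, and applying \<open>\<tau>\<close>
  leaves the preimage of \<open>m\<close> under \<open>c\<^sub>i \<dots> c\<^sub>n\<close> (\<open>tau_ideal_perm\<close>). As these tails permute \<open>{i..n}\<close>,
  the formula for \<open>\<xi>\<close> telescopes along the rows; so \<open>\<xi>\<close> is unimodular and carries the vertex
  of \<open>J\<close> to the point defining the other polytope (\<open>xi_chi\<close>, \<open>xi_indicator_marked\<close>).

  For the basis, the representation is realised inside the tensor power of \<open>\<complex>\<^sup>n\<close> whose factors are
  the boxes of the Young diagram of \<open>\<lambda>\<close>, with the product of one determinant per column as highest
  weight vector. This embedding is well defined because the standard Hermitian form is positive, and injective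
  because the representation is irreducible (\<open>model\<close>). A vector of the model is a function on words, that is, on fillings of the
  diagram with numbers in \<open>{1..n}\<close>.

  The dimension is bounded from above by the straightening law: the functions in the model are
  alternating in each column and satisfy exchange relations between columns, and these force a
  function that vanishes at all standard words to vanish (\<open>exchange_space_determined\<close>). A standard
  word is a chain of order ideals in disguise, and the sum of the vertices along a chain is a lattice
  point that determines the chain (\<open>inj_on_word_point\<close>); so the dimension is at most the number of
  lattice points.

  Linear independence comes from a leading term. Every lattice point is a sum of vertices along a
  chain of ideals (\<open>lattice_point_decompose\<close>), and the images under \<open>\<tau> w\<^sup>J\<close> of these ideals fill a
  word. Evaluating \<open>f\<^sup>c v\<close> at a word sums signs over the ways to lower that word, by replacements
  recorded in \<open>c\<close>, to a permutation of the row numbers in each column. In one column, the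
  assignment given by \<open>\<tau> w\<^sup>J\<close> is the strict maximum of a weight that is additive over the boxes
  (\<open>weight_maximal\<close>). So the matrix
  of these evaluations is triangular with nonzero diagonal (\<open>model_basis_vector_diagonal\<close>,
  \<open>model_basis_vector_triangular\<close>), the vectors \<open>f\<^sup>c v\<close> are linearly independent, and by the
  dimension bound they form a basis.
\<close>

section \<open>Products of transpositions by rows\<close>

definition row_cycle :: "nat \<Rightarrow> (nat \<times> nat) set \<Rightarrow> nat \<Rightarrow> nat \<Rightarrow> nat" where
  "row_cycle n M i =
     foldr (\<lambda>j g. Transposition.transpose i j \<circ> g) (filter (\<lambda>j. (i, j) \<in> M) [i..<Suc n]) id"

definition rows_prod :: "nat \<Rightarrow> (nat \<times> nat) set \<Rightarrow> nat list \<Rightarrow> nat \<Rightarrow> nat" where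
  "rows_prod n M ls = foldr (\<lambda>i g. row_cycle n M i \<circ> g) ls id"

lemma foldr_comp_append:
  "foldr (\<lambda>x g. F x \<circ> g) (xs @ ys) id = foldr (\<lambda>x g. F x \<circ> g) xs id \<circ> foldr (\<lambda>x g. F x \<circ> g) ys id"
  by (induction xs) (simp_all add: comp_assoc)

lemma rows_prod_append: "rows_prod n M (xs @ ys) = rows_prod n M xs \<circ> rows_prod n M ys"
  unfolding rows_prod_def by (rule foldr_comp_append)

lemma rows_prod_Nil [simp]: "rows_prod n M [] = id"
  and rows_prod_Cons: "rows_prod n M (i # ls) = row_cycle n M i \<circ> rows_prod n M ls"
  by (simp_all add: rows_prod_def)

lemma tri_list_eq: "tri_list n = concat (map (\<lambda>i. map (Pair i) [i..<Suc n]) [1..<Suc n])"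
  unfolding tri_list_def by (metis concat_map_singleton)

lemma transp_prod_eq_rows_prod: "transp_prod n M = rows_prod n M [1..<Suc n]"
proof -
  let ?F = "\<lambda>p g. Transposition.transpose (fst p) (snd p) \<circ> g"
  have row_measure: "foldr ?F (filter (\<lambda>p. p \<in> M) (map (Pair i) js)) id
      = foldr (\<lambda>j g. Transposition.transpose i j \<circ> g) (filter (\<lambda>j. (i, j) \<in> M) js) id" for i js
    by (induction js) auto
  have "foldr ?F (filter (\<lambda>p. p \<in> M) (concat (map (\<lambda>i. map (Pair i) [i..<Suc n]) ls))) id
      = rows_prod n M ls" for ls
  proof (induction ls)
    case (Cons i ls)
    have "filter (\<lambda>p. p \<in> M) (concat (map (\<lambda>i. map (Pair i) [i..<Suc n]) (i # ls)))
      = filter (\<lambda>p. p \<in> M) (map (Pair i) [i..<Suc n])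
        @ filter (\<lambda>p. p \<in> M) (concat (map (\<lambda>i. map (Pair i) [i..<Suc n]) ls))"
      by (simp del: upt_Suc)
    then show ?case
      by (simp only: foldr_comp_append[of "\<lambda>p. Transposition.transpose (fst p) (snd p)"]
          Cons row_measure rows_prod_Cons row_cycle_def)
  qed simp
  then show ?thesis
    by (simp only: transp_prod_def tri_list_eq split_def)
qed

text \<open>
  Adjoining the last column composes with one transposition on the right, so the facts below follow
  by induction on \<open>n\<close>.
\<close>

lemma row_cycle_Suc:
  "row_cycle (Suc n) M i =
     (if i \<le> Suc n \<and> (i, Suc n) \<in> M then row_cycle n M i \<circ> Transposition.transpose i (Suc n)
      else row_cycle n M i)"
proof (cases "i \<le> Suc n")
  case True
  then have "[i..<Suc (Suc n)] = [i..<Suc n] @ [Suc n]" by simp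
  then show ?thesis using True
    unfolding row_cycle_def by (simp only: filter_append foldr_comp_append) simp
next
  case False
  then show ?thesis by (simp add: row_cycle_def)
qed

lemma row_cycle_0: "row_cycle 0 M i = id"
  by (auto simp: row_cycle_def)

lemma row_cycle_fixes:
  assumes "x < i \<or> n < x \<or> (i < x \<and> (i, x) \<notin> M)"
  shows "row_cycle n M i x = x"
  using assms
proof (induction n)
  case (Suc n)
  then show ?case
    by (cases "x = Suc n")
      (auto simp: row_cycle_Suc transpose_def split: if_splits)
qed (simp add: row_cycle_0)

lemma row_cycle_start:
  assumes "i \<le> n"
  shows "row_cycle n M i i = Max {j. i \<le> j \<and> j \<le> n \<and> (j = i \<or> (i, j) \<in> M)}"
  using assms
proof (induction n)
  case (Suc n)
  let ?S = "\<lambda>n. {j. i \<le> j \<and> j \<le> n \<and> (j = i \<or> (i, j) \<in> M)}"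
  have fin: "finite (?S m)" for m by simp
  show ?case
  proof (cases "i = Suc n \<or> (i, Suc n) \<in> M")
    case True
    then have "Max (?S (Suc n)) = Suc n"
      using Suc.prems by (intro Max_eqI) auto
    moreover have "row_cycle (Suc n) M i i = Suc n"
    proof (cases "(i, Suc n) \<in> M")
      case True
      then show ?thesis using Suc.prems by (auto simp: row_cycle_Suc row_cycle_fixes)
    next
      case False
      with \<open>i = Suc n \<or> _\<close> show ?thesis by (auto simp: row_cycle_Suc row_cycle_fixes)
    qed
    ultimately show ?thesis by simp
  next
    case False
    with Suc.prems have "i \<le> n" by auto
    moreover have "?S (Suc n) = ?S n"
      using False by (auto simp: le_Suc_eq)
    ultimately show ?thesis using Suc.IH False by (simp add: row_cycle_Suc)
  qed
next
  case 0
  then have "{j. i \<le> j \<and> j \<le> 0 \<and> (j = i \<or> (i, j) \<in> M)} = {0}" by auto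
  with 0 show ?case by (simp add: row_cycle_0)
qed

lemma row_cycle_step:
  assumes "i < x" "x \<le> n" "(i, x) \<in> M"
  shows "row_cycle n M i x = Max {j. i \<le> j \<and> j < x \<and> (j = i \<or> (i, j) \<in> M)}"
  using assms
proof (induction n)
  case (Suc n)
  show ?case
  proof (cases "x = Suc n")
    case True
    then have "row_cycle (Suc n) M i x = row_cycle n M i i"
      using Suc.prems by (simp add: row_cycle_Suc)
    then show ?thesis using True Suc.prems by (simp add: row_cycle_start less_Suc_eq_le)
  next
    case False
    with Suc show ?thesis by (auto simp: row_cycle_Suc transpose_def)
  qed
qed simp

lemma bij_permutes: "bij f \<Longrightarrow> (\<And>x. x \<notin> S \<Longrightarrow> f x = x) \<Longrightarrow> f permutes S"
  unfolding permutes_def by (auto simp: bij_iff)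

lemma row_cycle_permutes: "row_cycle n M i permutes {i..n}"
proof -
  have "bij (row_cycle n M i)"
    by (induction n) (auto simp: row_cycle_0 row_cycle_Suc intro: bij_comp bij_id[unfolded id_def])
  then show ?thesis
    by (intro bij_permutes) (auto simp: row_cycle_fixes)
qed

lemma row_cycle_bounds:
  assumes "i < x"
  shows "i \<le> row_cycle n M i x" "row_cycle n M i x \<le> x"
proof -
  have "i \<le> row_cycle n M i x \<and> row_cycle n M i x \<le> x"
  proof (cases "x \<le> n \<and> (i, x) \<in> M")
    case True
    let ?S = "{j. i \<le> j \<and> j < x \<and> (j = i \<or> (i, j) \<in> M)}"
    have "finite ?S" "i \<in> ?S" using assms by auto
    then have "Max ?S \<in> ?S" by (metis (no_types, lifting) Max_in empty_iff)
    with True assms show ?thesis by (auto simp: row_cycle_step)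
  next
    case False
    with assms show ?thesis by (subst (1 2) row_cycle_fixes) auto
  qed
  then show "i \<le> row_cycle n M i x" "row_cycle n M i x \<le> x" by auto
qed

lemma rows_prod_fixes:
  assumes "\<And>i. i \<in> set ls \<Longrightarrow> x < i \<or> n < x"
  shows "rows_prod n M ls x = x"
  using assms
proof (induction ls)
  case (Cons a ls)
  then have "rows_prod n M ls x = x" "x < a \<or> n < x" by auto
  then show ?case by (auto simp: rows_prod_Cons row_cycle_fixes)
qed simp

lemma bij_rows_prod: "bij (rows_prod n M ls)"
proof (induction ls)
  case (Cons i ls)
  then show ?case
    unfolding rows_prod_Cons by (intro bij_comp permutes_bij[OF row_cycle_permutes])
qed (simp only: rows_prod_Nil bij_id)

lemma rows_prod_permutes: "rows_prod n M [i..<Suc n] permutes {i..n}"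
  by (intro bij_permutes bij_rows_prod) (auto intro!: rows_prod_fixes)

section \<open>The permutation of an order ideal\<close>

locale marked_triangle =
  fixes n :: nat and \<O> :: "(nat \<times> nat) set"
  assumes O_sub: "\<O> \<subseteq> tri n - diag n"
begin

text \<open>
  In terms of the cycles of the rows, \<open>head i\<close> is \<open>c\<^sub>1 \<dots> c\<^sub>i\<^sub>-\<^sub>1\<close> and \<open>tail i\<close> is \<open>c\<^sub>i \<dots> c\<^sub>n\<close>; their product
  is the permutation whose inverse is \<open>\<tau>\<close>.
\<close>

definition head :: "nat \<Rightarrow> nat \<Rightarrow> nat" where "head i = rows_prod n \<O> [1..<i]"
definition tail :: "nat \<Rightarrow> nat \<Rightarrow> nat" where "tail i = rows_prod n \<O> [i..<Suc n]"
abbreviation target :: "nat \<Rightarrow> nat \<Rightarrow> nat" where "target i \<equiv> inv_into UNIV (tail i)"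
abbreviation cyc :: "nat \<Rightarrow> nat \<Rightarrow> nat" where "cyc i \<equiv> row_cycle n \<O> i"

definition row_max :: "(nat \<times> nat) set \<Rightarrow> nat \<Rightarrow> nat" where
  "row_max J i = Max {j. (i, j) \<in> marked n \<O> J}"

lemma O_D: "(i, j) \<in> \<O> \<Longrightarrow> 1 \<le> i \<and> i < j \<and> j \<le> n"
  using O_sub by (fastforce simp: tri_def diag_def)

lemma diag_iff [simp]: "(i, j) \<in> diag n \<longleftrightarrow> i = j \<and> 1 \<le> i \<and> i \<le> n"
  by (auto simp: diag_def)

lemma tri_iff [simp]: "(i, j) \<in> tri n \<longleftrightarrow> 1 \<le> i \<and> i \<le> j \<and> j \<le> n"
  by (auto simp: tri_def)

lemma ideal_sub: "J \<in> ideals n \<Longrightarrow> (i, j) \<in> J \<Longrightarrow> 1 \<le> i \<and> i \<le> j \<and> j \<le> n"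
  by (auto simp: ideals_def tri_def)

lemma ideal_down:
  "J \<in> ideals n \<Longrightarrow> (i', j') \<in> J \<Longrightarrow> 1 \<le> i \<Longrightarrow> i \<le> i' \<Longrightarrow> i \<le> j \<Longrightarrow> j \<le> j' \<Longrightarrow> (i, j) \<in> J"
  using ideal_sub[of J i' j'] by (auto simp: ideals_def tri_le_def)

lemma principal_ideal: "(i, j) \<in> tri n \<Longrightarrow> principal n (i, j) \<in> ideals n"
  by (auto simp: principal_def ideals_def tri_le_def)

lemma marked_sub: "marked n \<O> J \<subseteq> J"
  by (auto simp: marked_def maximals_def)

lemma diag_marked: "(i, i) \<in> J \<Longrightarrow> J \<in> ideals n \<Longrightarrow> (i, i) \<in> marked n \<O> J"
  using ideal_sub by (fastforce simp: marked_def)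

lemma finite_marked_row: "J \<in> ideals n \<Longrightarrow> finite {j. (i, j) \<in> marked n \<O> J}"
  by (rule finite_subset[of _ "{..n}"]) (use marked_sub ideal_sub in blast, simp)

lemma row_max_marked:
  assumes "J \<in> ideals n" "(i, i) \<in> J"
  shows "(i, row_max J i) \<in> marked n \<O> J"
proof -
  have "row_max J i \<in> {j. (i, j) \<in> marked n \<O> J}"
    unfolding row_max_def using diag_marked[OF assms(2,1)] finite_marked_row[OF assms(1)]
    by (intro Max_in) auto
  then show ?thesis by simp
qed

lemma row_max_ge: "J \<in> ideals n \<Longrightarrow> (i, j) \<in> marked n \<O> J \<Longrightarrow> j \<le> row_max J i"
  unfolding row_max_def using finite_marked_row by (intro Max_ge) auto

lemma row_max_in:
  assumes "J \<in> ideals n" "(i, i) \<in> J"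
  shows "(i, row_max J i) \<in> J" "1 \<le> i" "i \<le> row_max J i" "row_max J i \<le> n"
  using row_max_marked[OF assms] marked_sub ideal_sub[OF assms(1)] by blast+

lemma not_maximal: "(i', j') \<in> J \<Longrightarrow> i \<le> i' \<Longrightarrow> j \<le> j' \<Longrightarrow> (i, j) \<noteq> (i', j') \<Longrightarrow> (i, j) \<notin> maximals J"
  by (force simp: maximals_def tri_le_def)

text \<open>
  Strictly below a cell that is not maximal in \<open>J\<close>, the marked cells of its row are those of \<open>\<O>\<close> and
  the diagonal one. Both cycles therefore take the same step at that cell.
\<close>

lemma row_cycle_marked:
  assumes J: "J \<in> ideals n" and mem: "(l, x) \<in> J" "l < x" and nm: "(l, x) \<notin> maximals J"
  shows "row_cycle n (marked n \<O> J) l x = cyc l x"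
proof -
  have b: "1 \<le> l" "x \<le> n" using ideal_sub[OF J mem(1)] by auto
  have iff: "(l, j) \<in> marked n \<O> J \<longleftrightarrow> (l, j) \<in> \<O>" if "l < j" "j \<le> x" for j
  proof -
    have "(l, j) \<in> J" using ideal_down[OF J mem(1)] b that by auto
    moreover have "(l, j) \<notin> maximals J"
      using nm not_maximal[OF mem(1), of l j] that by (cases "j = x") auto
    ultimately show ?thesis using that by (auto simp: marked_def)
  qed
  show ?thesis
  proof (cases "(l, x) \<in> \<O>")
    case True
    have "(j = l \<or> (l, j) \<in> marked n \<O> J) \<longleftrightarrow> (j = l \<or> (l, j) \<in> \<O>)" if "l \<le> j" "j < x" for j
      using iff[of j] that by (cases "j = l") auto
    then have "{j. l \<le> j \<and> j < x \<and> (j = l \<or> (l, j) \<in> marked n \<O> J)}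
        = {j. l \<le> j \<and> j < x \<and> (j = l \<or> (l, j) \<in> \<O>)}" by blast
    moreover have "(l, x) \<in> marked n \<O> J" using iff[of x] mem True by simp
    ultimately show ?thesis using True row_cycle_step[OF mem(2) b(2)] by simp
  next
    case False
    then show ?thesis using iff[of x] mem row_cycle_fixes[of x l n] by simp
  qed
qed

text \<open>
  Going up through the rows keeps the current cell inside \<open>J\<close>, and a cell that has a cell of \<open>J\<close>
  below it in its column is not maximal; so in each row the preceding lemma applies.
\<close>

lemma head_marked:
  assumes J: "J \<in> ideals n" and "(i, x) \<in> J"
  shows "rows_prod n (marked n \<O> J) [1..<i] x = head i x"
  using assms(2)
proof (induction i arbitrary: x)
  case (Suc l)
  show ?case
  proof (cases "l = 0")
    case False
    have b: "Suc l \<le> x" "x \<le> n" using ideal_sub[OF J Suc.prems] by auto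
    have split: "[1..<Suc l] = [1..<l] @ [l]" using False by simp
    have mem: "(l, x) \<in> J" using ideal_down[OF J Suc.prems] False b by auto
    have eq: "row_cycle n (marked n \<O> J) l x = cyc l x"
      using b by (intro row_cycle_marked[OF J mem] not_maximal[OF Suc.prems]) auto
    have "(l, cyc l x) \<in> J"
      using ideal_down[OF J mem] False b row_cycle_bounds[of l x n \<O>] by auto
    from Suc.IH[OF this] show ?thesis
      unfolding split head_def by (simp add: rows_prod_append rows_prod_Cons eq)
  qed (simp add: head_def)
qed (simp add: head_def)

text \<open>
  The factors of the rows after row \<open>i\<close> fix \<open>i\<close>, and the factor of row \<open>i\<close> moves it to the last
  marked column.
\<close>

lemma ideal_perm_row:
  assumes J: "J \<in> ideals n" and i: "(i, i) \<in> J"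
  shows "ideal_perm n \<O> J i = head i (row_max J i)"
proof -
  note rm = row_max_in[OF J i]
  have split: "[1..<Suc n] = [1..<i] @ i # [Suc i..<Suc n]"
    using rm upt_add_eq_append[of 1 i "Suc n - i"] upt_conv_Cons[of i "Suc n"] by simp
  have "{j. i \<le> j \<and> j \<le> n \<and> (j = i \<or> (i, j) \<in> marked n \<O> J)} = {j. (i, j) \<in> marked n \<O> J}"
    using diag_marked[OF i J] marked_sub ideal_sub[OF J] by blast
  then have start: "row_cycle n (marked n \<O> J) i i = row_max J i"
    using rm by (simp add: row_cycle_start row_max_def)
  have "rows_prod n (marked n \<O> J) [Suc i..<Suc n] i = i"
    by (rule rows_prod_fixes) auto
  then show ?thesis
    unfolding ideal_perm_def transp_prod_eq_rows_prod split
    by (simp add: rows_prod_append rows_prod_Cons start head_marked[OF J rm(1), simplified] del: upt_Suc)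
qed

lemma tau_head:
  assumes "1 \<le> i" "i \<le> Suc n" shows "tau n \<O> (head i x) = target i x"
proof -
  have split: "[1..<Suc n] = [1..<i] @ [i..<Suc n]"
    using assms by (metis le_SucI le_add_diff_inverse upt_add_eq_append)
  have "transp_prod n \<O> = head i \<circ> tail i"
    unfolding transp_prod_eq_rows_prod head_def tail_def by (subst split) (rule rows_prod_append)
  then have "tau n \<O> = inv_into UNIV (tail i) \<circ> inv_into UNIV (head i)"
    by (simp add: tau_def o_inv_distrib bij_rows_prod head_def tail_def)
  then show ?thesis by (simp add: bij_rows_prod bij_is_inj inv_f_f head_def)
qed

lemma tau_ideal_perm:
  assumes "J \<in> ideals n" "(i, i) \<in> J"
  shows "tau n \<O> (ideal_perm n \<O> J i) = target i (row_max J i)"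
  using row_max_in[OF assms] by (simp add: ideal_perm_row[OF assms] tau_head)

lemma row_max_principal:
  assumes "(i, j) \<in> tri n" shows "row_max (principal n (i, j)) i = j"
proof -
  have "(i, j) \<in> marked n \<O> (principal n (i, j))"
    using assms by (auto simp: marked_def maximals_def principal_def tri_le_def)
  moreover have "(i, j') \<in> marked n \<O> (principal n (i, j)) \<Longrightarrow> j' \<le> j" for j'
    using marked_sub by (fastforce simp: principal_def tri_le_def)
  ultimately show ?thesis
    unfolding row_max_def using finite_marked_row[OF principal_ideal[OF assms]]
    by (intro Max_eqI) auto
qed

lemma tau_r_index:
  assumes "(i, j) \<in> tri n" shows "tau n \<O> (r_index n \<O> i j) = target i j"
  using assms principal_ideal[OF assms] row_max_principal[OF assms]
  by (simp add: r_index_def tau_ideal_perm principal_def tri_le_def)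

lemma tail_permutes: "tail i permutes {i..n}"
  unfolding tail_def by (rule rows_prod_permutes)

lemma target_permutes: "target i permutes {i..n}"
  by (intro permutes_inv tail_permutes)

lemma tail_target [simp]: "tail i (target i x) = x"
  using tail_permutes permutes_inverses(1) by metis

lemma target_tail [simp]: "target i (tail i x) = x"
  using tail_permutes permutes_inverses(2) by metis

lemma tail_rec: "i \<le> n \<Longrightarrow> tail i x = cyc i (tail (Suc i) x)"
  by (simp add: tail_def upt_conv_Cons rows_prod_Cons del: upt_Suc)

lemma tail_ge: "i \<le> x \<Longrightarrow> x \<le> n \<Longrightarrow> i \<le> tail i x \<and> tail i x \<le> n"
  using permutes_in_image[OF tail_permutes, of i x] by simp

lemma target_ge: "i \<le> x \<Longrightarrow> x \<le> n \<Longrightarrow> i \<le> target i x \<and> target i x \<le> n"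
  using permutes_in_image[OF target_permutes, of i x] by simp

text \<open>
  In row \<open>a\<close> the value \<open>e\<close> corresponds to the last marked column. Passing to the next row undoes the
  cycle of row \<open>a\<close>: either the column moves to the next one of \<open>\<O>\<close> in row \<open>a\<close>, which is outside \<open>J\<close>, or
  it stays, and then it is not in \<open>\<O>\<close>, so its cell in row \<open>a\<close> is maximal. In both cases the cell of
  the new column in row \<open>a + 1\<close> is outside \<open>J\<close>. Afterwards columns never move to the left, so the cells
  stay outside. This makes the values assigned by \<open>J\<close> extremal in \<open>weight_maximal\<close>.
\<close>

lemma tail_outside_ideal:
  assumes J: "J \<in> ideals n" and a: "(a, a) \<in> J"
    and e: "e = target a (row_max J a)" and al: "a < l" "l \<le> e"
  shows "(l, tail l e) \<notin> J"
  using al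
proof (induction l)
  case (Suc l)
  note rm = row_max_in[OF J a]
  have e_n: "e \<le> n" using rm target_ge[of a "row_max J a"] e by auto
  define x where "x = tail (Suc l) e"
  have x: "Suc l \<le> x" "x \<le> n" using tail_ge[of "Suc l" e] Suc.prems e_n by (auto simp: x_def)
  have cx: "cyc l x = tail l e" using Suc.prems e_n by (simp add: x_def tail_rec)
  have "(Suc l, x) \<notin> J"
  proof
    assume in_J: "(Suc l, x) \<in> J"
    have mem: "(l, x) \<in> J"
      using ideal_down[OF J in_J] Suc.prems(1) rm(2) x by auto
    show False
    proof (cases "a = l")
      case True
      then have cx': "cyc a x = row_max J a" using cx e by simp
      have "(a, x) \<in> marked n \<O> J \<longleftrightarrow> (a, x) \<in> \<O>"
        using True mem not_maximal[OF in_J, of l x] x by (auto simp: marked_def)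
      moreover have "(a, x) \<in> \<O>"
      proof (rule ccontr)
        assume "(a, x) \<notin> \<O>"
        then have "cyc a x = x" using x True by (intro row_cycle_fixes) auto
        with cx' row_max_marked[OF J a] \<open>(a, x) \<in> marked n \<O> J \<longleftrightarrow> (a, x) \<in> \<O>\<close> \<open>(a, x) \<notin> \<O>\<close>
        show False by simp
      qed
      ultimately have "x \<le> row_max J a" using row_max_ge[OF J] by blast
      moreover have "cyc a x < x"
      proof -
        let ?S = "{j. a \<le> j \<and> j < x \<and> (j = a \<or> (a, j) \<in> \<O>)}"
        have "a \<in> ?S" "finite ?S" using x True by auto
        then have "Max ?S \<in> ?S" by (metis (no_types, lifting) Max_in empty_iff)
        then show ?thesis using row_cycle_step[of a x n \<O>] \<open>(a, x) \<in> \<O>\<close> x True by simp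
      qed
      ultimately show False using cx' by simp
    next
      case False
      then have "(l, tail l e) \<notin> J" using Suc by simp
      moreover have "(l, cyc l x) \<in> J"
        using ideal_down[OF J mem] ideal_sub[OF J mem] row_cycle_bounds[of l x n \<O>] x by auto
      ultimately show False using cx by simp
    qed
  qed
  then show ?case by (simp add: x_def)
qed simp

lemma row_max_less_tail:
  assumes J: "J \<in> ideals n" and a: "(a, a) \<in> J" and l: "(l, l) \<in> J"
    and e: "e = target a (row_max J a)" and al: "a < l" "l \<le> e"
  shows "row_max J l < tail l e"
proof (rule ccontr)
  assume "\<not> ?thesis"
  moreover have "e \<le> n" using row_max_in[OF J a] target_ge[of a "row_max J a"] e by auto
  ultimately have "(l, tail l e) \<in> J"
    using ideal_down[OF J row_max_in(1)[OF J l], of l "tail l e"] row_max_in[OF J l] tail_ge[of l e] al by auto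
  with tail_outside_ideal[OF J a e al] show False by simp
qed

end

section \<open>The unimodular transformation\<close>

lemma sum_fun_apply: "(\<Sum>i\<in>A. f i) x = (\<Sum>i\<in>A. f i x)"
  by (induction A rule: infinite_finite_induct) auto

lemma finite_tri [simp]: "finite (tri n)"
proof -
  have "tri n \<subseteq> {1..n} \<times> {1..n}" by (auto simp: tri_def)
  then show ?thesis by (rule finite_subset) simp
qed

lemma eps_apply: "eps i j p = (if p = (i, j) then 1 else 0)"
  by (simp add: eps_def indicator_def)

lemma coord_space_expand:
  assumes "x \<in> coord_space n" shows "x = (\<Sum>(i, j)\<in>tri n. x (i, j) *\<^sub>R eps i j)"
proof
  fix p
  have "(\<Sum>(i, j)\<in>tri n. x (i, j) *\<^sub>R eps i j) p = (\<Sum>q\<in>tri n. x q * (if p = q then 1 else 0))"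
    unfolding sum_fun_apply by (rule sum.cong) (auto simp: scaleR_fun_def eps_apply)
  also have "\<dots> = x p"
  proof (cases "p \<in> tri n")
    case True
    then have "(\<Sum>q\<in>tri n. x q * (if p = q then 1 else 0)) = (\<Sum>q\<in>{p}. x q)"
      by (intro sum.mono_neutral_cong_right) auto
    then show ?thesis by simp
  next
    case False
    then have "x p = 0" using assms unfolding coord_space_def by blast
    then show ?thesis using False by (auto intro!: sum.neutral)
  qed
  finally show "x p = (\<Sum>(i, j)\<in>tri n. x (i, j) *\<^sub>R eps i j) p" by simp
qed

lemma int_latticeD: "x \<in> int_lattice n \<Longrightarrow> x p \<in> \<int>"
  unfolding int_lattice_def by blast

lemma int_lattice_sub: "int_lattice n \<subseteq> coord_space n"
  unfolding int_lattice_def by blast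

lemma coord_spaceD: "x \<in> coord_space n \<Longrightarrow> p \<notin> tri n \<Longrightarrow> x p = 0"
  unfolding coord_space_def by blast

lemma int_lattice_sum:
  assumes "\<And>p. p \<in> A \<Longrightarrow> c p \<in> \<int>" and "\<And>p. p \<in> A \<Longrightarrow> u p \<in> int_lattice n"
  shows "(\<Sum>p\<in>A. c p *\<^sub>R u p) \<in> int_lattice n"
proof -
  have "(\<Sum>p\<in>A. c p *\<^sub>R u p) q \<in> \<int>" for q
    unfolding sum_fun_apply scaleR_fun_def
    unfolding real_scaleR_def by (intro Ints_sum Ints_mult int_latticeD[of _ n] assms(2) assms(1))
  moreover have "(\<Sum>p\<in>A. c p *\<^sub>R u p) q = 0" if "q \<notin> tri n" for q
    unfolding sum_fun_apply scaleR_fun_def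
    using coord_spaceD[OF _ that] assms(2) int_lattice_sub[of n]
    by (intro sum.neutral ballI) (simp add: subset_iff del: split_paired_All)
  ultimately show ?thesis unfolding int_lattice_def coord_space_def by blast
qed

lemma linear_coord_sum: "linear (\<lambda>x :: point. \<Sum>p\<in>A. x (g p) *\<^sub>R (u p :: point))"
proof (rule linearI)
  fix x y :: point and r :: real
  show "(\<Sum>p\<in>A. (x + y) (g p) *\<^sub>R u p) = (\<Sum>p\<in>A. x (g p) *\<^sub>R u p) + (\<Sum>p\<in>A. y (g p) *\<^sub>R u p)"
    by (simp only: plus_fun_apply[of x y] scaleR_add_left sum.distrib)
  show "(\<Sum>p\<in>A. (r *\<^sub>R x) (g p) *\<^sub>R u p) = r *\<^sub>R (\<Sum>p\<in>A. x (g p) *\<^sub>R u p)"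
    unfolding scaleR_sum_right scaleR_scaleR by (simp add: scaleR_fun_def)
qed

context marked_triangle
begin

text \<open>
  The marked cells of row \<open>i\<close> for an ideal whose last marked column there is \<open>b\<close>. These vectors form
  the basis that \<open>\<xi>\<close> maps to the standard one, up to a permutation in each row.
\<close>

definition chi :: "nat \<Rightarrow> nat \<Rightarrow> point" where
  "chi i b = indicator ({i} \<times> {b'. b' \<le> b \<and> ((i, b') \<in> \<O> \<union> diag n \<or> b' = b)})"

text \<open>
  The inverse of \<open>\<xi>\<close> on the coordinate space; it is integral because each \<open>chi i b\<close> is.
\<close>

definition xi_inv :: "point \<Rightarrow> point" where
  "xi_inv y = (\<Sum>(i, b)\<in>tri n. y (i, target i b) *\<^sub>R chi i b)"

lemma prev_marked:
  assumes "(i, j) \<in> tri n" "i < j"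
  shows "prev_marked n \<O> i j < j" "(i, prev_marked n \<O> i j) \<in> \<O> \<union> diag n"
    "\<And>b. b < j \<Longrightarrow> (i, b) \<in> \<O> \<union> diag n \<Longrightarrow> b \<le> prev_marked n \<O> i j"
    "i \<le> prev_marked n \<O> i j" "(i, prev_marked n \<O> i j) \<in> tri n"
proof -
  let ?S = "{j'. j' < j \<and> (i, j') \<in> \<O> \<union> diag n}"
  have "finite ?S" "i \<in> ?S" using assms by auto
  then have "Max ?S \<in> ?S" by (metis (no_types, lifting) Max_in empty_iff)
  then show 1: "prev_marked n \<O> i j < j" "(i, prev_marked n \<O> i j) \<in> \<O> \<union> diag n"
    by (auto simp: prev_marked_def)
  show 2: "b < j \<Longrightarrow> (i, b) \<in> \<O> \<union> diag n \<Longrightarrow> b \<le> prev_marked n \<O> i j" for b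
    unfolding prev_marked_def using \<open>finite ?S\<close> by (intro Max_ge) auto
  from 2[of i] assms show "i \<le> prev_marked n \<O> i j" by auto
  with 1 assms show "(i, prev_marked n \<O> i j) \<in> tri n" by auto
qed

lemma chi_diag: "(i, i) \<in> tri n \<Longrightarrow> chi i i = eps i i"
  by (rule ext) (auto simp: chi_def eps_apply indicator_def dest: O_D)

text \<open>
  This identity turns the difference in the definition of \<open>\<xi>\<close> into a telescoping sum along a row.
\<close>

lemma chi_prev:
  assumes "(i, j) \<in> tri n" "i < j"
  shows "chi i j = chi i (prev_marked n \<O> i j) + eps i j"
proof
  fix p :: "nat \<times> nat"
  note pm = prev_marked[OF assms]
  obtain i' b where p: "p = (i', b)" by fastforce
  have "b \<le> j \<and> ((i, b) \<in> \<O> \<union> diag n \<or> b = j) \<longleftrightarrow>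
    (b \<le> prev_marked n \<O> i j \<and> (i, b) \<in> \<O> \<union> diag n) \<or> b = j"
    using pm(1) pm(3)[of b] by (cases "b = j") auto
  then show "chi i j p = (chi i (prev_marked n \<O> i j) + eps i j) p"
    using pm(1,2) by (auto simp: p chi_def eps_apply indicator_def)
qed

lemma linear_xi: "linear (xi n \<O>)"
  unfolding xi_def split_def by (rule linear_coord_sum)

lemma linear_xi_inv: "linear xi_inv"
  unfolding xi_inv_def split_def by (rule linear_coord_sum)

lemma xi_eps_basis:
  assumes "(i, j) \<in> tri n" shows "xi n \<O> (eps i j) = xi_eps n \<O> i j"
proof -
  have "xi n \<O> (eps i j) = (\<Sum>p\<in>tri n. if p = (i, j) then xi_eps n \<O> i j else 0)"
    unfolding xi_def by (rule sum.cong) (auto simp: eps_apply)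
  then show ?thesis using assms by simp
qed

lemma xi_eps_target:
  assumes "(i, j) \<in> tri n"
  shows "xi_eps n \<O> i j =
    (if i = j then eps i (target i i)
     else eps i (target i j) - eps i (target i (prev_marked n \<O> i j)))"
  using assms prev_marked(5)[OF assms] by (auto simp: xi_eps_def tau_r_index)

lemma xi_chi:
  assumes "(i, b) \<in> tri n" shows "xi n \<O> (chi i b) = eps i (target i b)"
  using assms
proof (induction b rule: less_induct)
  case (less b)
  show ?case
  proof (cases "i = b")
    case True
    then show ?thesis using less.prems by (simp add: chi_diag xi_eps_basis xi_eps_target)
  next
    case False
    then have "i < b" using less.prems by auto
    note pm = prev_marked[OF less.prems this]
    have "xi n \<O> (chi i b) = xi n \<O> (chi i (prev_marked n \<O> i b)) + xi n \<O> (eps i b)"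
      using \<open>i < b\<close> less.prems by (simp add: chi_prev linear_add[OF linear_xi])
    then show ?thesis
      using less.IH[OF pm(1,5)] False less.prems by (simp add: xi_eps_basis xi_eps_target)
  qed
qed

lemma target_tri: "(i, b) \<in> tri n \<Longrightarrow> (i, target i b) \<in> tri n"
  using target_ge[of i b] by auto

lemma tail_tri: "(i, b) \<in> tri n \<Longrightarrow> (i, tail i b) \<in> tri n"
  using tail_ge[of i b] by auto

lemma xi_inv_eps:
  assumes "(i, b) \<in> tri n" shows "xi_inv (eps i (target i b)) = chi i b"
proof -
  have "eps i (target i b) (i', target i' b') *\<^sub>R chi i' b' = (if (i', b') = (i, b) then chi i b else 0)" for i' b'
    using inj_eq[OF permutes_inj[OF target_permutes[of i]], of b' b]
    by (cases "i' = i") (simp_all add: eps_apply)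
  then have "xi_inv (eps i (target i b)) = (\<Sum>(i', b')\<in>tri n. if (i', b') = (i, b) then chi i b else 0)"
    unfolding xi_inv_def by (simp only:)
  also have "\<dots> = (\<Sum>p\<in>tri n. if p = (i, b) then chi i b else 0)"
    by (simp only: split_def prod.collapse)
  also have "\<dots> = chi i b" using assms finite_tri by (simp only: sum.delta if_True)
  finally show ?thesis .
qed

lemma xi_inv_xi_eps:
  assumes "(i, j) \<in> tri n" shows "xi_inv (xi_eps n \<O> i j) = eps i j"
proof (cases "i = j")
  case True
  then show ?thesis using assms by (simp add: xi_eps_target xi_inv_eps chi_diag)
next
  case False
  then have "i < j" using assms by auto
  then show ?thesis
    using assms prev_marked(5)[OF assms] chi_prev[OF assms]
    by (simp add: xi_eps_target linear_diff[OF linear_xi_inv] xi_inv_eps)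
qed

lemma xi_inv_xi:
  assumes "x \<in> coord_space n" shows "xi_inv (xi n \<O> x) = x"
proof -
  have "xi_inv (xi n \<O> x) = (\<Sum>(i, j)\<in>tri n. x (i, j) *\<^sub>R xi_inv (xi_eps n \<O> i j))"
    unfolding xi_def by (simp only: linear_sum[OF linear_xi_inv] linear_cmul[OF linear_xi_inv] split_def)
  also have "\<dots> = (\<Sum>(i, j)\<in>tri n. x (i, j) *\<^sub>R eps i j)"
    by (intro sum.cong) (auto simp: xi_inv_xi_eps)
  also have "\<dots> = x" by (rule coord_space_expand[OF assms, symmetric])
  finally show ?thesis .
qed

lemma xi_xi_inv:
  assumes "y \<in> coord_space n" shows "xi n \<O> (xi_inv y) = y"
proof -
  have "xi n \<O> (xi_inv y) = (\<Sum>(i, b)\<in>tri n. y (i, target i b) *\<^sub>R xi n \<O> (chi i b))"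
    unfolding xi_inv_def by (simp only: linear_sum[OF linear_xi] linear_cmul[OF linear_xi] split_def)
  also have "\<dots> = (\<Sum>(i, b)\<in>tri n. y (i, target i b) *\<^sub>R eps i (target i b))"
    by (intro sum.cong) (auto simp: xi_chi)
  also have "\<dots> = (\<Sum>(i, e)\<in>tri n. y (i, e) *\<^sub>R eps i e)"
    by (rule sum.reindex_bij_witness[where j = "\<lambda>(i, b). (i, target i b)" and i = "\<lambda>(i, b). (i, tail i b)"])
      (auto simp del: tri_iff intro: target_tri tail_tri)
  also have "\<dots> = y" by (rule coord_space_expand[OF assms, symmetric])
  finally show ?thesis .
qed

lemma chi_lattice: "(i, b) \<in> tri n \<Longrightarrow> chi i b \<in> int_lattice n"
  by (auto simp: chi_def int_lattice_def coord_space_def indicator_def dest: O_D)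

lemma xi_eps_lattice:
  assumes "(i, j) \<in> tri n" shows "xi_eps n \<O> i j \<in> int_lattice n"
proof -
  have "(i, target i j) \<in> tri n" using assms by (rule target_tri)
  moreover have "(i, target i (prev_marked n \<O> i j)) \<in> tri n" if "i < j"
    using prev_marked(5)[OF assms that] by (rule target_tri)
  ultimately show ?thesis
    using assms by (auto simp: xi_eps_target int_lattice_def coord_space_def eps_apply)
qed

lemma xi_coord_space: "xi n \<O> x \<in> coord_space n"
  using xi_eps_lattice
  by (fastforce simp: xi_def coord_space_def int_lattice_def sum_fun_apply scaleR_fun_def split_def
      intro!: sum.neutral)

lemma xi_lattice:
  assumes "x \<in> int_lattice n" shows "xi n \<O> x \<in> int_lattice n"
  unfolding xi_def split_def using int_latticeD[OF assms] xi_eps_lattice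
  by (intro int_lattice_sum) (simp_all del: tri_iff)

lemma xi_inv_lattice:
  assumes "x \<in> int_lattice n" shows "xi_inv x \<in> int_lattice n"
  unfolding xi_inv_def split_def using int_latticeD[OF assms] chi_lattice
  by (intro int_lattice_sum) (simp_all del: tri_iff)

lemma unimodular_xi: "unimodular n (xi n \<O>)"
proof -
  have "bij_betw (xi n \<O>) (int_lattice n) (int_lattice n)"
  proof (rule bij_betw_byWitness[where f' = xi_inv])
    show "\<forall>x\<in>int_lattice n. xi_inv (xi n \<O> x) = x"
      using xi_inv_xi int_lattice_sub by blast
    show "\<forall>y\<in>int_lattice n. xi n \<O> (xi_inv y) = y"
      using xi_xi_inv int_lattice_sub by blast
  qed (use xi_lattice xi_inv_lattice in blast)+
  then show ?thesis
    unfolding unimodular_def using linear_xi xi_coord_space by blast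
qed

lemma inj_on_xi: "inj_on (xi n \<O>) (coord_space n)"
  by (rule inj_on_inverseI[where g = xi_inv]) (rule xi_inv_xi)

text \<open>
  The diagonal cells of a lower set are an initial segment of the diagonal.
\<close>

lemma ideals_of_diag:
  assumes "J \<in> ideals_of n k" shows "(i, i) \<in> J \<longleftrightarrow> 1 \<le> i \<and> i \<le> k"
proof -
  have J: "J \<in> ideals n" and card: "card (J \<inter> diag n) = k"
    using assms by (auto simp: ideals_of_def)
  let ?D = "{i. (i, i) \<in> J}"
  have "J \<inter> diag n = (\<lambda>i. (i, i)) ` ?D"
    using ideal_sub[OF J] by (auto simp: diag_def)
  with card have card': "card ?D = k"
    by (metis (no_types, lifting) card_image inj_onI prod.inject)
  have fin: "finite ?D"
    by (rule finite_subset[of _ "{..n}"]) (use ideal_sub[OF J] in auto)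
  have "i \<le> k" if "i \<in> ?D" for i
  proof -
    have "{1..i} \<subseteq> ?D" using that ideal_down[OF J] by auto
    then have "card {1..i} \<le> card ?D" by (rule card_mono[OF fin])
    then show ?thesis unfolding card' by simp
  qed
  then have "?D \<subseteq> {1..k}" using ideal_sub[OF J] by auto
  then have "?D = {1..k}" using card' by (intro card_subset_eq) auto
  then show ?thesis by auto
qed

lemma marked_iff:
  assumes J: "J \<in> ideals n"
  shows "(i, j) \<in> marked n \<O> J \<longleftrightarrow>
    (i, i) \<in> J \<and> j \<le> row_max J i \<and> ((i, j) \<in> \<O> \<union> diag n \<or> j = row_max J i)"
proof
  assume m: "(i, j) \<in> marked n \<O> J"
  then have mJ: "(i, j) \<in> J" using marked_sub by auto
  then have ii: "(i, i) \<in> J" using ideal_down[OF J mJ, of i i] ideal_sub[OF J mJ] by auto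
  have le: "j \<le> row_max J i" using row_max_ge[OF J m] .
  have "j = row_max J i" if "(i, j) \<notin> \<O> \<union> diag n"
  proof -
    have "(i, j) \<in> maximals J" using m that by (auto simp: marked_def)
    then show ?thesis using not_maximal[OF row_max_in(1)[OF J ii], of i j] le by auto
  qed
  then show "(i, i) \<in> J \<and> j \<le> row_max J i \<and> ((i, j) \<in> \<O> \<union> diag n \<or> j = row_max J i)"
    using ii le by blast
next
  assume *: "(i, i) \<in> J \<and> j \<le> row_max J i \<and> ((i, j) \<in> \<O> \<union> diag n \<or> j = row_max J i)"
  show "(i, j) \<in> marked n \<O> J"
  proof (cases "j = row_max J i")
    case True
    then show ?thesis using row_max_marked[OF J] * by simp
  next
    case False
    then have O: "(i, j) \<in> \<O> \<union> diag n" using * by simp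
    then have "1 \<le> i" "i \<le> j" using O_D by fastforce+
    then have "(i, j) \<in> J" using ideal_down[OF J row_max_in(1)[OF J]] * by blast
    then show ?thesis using O by (auto simp: marked_def)
  qed
qed

lemma indicator_marked:
  assumes "J \<in> ideals_of n k"
  shows "indicator (marked n \<O> J) = (\<Sum>i = 1..k. chi i (row_max J i))"
proof
  fix p :: "nat \<times> nat"
  obtain i j where p: "p = (i, j)" by fastforce
  have J: "J \<in> ideals n" using assms by (simp add: ideals_of_def)
  have "(\<Sum>i' = 1..k. chi i' (row_max J i')) p
      = (\<Sum>i'\<in>{1..k}. if i' = i then (chi i (row_max J i)) (i, j) else 0)"
    unfolding sum_fun_apply p by (rule sum.cong) (auto simp: chi_def)
  then show "indicator (marked n \<O> J) p = (\<Sum>i = 1..k. chi i (row_max J i)) p"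
    using marked_iff[OF J, of i j] ideals_of_diag[OF assms, of i]
    by (auto simp: p chi_def indicator_def)
qed

lemma row_max_tri:
  assumes "J \<in> ideals_of n k" "1 \<le> i" "i \<le> k" shows "(i, row_max J i) \<in> tri n"
  using row_max_in[of J i] assms ideals_of_diag[OF assms(1), of i] by (auto simp: ideals_of_def)

lemma xi_indicator_marked:
  assumes "J \<in> ideals_of n k"
  shows "xi n \<O> (indicator (marked n \<O> J)) = (\<Sum>i = 1..k. eps i (target i (row_max J i)))"
  unfolding indicator_marked[OF assms] linear_sum[OF linear_xi]
  using row_max_tri[OF assms] by (intro sum.cong) (auto simp: xi_chi)

lemma xi_fund: "xi n \<O> ` fund_chain_order n \<O> k = fund_Pi n \<O> k"
proof -
  have "xi n \<O> (indicator (marked n \<O> J)) = (\<Sum>i = 1..k. eps i (tau n \<O> (ideal_perm n \<O> J i)))"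
    if "J \<in> ideals_of n k" for J
    unfolding xi_indicator_marked[OF that]
    using that ideals_of_diag[OF that] by (intro sum.cong) (auto simp: tau_ideal_perm ideals_of_def)
  then show ?thesis
    unfolding fund_chain_order_def fund_Pi_def convex_hull_linear_image[OF linear_xi] image_image
    by (intro arg_cong[where f = "(hull) convex"] image_cong refl)
qed

lemma xi_chain_order: "xi n \<O> ` chain_order n \<O> a = Pi_polytope n \<O> a"
proof -
  have plus: "f ` (A + B) = f ` A + f ` B" if "linear f" for f :: "point \<Rightarrow> point" and A B
    using that by (force simp: set_plus_def linear_add)
  have zero: "xi n \<O> ` 0 = 0"
    by (simp only: set_zero image_insert image_empty linear_0[OF linear_xi])
  have im: "xi n \<O> ` (\<Sum>k\<in>K. S k) = (\<Sum>k\<in>K. xi n \<O> ` S k)" for K :: "nat set" and S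
    by (induction K rule: infinite_finite_induct)
      (simp_all only: sum.infinite sum.empty sum.insert plus[OF linear_xi] zero not_False_eq_True)
  show ?thesis
    unfolding chain_order_def Pi_polytope_def im xi_fund[symmetric] image_image
    by (simp add: linear_cmul[OF linear_xi])
qed

end

section \<open>Lattice points as sums over chains of ideals\<close>

text \<open>
  The weight \<open>\<lambda>\<close> is read as a Young diagram: \<open>row_len n a i\<close> is the length of its row \<open>i\<close> and
  \<open>height n a t\<close> the height of its column \<open>t\<close>, with columns counted from 0 and rows from 1.
\<close>

lemma initial_segment_eq:
  fixes D :: "nat set"
  assumes "finite D" "\<And>i j. i \<in> D \<Longrightarrow> 1 \<le> j \<Longrightarrow> j \<le> i \<Longrightarrow> j \<in> D" "0 \<notin> D"
  shows "D = {1..card D}"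
proof -
  have "i \<le> card D" if "i \<in> D" for i
  proof -
    have "{1..i} \<subseteq> D" using that assms(2) by auto
    then have "card {1..i} \<le> card D" by (rule card_mono[OF assms(1)])
    then show ?thesis by simp
  qed
  moreover have "1 \<le> i" if "i \<in> D" for i
    using that assms(3) by (cases i) auto
  ultimately have "D \<subseteq> {1..card D}" by auto
  then show ?thesis by (intro card_subset_eq) auto
qed

definition row_len :: "nat \<Rightarrow> (nat \<Rightarrow> nat) \<Rightarrow> nat \<Rightarrow> nat" where
  "row_len n a i = (\<Sum>k = i..<n. a k)"

definition height :: "nat \<Rightarrow> (nat \<Rightarrow> nat) \<Rightarrow> nat \<Rightarrow> nat" where
  "height n a t = card {i. 1 \<le> i \<and> i < n \<and> t < row_len n a i}"

lemma row_len_antimono: "i \<le> j \<Longrightarrow> row_len n a j \<le> row_len n a i"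
  unfolding row_len_def by (rule sum_mono2) auto

lemma row_len_Suc: "k < n \<Longrightarrow> row_len n a k = a k + row_len n a (Suc k)"
  unfolding row_len_def by (simp add: sum.atLeast_Suc_lessThan)

lemma row_len_n [simp]: "row_len n a n = 0"
  by (simp add: row_len_def)

lemma le_height_iff:
  assumes "1 \<le> i" shows "i \<le> height n a t \<longleftrightarrow> i < n \<and> t < row_len n a i"
proof -
  let ?D = "{i. 1 \<le> i \<and> i < n \<and> t < row_len n a i}"
  have "?D = {1..card ?D}"
  proof (rule initial_segment_eq)
    fix i j assume "i \<in> ?D" "1 \<le> j" "j \<le> i"
    then show "j \<in> ?D" using row_len_antimono[of j i n a] by auto
  qed auto
  then have "i \<in> ?D \<longleftrightarrow> i \<in> {1..height n a t}" by (simp only: height_def)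
  then show ?thesis using assms by auto
qed

lemma height_eq_iff:
  assumes "1 \<le> k" "k < n"
  shows "height n a t = k \<longleftrightarrow> row_len n a (Suc k) \<le> t \<and> t < row_len n a k"
proof -
  have "height n a t = k \<longleftrightarrow> k \<le> height n a t \<and> \<not> Suc k \<le> height n a t" by auto
  moreover have "\<not> (Suc k < n \<and> t < row_len n a (Suc k)) \<longleftrightarrow> row_len n a (Suc k) \<le> t"
    using assms by (cases "Suc k = n") auto
  ultimately show ?thesis using assms le_height_iff[of k n a t] le_height_iff[of "Suc k" n a t] by auto
qed

lemma height_bounds:
  assumes "1 < n" "t < row_len n a 1" shows "1 \<le> height n a t" "height n a t < n"
proof -
  show 1: "1 \<le> height n a t" using assms le_height_iff[of 1 n a t] by simp
  show "height n a t < n" using le_height_iff[of "height n a t" n a t] 1 by simp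
qed

lemma sum_levels:
  assumes "y \<in> \<int>" "0 \<le> y" "y \<le> real M"
  shows "(\<Sum>t<M. if real t + 1 \<le> y then 1 else 0) = y"
proof -
  obtain m where m: "y = real m"
    using assms by (metis Ints_cases of_int_0_le_iff of_int_of_nat_eq zero_le_imp_eq_int)
  have "(\<Sum>t<M. if real t + 1 \<le> y then 1 else 0) = (\<Sum>t<M. if t \<in> {..<m} then 1 else (0::real))"
    using m by (intro sum.cong) auto
  also have "\<dots> = real (card ({..<M} \<inter> {..<m}))"
    by (simp add: sum.If_cases) (simp add: lessThan_def)
  also have "{..<M} \<inter> {..<m} = {..<m}" using assms m by auto
  finally show ?thesis using m by simp
qed

context marked_triangle
begin

text \<open>
  The transfer map sends an order-reversing function \<open>y\<close> to the point with coordinate \<open>y p\<close> at cells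
  of \<open>\<O>\<close> and the diagonal and \<open>y p\<close> minus the maximum of \<open>y\<close> over the cells covering \<open>p\<close> elsewhere; the
  function below is its inverse. It is convex and positively homogeneous in \<open>x\<close> and takes the vertex of
  an ideal to the indicator function of that ideal. Cells
  outside the triangle have value 0, so that a cell in the last column is treated like the others.
\<close>

function transfer_inv :: "point \<Rightarrow> nat \<Rightarrow> nat \<Rightarrow> real" where
  "transfer_inv x i j =
    (if (i, j) \<notin> tri n then 0
     else if (i, j) \<in> \<O> \<union> diag n then x (i, j)
     else x (i, j) + max (transfer_inv x (Suc i) j) (transfer_inv x i (Suc j)))"
  by pat_completeness auto
termination
  by (relation "measure (\<lambda>(x, i, j). (Suc n - j) + (Suc n - i))") auto

declare transfer_inv.simps [simp del]

lemma transfer_inv_outside: "(i, j) \<notin> tri n \<Longrightarrow> transfer_inv x i j = 0"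
  by (subst transfer_inv.simps) (simp del: tri_iff)

lemma transfer_inv_marked: "(i, j) \<in> tri n \<Longrightarrow> (i, j) \<in> \<O> \<union> diag n \<Longrightarrow> transfer_inv x i j = x (i, j)"
  by (subst transfer_inv.simps) (simp del: tri_iff)

lemma transfer_inv_unmarked:
  "(i, j) \<in> tri n \<Longrightarrow> (i, j) \<notin> \<O> \<union> diag n \<Longrightarrow>
    transfer_inv x i j = x (i, j) + max (transfer_inv x (Suc i) j) (transfer_inv x i (Suc j))"
  by (subst transfer_inv.simps) (simp only: if_False if_True not_True_eq_False not_False_eq_True)

lemma transfer_inv_add_le: "transfer_inv (x + y) i j \<le> transfer_inv x i j + transfer_inv y i j"
proof (induction x i j rule: transfer_inv.induct)
  case (1 x i j)
  consider "(i, j) \<notin> tri n" | "(i, j) \<in> tri n" "(i, j) \<in> \<O> \<union> diag n"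
    | "(i, j) \<in> tri n" "(i, j) \<notin> \<O> \<union> diag n" by blast
  then show ?case
  proof cases
    case 3
    have "transfer_inv (x + y) (Suc i) j \<le> transfer_inv x (Suc i) j + transfer_inv y (Suc i) j"
      "transfer_inv (x + y) i (Suc j) \<le> transfer_inv x i (Suc j) + transfer_inv y i (Suc j)"
      using 1 3 by blast+
    then show ?thesis
      unfolding transfer_inv_unmarked[OF 3] plus_fun_apply by (auto simp: max_def)
  qed (simp_all add: transfer_inv_outside transfer_inv_marked del: tri_iff)
qed

lemma transfer_inv_scale: "0 \<le> c \<Longrightarrow> transfer_inv (c *\<^sub>R x) i j = c * transfer_inv x i j"
proof (induction x i j rule: transfer_inv.induct)
  case (1 x i j)
  consider "(i, j) \<notin> tri n" | "(i, j) \<in> tri n" "(i, j) \<in> \<O> \<union> diag n"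
    | "(i, j) \<in> tri n" "(i, j) \<notin> \<O> \<union> diag n" by blast
  then show ?case
  proof cases
    case 3
    then show ?thesis using 1
      by (simp add: transfer_inv_unmarked scaleR_fun_def distrib_left max_mult_distrib_left del: tri_iff)
  qed (simp_all add: transfer_inv_outside transfer_inv_marked scaleR_fun_def del: tri_iff)
qed

lemma transfer_inv_Ints: "x \<in> int_lattice n \<Longrightarrow> transfer_inv x i j \<in> \<int>"
proof (induction x i j rule: transfer_inv.induct)
  case (1 x i j)
  consider "(i, j) \<notin> tri n" | "(i, j) \<in> tri n" "(i, j) \<in> \<O> \<union> diag n"
    | "(i, j) \<in> tri n" "(i, j) \<notin> \<O> \<union> diag n" by blast
  then show ?case
  proof cases
    case 3
    then show ?thesis using 1 by (simp add: transfer_inv_unmarked int_latticeD[OF 1(3)] max_def Ints_add del: tri_iff)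
  qed (simp_all add: transfer_inv_outside transfer_inv_marked int_latticeD[OF 1(3)] del: tri_iff)
qed

text \<open>
  A cell off \<open>\<O>\<close> and the diagonal is marked iff it is maximal in \<open>J\<close>, that is, iff it lies in \<open>J\<close> and
  neither of the two cells covering it does.
\<close>

lemma indicator_marked_unmarked:
  assumes J: "J \<in> ideals n" and p: "(i, j) \<in> tri n" "(i, j) \<notin> \<O> \<union> diag n"
  shows "(indicator (marked n \<O> J) (i, j) :: real) =
    indicator J (i, j) - max (indicator J (Suc i, j)) (indicator J (i, Suc j))"
proof -
  have ij: "1 \<le> i" "i < j" "j \<le> n" using p by auto
  have eq: "(i, j) \<in> marked n \<O> J \<longleftrightarrow> (i, j) \<in> maximals J"
    using p by (auto simp: marked_def)
  show ?thesis
  proof (cases "(Suc i, j) \<in> J \<or> (i, Suc j) \<in> J")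
    case True
    then have "(i, j) \<in> J" using ideal_down[OF J, of "Suc i" j i j] ideal_down[OF J, of i "Suc j" i j] ij by auto
    moreover have "(i, j) \<notin> maximals J"
      using True not_maximal[of "Suc i" j J i j] not_maximal[of i "Suc j" J i j] by auto
    ultimately show ?thesis using True eq by (auto simp: indicator_def)
  next
    case False
    have "(i, j) \<in> maximals J" if "(i, j) \<in> J"
      unfolding maximals_def
    proof (intro CollectI conjI ballI impI that)
      fix q assume q: "q \<in> J" "tri_le (i, j) q"
      obtain i' j' where [simp]: "q = (i', j')" by fastforce
      have "i' = i" using ideal_down[OF J, of i' j' "Suc i" j] q False ij
        by (cases "i' = i") (auto simp: tri_le_def)
      moreover have "j' = j" using ideal_down[OF J, of i' j' i "Suc j"] q False ij
        by (cases "j' = j") (auto simp: tri_le_def)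
      ultimately show "q = (i, j)" by simp
    qed
    moreover have "maximals J \<subseteq> J" by (auto simp: maximals_def)
    ultimately show ?thesis using False eq by (auto simp: indicator_def)
  qed
qed

lemma indicator_marked_marked:
  "(i, j) \<in> \<O> \<union> diag n \<Longrightarrow> indicator (marked n \<O> J) (i, j) = indicator J (i, j)"
  by (auto simp: marked_def maximals_def indicator_def)

lemma transfer_inv_indicator:
  assumes J: "J \<in> ideals n"
  shows "transfer_inv (indicator (marked n \<O> J)) i j = indicator J (i, j)"
proof -
  have "x = indicator (marked n \<O> J) \<Longrightarrow> transfer_inv x i j = indicator J (i, j)" for x
  proof (induction x i j rule: transfer_inv.induct)
    case (1 x i j)
    consider "(i, j) \<notin> tri n" | "(i, j) \<in> tri n" "(i, j) \<in> \<O> \<union> diag n"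
      | "(i, j) \<in> tri n" "(i, j) \<notin> \<O> \<union> diag n" by blast
    then show ?case
    proof cases
      case 1
      then have "(i, j) \<notin> J" using J by (auto simp: ideals_def)
      with 1 show ?thesis by (simp add: transfer_inv_outside del: tri_iff)
    next
      case 2
      then show ?thesis using 1 by (simp add: transfer_inv_marked indicator_marked_marked del: tri_iff)
    next
      case 3
      then show ?thesis using 1 by (simp add: transfer_inv_unmarked indicator_marked_unmarked[OF J] del: tri_iff)
    qed
  qed
  then show ?thesis by simp
qed

text \<open>
  The inequalities saying that the inverse transfer of \<open>x\<close> is order-reversing. They define a convex cone
  because the inverse transfer is convex, so it suffices to check them at the vertices.
\<close>

definition order_cone :: "point set" where
  "order_cone = {x. \<forall>i j. (i, j) \<in> tri n \<longrightarrow>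
     (if (i, j) \<in> \<O> \<union> diag n then transfer_inv x (Suc i) j \<le> x (i, j) \<and> transfer_inv x i (Suc j) \<le> x (i, j)
      else 0 \<le> x (i, j))}"

lemma order_cone_add:
  assumes "x \<in> order_cone" "y \<in> order_cone" shows "x + y \<in> order_cone"
  unfolding order_cone_def
proof (intro CollectI allI impI)
  fix i j assume t: "(i, j) \<in> tri n"
  have 1: "if (i, j) \<in> \<O> \<union> diag n then transfer_inv x (Suc i) j \<le> x (i, j) \<and> transfer_inv x i (Suc j) \<le> x (i, j)
      else 0 \<le> x (i, j)"
    and 2: "if (i, j) \<in> \<O> \<union> diag n then transfer_inv y (Suc i) j \<le> y (i, j) \<and> transfer_inv y i (Suc j) \<le> y (i, j)
      else 0 \<le> y (i, j)"
    using assms t unfolding order_cone_def by blast+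
  then show "if (i, j) \<in> \<O> \<union> diag n
      then transfer_inv (x + y) (Suc i) j \<le> (x + y) (i, j) \<and> transfer_inv (x + y) i (Suc j) \<le> (x + y) (i, j)
      else 0 \<le> (x + y) (i, j)"
    using transfer_inv_add_le[of x y "Suc i" j] transfer_inv_add_le[of x y i "Suc j"] by (auto split: if_splits)
qed

lemma order_cone_scale:
  assumes "x \<in> order_cone" "0 \<le> c" shows "c *\<^sub>R x \<in> order_cone"
  unfolding order_cone_def
proof (intro CollectI allI impI)
  fix i j assume t: "(i, j) \<in> tri n"
  have "if (i, j) \<in> \<O> \<union> diag n then transfer_inv x (Suc i) j \<le> x (i, j) \<and> transfer_inv x i (Suc j) \<le> x (i, j)
      else 0 \<le> x (i, j)"
    using assms t unfolding order_cone_def by blast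
  moreover have val: "(c *\<^sub>R x) (i, j) = c * x (i, j)" by (simp add: scaleR_fun_def)
  ultimately show "if (i, j) \<in> \<O> \<union> diag n
      then transfer_inv (c *\<^sub>R x) (Suc i) j \<le> (c *\<^sub>R x) (i, j) \<and> transfer_inv (c *\<^sub>R x) i (Suc j) \<le> (c *\<^sub>R x) (i, j)
      else 0 \<le> (c *\<^sub>R x) (i, j)"
    using assms(2) by (auto simp: transfer_inv_scale[OF assms(2)] val mult_left_mono split: if_splits)
qed

lemma transfer_inv_zero [simp]: "transfer_inv 0 i j = 0"
  using transfer_inv_scale[of 0 0 i j] by simp

lemma order_cone_zero: "0 \<in> order_cone"
  by (auto simp: order_cone_def)

lemma order_cone_sum: "(\<And>k. k \<in> K \<Longrightarrow> f k \<in> order_cone) \<Longrightarrow> sum f K \<in> order_cone"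
  by (induction K rule: infinite_finite_induct) (simp_all only: sum.infinite sum.empty sum.insert
      order_cone_zero order_cone_add insert_iff HOL.simp_thms)

lemma indicator_marked_order_cone:
  assumes J: "J \<in> ideals n" shows "indicator (marked n \<O> J) \<in> order_cone"
  unfolding order_cone_def
proof (intro CollectI allI impI)
  fix i j assume t: "(i, j) \<in> tri n"
  have "(i, j) \<in> J" if "(Suc i, j) \<in> J \<or> (i, Suc j) \<in> J"
    using that t ideal_down[OF J, of "Suc i" j i j] ideal_down[OF J, of i "Suc j" i j] by auto
  then show "if (i, j) \<in> \<O> \<union> diag n
      then transfer_inv (indicator (marked n \<O> J)) (Suc i) j \<le> indicator (marked n \<O> J) (i, j) \<and>
        transfer_inv (indicator (marked n \<O> J)) i (Suc j) \<le> indicator (marked n \<O> J) (i, j)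
      else 0 \<le> (indicator (marked n \<O> J) (i, j) :: real)"
    using indicator_marked_marked[of i j J] by (simp only: transfer_inv_indicator[OF J] split: if_split)
      (auto simp: indicator_def)
qed

lemma fund_order_cone: "fund_chain_order n \<O> k \<subseteq> order_cone"
  unfolding fund_chain_order_def
proof (rule hull_minimal)
  show "(\<lambda>J. indicator (marked n \<O> J)) ` ideals_of n k \<subseteq> order_cone"
    using indicator_marked_order_cone by (auto simp: ideals_of_def)
  show "convex order_cone"
    unfolding convex_def using order_cone_add order_cone_scale by blast
qed

lemma fund_diag:
  assumes "x \<in> fund_chain_order n \<O> k" "1 \<le> i" "i \<le> n"
  shows "x (i, i) = (if i \<le> k then 1 else 0)"
proof -
  let ?S = "{x :: point. x (i, i) = (if i \<le> k then 1 else 0)}"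
  have "fund_chain_order n \<O> k \<subseteq> ?S"
    unfolding fund_chain_order_def
  proof (rule hull_minimal)
    have "indicator (marked n \<O> J) (i, i) = (if i \<le> k then 1 else (0::real))"
      if "J \<in> ideals_of n k" for J
      using indicator_marked_marked[of i i J] ideals_of_diag[OF that, of i] assms by (auto simp: indicator_def)
    then show "(\<lambda>J. indicator (marked n \<O> J)) ` ideals_of n k \<subseteq> ?S" by auto
    show "convex ?S"
      unfolding convex_def by (auto simp: scaleR_fun_def)
  qed
  then show ?thesis using assms by auto
qed

lemma chain_order_decompose:
  assumes "x \<in> chain_order n \<O> a"
  shows "\<exists>y. x = (\<Sum>k = 1..<n. real (a k) *\<^sub>R y k) \<and>
    (\<forall>k\<in>{1..<n}. y k \<in> fund_chain_order n \<O> k)"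
proof -
  from assms obtain s where s: "x = sum s {1..<n}"
    "\<forall>k\<in>{1..<n}. s k \<in> (\<lambda>x. real (a k) *\<^sub>R x) ` fund_chain_order n \<O> k"
    unfolding chain_order_def by (auto simp: set_sum_alt)
  then have "\<forall>k\<in>{1..<n}. \<exists>y. y \<in> fund_chain_order n \<O> k \<and> s k = real (a k) *\<^sub>R y" by blast
  then obtain y where y: "\<And>k. k \<in> {1..<n} \<Longrightarrow> y k \<in> fund_chain_order n \<O> k \<and> s k = real (a k) *\<^sub>R y k"
    by metis
  have "x = (\<Sum>k = 1..<n. real (a k) *\<^sub>R y k)"
    unfolding s(1) by (rule sum.cong) (use y in blast)+
  then show ?thesis using y by blast
qed

lemma chain_order_cone: "chain_order n \<O> a \<subseteq> order_cone"
proof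
  fix x assume "x \<in> chain_order n \<O> a"
  then obtain y where y: "x = (\<Sum>k = 1..<n. real (a k) *\<^sub>R y k)"
    "\<And>k. k \<in> {1..<n} \<Longrightarrow> y k \<in> fund_chain_order n \<O> k"
    using chain_order_decompose by blast
  show "x \<in> order_cone"
    unfolding y(1)
  proof (intro order_cone_sum order_cone_scale)
    fix k assume "k \<in> {1..<n}"
    then show "y k \<in> order_cone" by (intro subsetD[OF fund_order_cone[of k]] y(2))
  qed simp
qed

lemma chain_order_diag:
  assumes "x \<in> chain_order n \<O> a" "1 \<le> i" "i \<le> n"
  shows "x (i, i) = real (row_len n a i)"
proof -
  obtain y where y: "x = (\<Sum>k = 1..<n. real (a k) *\<^sub>R y k)"
    "\<And>k. k \<in> {1..<n} \<Longrightarrow> y k \<in> fund_chain_order n \<O> k"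
    using chain_order_decompose[OF assms(1)] by blast
  have "x (i, i) = (\<Sum>k = 1..<n. real (a k) * (if i \<le> k then 1 else 0))"
    unfolding y(1) sum_fun_apply scaleR_fun_def
    by (intro sum.cong) (auto simp: fund_diag[OF y(2) assms(2,3)])
  also have "\<dots> = (\<Sum>k\<in>{i..<n}. real (a k))"
    using assms(2) by (intro sum.mono_neutral_cong_right) auto
  finally show ?thesis by (simp add: row_len_def)
qed

lemma transfer_inv_antimono_covers:
  assumes "x \<in> order_cone" "(i, j) \<in> tri n"
  shows "transfer_inv x (Suc i) j \<le> transfer_inv x i j" "transfer_inv x i (Suc j) \<le> transfer_inv x i j"
proof -
  have *: "if (i, j) \<in> \<O> \<union> diag n then transfer_inv x (Suc i) j \<le> x (i, j) \<and> transfer_inv x i (Suc j) \<le> x (i, j)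
      else 0 \<le> x (i, j)"
    using assms unfolding order_cone_def by blast
  have "transfer_inv x (Suc i) j \<le> transfer_inv x i j \<and> transfer_inv x i (Suc j) \<le> transfer_inv x i j"
  proof (cases "(i, j) \<in> \<O> \<union> diag n")
    case True
    then show ?thesis using * transfer_inv_marked[OF assms(2)] by simp
  next
    case False
    then have "0 \<le> x (i, j)" using * by simp
    then show ?thesis using transfer_inv_unmarked[OF assms(2) False, of x] by (auto simp: max_def)
  qed
  then show "transfer_inv x (Suc i) j \<le> transfer_inv x i j" "transfer_inv x i (Suc j) \<le> transfer_inv x i j" by auto
qed

lemma transfer_inv_antimono_col:
  assumes "x \<in> order_cone" "(i, j) \<in> tri n" "j \<le> j'" "j' \<le> Suc n"
  shows "transfer_inv x i j' \<le> transfer_inv x i j"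
  using assms(3,4)
proof (induction j' rule: dec_induct)
  case (step m)
  then have "(i, m) \<in> tri n" using assms(2) by auto
  from transfer_inv_antimono_covers(2)[OF assms(1) this] show ?case using step by simp
qed simp

lemma transfer_inv_antimono_row:
  assumes "x \<in> order_cone" "1 \<le> i" "i \<le> i'" "i' \<le> j" "j \<le> n"
  shows "transfer_inv x i' j \<le> transfer_inv x i j"
  using assms(3,4)
proof (induction i' rule: dec_induct)
  case (step m)
  then have "(m, j) \<in> tri n" using assms by auto
  from transfer_inv_antimono_covers(1)[OF assms(1) this] show ?case using step by simp
qed simp

lemma transfer_inv_nonneg: "x \<in> order_cone \<Longrightarrow> 0 \<le> transfer_inv x i j"
  using transfer_inv_antimono_col[of x i j "Suc n"] transfer_inv_outside[of i "Suc n"] transfer_inv_outside[of i j x]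
  by (cases "(i, j) \<in> tri n") auto

lemma transfer_inv_antimono:
  assumes "x \<in> order_cone" "(i, j) \<in> tri n" "(i', j') \<in> tri n" "i \<le> i'" "j \<le> j'"
  shows "transfer_inv x i' j' \<le> transfer_inv x i j"
  using transfer_inv_antimono_row[of x i i' j'] transfer_inv_antimono_col[of x i j j'] assms by auto

definition level :: "point \<Rightarrow> nat \<Rightarrow> (nat \<times> nat) set" where
  "level x t = {(i, j). (i, j) \<in> tri n \<and> real t + 1 \<le> transfer_inv x i j}"

lemma level_ideal: "x \<in> order_cone \<Longrightarrow> level x t \<in> ideals n"
  unfolding ideals_def level_def tri_le_def
  using transfer_inv_antimono by (fastforce simp del: tri_iff)

lemma ideals_ofI:
  assumes J: "J \<in> ideals n" and d: "\<And>i. 1 \<le> i \<Longrightarrow> i \<le> n \<Longrightarrow> (i, i) \<in> J \<longleftrightarrow> i \<le> k" and "k \<le> n"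
  shows "J \<in> ideals_of n k"
proof -
  have "J \<inter> diag n = (\<lambda>i. (i, i)) ` {1..k}"
    using d \<open>k \<le> n\<close> by (auto simp: diag_def)
  then have "card (J \<inter> diag n) = k" by (simp add: card_image inj_on_def)
  then show ?thesis using J by (simp add: ideals_of_def)
qed

lemma level_ideals_of:
  assumes x: "x \<in> chain_order n \<O> a" and n: "1 < n"
  shows "level x t \<in> ideals_of n (height n a t)"
proof (rule ideals_ofI)
  have cone: "x \<in> order_cone" using x chain_order_cone by auto
  show "level x t \<in> ideals n" by (rule level_ideal[OF cone])
  have h: "height n a t < n"
    using le_height_iff[of "height n a t" n a t] n by (cases "height n a t = 0") auto
  then show "height n a t \<le> n" by simp
  fix i assume i: "1 \<le> i" "i \<le> n"
  have "transfer_inv x i i = real (row_len n a i)"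
    using i chain_order_diag[OF x i] by (subst transfer_inv_marked) auto
  then have "(i, i) \<in> level x t \<longleftrightarrow> t < row_len n a i"
    using i by (auto simp: level_def)
  also have "\<dots> \<longleftrightarrow> i \<le> height n a t"
    using le_height_iff[OF i(1), of n a t] i by (cases "i = n") auto
  finally show "(i, i) \<in> level x t \<longleftrightarrow> i \<le> height n a t" .
qed

lemma sum_level:
  assumes x: "x \<in> chain_order n \<O> a" "x \<in> int_lattice n" and n: "1 < n"
    and p: "(i, j) \<in> tri n"
  shows "(\<Sum>t<row_len n a 1. indicator (level x t) (i, j)) = transfer_inv x i j"
proof -
  have cone: "x \<in> order_cone" using x chain_order_cone by auto
  have "transfer_inv x i j \<le> transfer_inv x 1 1"
    using p by (intro transfer_inv_antimono[OF cone]) auto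
  also have "\<dots> = real (row_len n a 1)"
    using n chain_order_diag[OF x(1), of 1] by (subst transfer_inv_marked) auto
  finally have "transfer_inv x i j \<le> real (row_len n a 1)" .
  from sum_levels[OF transfer_inv_Ints[OF x(2)] transfer_inv_nonneg[OF cone] this]
  have "(\<Sum>t<row_len n a 1. if real t + 1 \<le> transfer_inv x i j then 1 else 0) = transfer_inv x i j" .
  moreover have "indicator (level x t) (i, j) = (if real t + 1 \<le> transfer_inv x i j then 1 else (0::real))" for t
    using p by (simp add: level_def indicator_def)
  ultimately show ?thesis by (simp only:)
qed

lemma indicator_level_max:
  assumes "(i, j) \<in> tri n" "(i', j') \<in> tri n"
  shows "(max (indicator (level x t) (i, j)) (indicator (level x t) (i', j')) :: real)
    = (if transfer_inv x i' j' \<le> transfer_inv x i j then indicator (level x t) (i, j) else indicator (level x t) (i', j'))"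
  using assms by (auto simp: level_def indicator_def)

text \<open>
  The inverse transfer of a lattice point is an integral order-reversing function with prescribed values
  on the diagonal. Its level sets form a chain of ideals; on a chain the maximum over the covering cells
  commutes with sums, so the transfer map is additive there.
\<close>

theorem lattice_point_decompose:
  assumes x: "x \<in> chain_order n \<O> a" "x \<in> int_lattice n" and n: "1 < n"
  shows "x = (\<Sum>t<row_len n a 1. indicator (marked n \<O> (level x t)))"
proof
  fix p :: "nat \<times> nat"
  obtain i j where p: "p = (i, j)" by fastforce
  have cone: "x \<in> order_cone" using x chain_order_cone by auto
  have id: "level x t \<in> ideals n" for t by (rule level_ideal[OF cone])
  let ?A = "row_len n a 1"
  consider "(i, j) \<notin> tri n" | "(i, j) \<in> tri n" "(i, j) \<in> \<O> \<union> diag n"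
    | "(i, j) \<in> tri n" "(i, j) \<notin> \<O> \<union> diag n" by blast
  then have "x (i, j) = (\<Sum>t<?A. indicator (marked n \<O> (level x t)) (i, j))"
  proof cases
    case 1
    then have "(i, j) \<notin> marked n \<O> (level x t)" for t
      using marked_sub by (auto simp: level_def)
    moreover have "x (i, j) = 0"
      using x(2) 1 int_lattice_sub coord_spaceD by blast
    ultimately show ?thesis by simp
  next
    case 2
    then show ?thesis
      using sum_level[OF x n 2(1)] by (simp add: indicator_marked_marked transfer_inv_marked del: tri_iff)
  next
    case 3
    have ij: "1 \<le> i" "i < j" "j \<le> n" using 3 by auto
    then have q1: "(Suc i, j) \<in> tri n" by auto
    have "(\<Sum>t<?A. max (indicator (level x t) (Suc i, j)) (indicator (level x t) (i, Suc j)))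
        = max (transfer_inv x (Suc i) j) (transfer_inv x i (Suc j))"
    proof (cases "j = n")
      case True
      then have "(i, Suc j) \<notin> tri n" by auto
      then have "transfer_inv x i (Suc j) = 0" "(i, Suc j) \<notin> level x t" for t
        by (simp_all add: transfer_inv_outside level_def del: tri_iff)
      then show ?thesis
        using sum_level[OF x n q1] transfer_inv_nonneg[OF cone, of "Suc i" j] by (simp add: max_absorb1)
    next
      case False
      then have q2: "(i, Suc j) \<in> tri n" using ij by auto
      show ?thesis
        using sum_level[OF x n q1] sum_level[OF x n q2] unfolding indicator_level_max[OF q1 q2]
        by (cases "transfer_inv x i (Suc j) \<le> transfer_inv x (Suc i) j") (simp_all add: max_absorb1 max_absorb2)
    qed
    then show ?thesis
      using sum_level[OF x n 3(1)] transfer_inv_unmarked[OF 3, of x]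
      by (simp add: indicator_marked_unmarked[OF id 3] sum_subtractf del: tri_iff)
  qed
  then show "x p = (\<Sum>t<?A. indicator (marked n \<O> (level x t))) p"
    unfolding p sum_fun_apply .
qed

lemma fund_nonempty:
  assumes "1 \<le> k" "k \<le> n" shows "fund_chain_order n \<O> k \<noteq> {}"
proof -
  have "principal n (k, k) \<in> ideals_of n k"
    using assms principal_ideal[of k k]
    by (intro ideals_ofI) (auto simp: principal_def tri_le_def)
  then have "indicator (marked n \<O> (principal n (k, k))) \<in> fund_chain_order n \<O> k"
    unfolding fund_chain_order_def by (intro hull_inc imageI)
  then show ?thesis by blast
qed

lemma sum_convex_average:
  assumes "convex S" "finite T" "\<And>t. t \<in> T \<Longrightarrow> f t \<in> S" "S \<noteq> {}"
  shows "sum f T \<in> (\<lambda>x. real (card T) *\<^sub>R x) ` S"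
proof (cases "T = {}")
  case True
  then show ?thesis using assms(4) by auto
next
  case False
  then have c: "real (card T) > 0" using assms(2) by (simp add: card_gt_0_iff)
  have "(\<Sum>t\<in>T. (1 / real (card T)) *\<^sub>R f t) \<in> S"
    using assms c by (intro convex_sum) auto
  moreover have "real (card T) *\<^sub>R (\<Sum>t\<in>T. (1 / real (card T)) *\<^sub>R f t) = sum f T"
    using c by (simp add: scaleR_sum_right)
  ultimately show ?thesis by (metis image_eqI)
qed

text \<open>
  The columns of height \<open>k\<close> are \<open>a k\<close> in number, so their vertices add up to \<open>a k\<close> times their average.
\<close>

theorem sum_indicator_marked_in_chain_order:
  assumes n: "1 < n" and J: "\<And>t. t < row_len n a 1 \<Longrightarrow> J t \<in> ideals_of n (height n a t)"
  shows "(\<Sum>t<row_len n a 1. indicator (marked n \<O> (J t))) \<in> chain_order n \<O> a"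
proof -
  let ?T = "\<lambda>k. {t. t < row_len n a 1 \<and> height n a t = k}"
  let ?f = "\<lambda>t. indicator (marked n \<O> (J t)) :: point"
  have T: "?T k = {row_len n a (Suc k)..<row_len n a k}" if "k \<in> {1..<n}" for k
  proof (rule Set.set_eqI)
    fix t
    have "1 \<le> k" "k < n" using that by auto
    then show "t \<in> ?T k \<longleftrightarrow> t \<in> {row_len n a (Suc k)..<row_len n a k}"
      unfolding mem_Collect_eq atLeastLessThan_iff
      using height_eq_iff[of k n a t] row_len_antimono[of 1 k n a] by linarith
  qed
  have card: "card (?T k) = a k" if "k \<in> {1..<n}" for k
    using that row_len_Suc[of k n a] unfolding T[OF that] by simp
  have "sum ?f (?T k) \<in> (\<lambda>x. real (a k) *\<^sub>R x) ` fund_chain_order n \<O> k" if k: "k \<in> {1..<n}" for k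
    unfolding card[OF k, symmetric]
  proof (rule sum_convex_average)
    show "convex (fund_chain_order n \<O> k)"
      unfolding fund_chain_order_def by (rule convex_convex_hull)
    show "fund_chain_order n \<O> k \<noteq> {}" using k fund_nonempty by simp
    show "?f t \<in> fund_chain_order n \<O> k" if "t \<in> ?T k" for t
      unfolding fund_chain_order_def using that J by (intro hull_inc) auto
  qed auto
  moreover have "sum ?f {..<row_len n a 1} = (\<Sum>k = 1..<n. sum ?f (?T k))"
  proof -
    have "sum ?f {..<row_len n a 1} = (\<Sum>k\<in>{1..<n}. sum ?f {t \<in> {..<row_len n a 1}. height n a t = k})"
      using height_bounds[OF n, of _ a] by (intro sum.group[symmetric]) auto
    then show ?thesis by simp
  qed
  ultimately show ?thesis
    unfolding chain_order_def set_sum_alt[OF finite_atLeastLessThan] by blast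
qed

lemma indicator_marked_lattice:
  assumes "J \<in> ideals n" shows "indicator (marked n \<O> J) \<in> int_lattice n"
  using assms marked_sub[of J] ideals_def unfolding int_lattice_def coord_space_def
  by (auto simp: indicator_def ideals_def)

lemma int_lattice_sum_unscaled: "(\<And>p. p \<in> A \<Longrightarrow> u p \<in> int_lattice n) \<Longrightarrow> sum u A \<in> int_lattice n"
  using int_lattice_sum[of A "\<lambda>_. 1" u n] by simp

text \<open>
  Along a chain the indicators at two fixed cells are comparable, simultaneously for all members;
  this lets the maximum of two sums be taken term by term.
\<close>

lemma transfer_inv_chain_sum:
  assumes J: "\<And>t. t < M \<Longrightarrow> J t \<in> ideals n" and chain: "\<And>s t :: nat. s \<le> t \<Longrightarrow> t < M \<Longrightarrow> J t \<subseteq> J s"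
  shows "transfer_inv (\<Sum>t<M. indicator (marked n \<O> (J t))) i j = (\<Sum>t<M. indicator (J t) (i, j))"
proof -
  have "x = (\<Sum>t<M. indicator (marked n \<O> (J t))) \<Longrightarrow> transfer_inv x i j = (\<Sum>t<M. indicator (J t) (i, j))" for x
  proof (induction x i j rule: transfer_inv.induct)
    case (1 x i j)
    have x: "x p = (\<Sum>t<M. indicator (marked n \<O> (J t)) p)" for p
      unfolding 1(3) by (rule sum_fun_apply)
    consider "(i, j) \<notin> tri n" | "(i, j) \<in> tri n" "(i, j) \<in> \<O> \<union> diag n"
      | "(i, j) \<in> tri n" "(i, j) \<notin> \<O> \<union> diag n" by blast
    then show ?case
    proof cases
      case 1
      then have "(i, j) \<notin> J t" if "t < M" for t using J[OF that] by (auto simp: ideals_def)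
      with 1 show ?thesis by (simp add: transfer_inv_outside del: tri_iff)
    next
      case 2
      then show ?thesis by (simp add: transfer_inv_marked x indicator_marked_marked del: tri_iff)
    next
      case 3
      let ?u = "\<lambda>t. indicator (J t) (Suc i, j) :: real" and ?v = "\<lambda>t. indicator (J t) (i, Suc j) :: real"
      have "(\<forall>t<M. ?u t \<le> ?v t) \<or> (\<forall>t<M. ?v t \<le> ?u t)"
      proof (rule ccontr)
        assume "\<not> ?thesis"
        then obtain s t where st: "s < M" "t < M" "(Suc i, j) \<in> J s" "(i, Suc j) \<notin> J s"
          "(i, Suc j) \<in> J t" "(Suc i, j) \<notin> J t"
          by (auto simp: indicator_def split: if_splits)
        then show False using chain[of s t] chain[of t s] nat_le_linear[of s t] by blast
      qed
      then have "max (sum ?u {..<M}) (sum ?v {..<M}) = (\<Sum>t<M. max (?u t) (?v t))"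
      proof
        assume le: "\<forall>t<M. ?u t \<le> ?v t"
        then have "sum ?u {..<M} \<le> sum ?v {..<M}" by (intro sum_mono) simp
        moreover have "(\<Sum>t<M. max (?u t) (?v t)) = sum ?v {..<M}"
          using le by (intro sum.cong) (simp_all add: max_absorb2)
        ultimately show ?thesis by simp
      next
        assume le: "\<forall>t<M. ?v t \<le> ?u t"
        then have "sum ?v {..<M} \<le> sum ?u {..<M}" by (intro sum_mono) simp
        moreover have "(\<Sum>t<M. max (?u t) (?v t)) = sum ?u {..<M}"
          using le by (intro sum.cong) (simp_all add: max_absorb1)
        ultimately show ?thesis by simp
      qed
      moreover have "x (i, j) = (\<Sum>t<M. indicator (J t) (i, j) - max (?u t) (?v t))"
        unfolding x using indicator_marked_unmarked[OF J 3] by (intro sum.cong) auto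
      ultimately show ?thesis
        using 1 3 by (simp add: transfer_inv_unmarked sum_subtractf del: tri_iff)
    qed
  qed
  then show ?thesis by simp
qed

end

section \<open>The action on tensors\<close>

text \<open>
  A tensor is given by its coordinates: a function on words, each of which assigns a basis vector of
  \<open>\<complex>\<^sup>n\<close> to every box of the Young diagram.
\<close>

type_synonym word = "nat \<times> nat \<Rightarrow> nat"
type_synonym tensor = "word \<Rightarrow> complex"

definition scale :: "complex \<Rightarrow> tensor \<Rightarrow> tensor" where
  "scale c t = (\<lambda>\<omega>. c * t \<omega>)"

abbreviation entry :: "complex mat \<Rightarrow> nat \<Rightarrow> nat \<Rightarrow> complex" where
  "entry A i j \<equiv> A $$ (i - 1, j - 1)"

lemma entry_mult:
  assumes "A \<in> carrier_mat n n" "B \<in> carrier_mat n n" "i \<in> {1..n}" "k \<in> {1..n}"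
  shows "entry (A * B) i k = (\<Sum>j = 1..n. entry A i j * entry B j k)"
proof -
  have "entry (A * B) i k = (\<Sum>j = 0..<n. A $$ (i - 1, j) * B $$ (j, k - 1))"
    using assms by (auto simp: scalar_prod_def)
  also have "\<dots> = (\<Sum>j = 1..n. entry A i j * entry B j k)"
    by (rule sum.reindex_bij_witness[where j = Suc and i = "\<lambda>j. j - 1"]) auto
  finally show ?thesis .
qed

lemma entry_mat_unit:
  assumes "i \<in> {1..n}" "j \<in> {1..n}"
  shows "entry (mat_unit n k l) i j = (if i = k \<and> j = l then 1 else 0)"
  using assms by (auto simp: mat_unit_def)

lemma mat_unit_carrier [simp]: "mat_unit n k l \<in> carrier_mat n n"
  by (simp add: mat_unit_def)

lemma entry_add:
  "A \<in> carrier_mat n n \<Longrightarrow> B \<in> carrier_mat n n \<Longrightarrow> i \<in> {1..n} \<Longrightarrow> j \<in> {1..n} \<Longrightarrow>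
    entry (A + B) i j = entry A i j + entry B i j"
  by auto

lemma entry_minus:
  "A \<in> carrier_mat n n \<Longrightarrow> B \<in> carrier_mat n n \<Longrightarrow> i \<in> {1..n} \<Longrightarrow> j \<in> {1..n} \<Longrightarrow>
    entry (A - B) i j = entry A i j - entry B i j"
  by auto

lemma entry_smult:
  "A \<in> carrier_mat n n \<Longrightarrow> i \<in> {1..n} \<Longrightarrow> j \<in> {1..n} \<Longrightarrow> entry (c \<cdot>\<^sub>m A) i j = c * entry A i j"
  by auto

locale young_shape =
  fixes n :: nat and a :: "nat \<Rightarrow> nat"
  assumes n_gt_1: "1 < n"
begin

definition boxes :: "(nat \<times> nat) set" where
  "boxes = {(t, i). 1 \<le> i \<and> i < n \<and> t < row_len n a i}"

text \<open>
  Words vanish off the diagram so that they are determined by their values on the boxes.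
\<close>

definition words :: "word set" where
  "words = {\<omega>. \<forall>p. (p \<in> boxes \<longrightarrow> \<omega> p \<in> {1..n}) \<and> (p \<notin> boxes \<longrightarrow> \<omega> p = 0)}"

lemma finite_boxes [simp]: "finite boxes"
proof -
  have "boxes \<subseteq> {..<row_len n a 1} \<times> {..<n}"
    using row_len_antimono[of 1 _ n a] by (fastforce simp: boxes_def)
  then show ?thesis by (rule finite_subset) simp
qed

lemma finite_words [simp]: "finite words"
  unfolding words_def by (rule finite_set_of_finite_funs) auto

lemma wordsD: "\<omega> \<in> words \<Longrightarrow> p \<in> boxes \<Longrightarrow> \<omega> p \<in> {1..n}"
  unfolding words_def by blast

lemma words_outside: "\<omega> \<in> words \<Longrightarrow> p \<notin> boxes \<Longrightarrow> \<omega> p = 0"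
  unfolding words_def by blast

lemma words_upd: "\<omega> \<in> words \<Longrightarrow> p \<in> boxes \<Longrightarrow> j \<in> {1..n} \<Longrightarrow> \<omega>(p := j) \<in> words"
  unfolding words_def by simp

lemma words_permute: "\<omega> \<in> words \<Longrightarrow> \<sigma> permutes boxes \<Longrightarrow> \<omega> \<circ> \<sigma> \<in> words"
  unfolding words_def using permutes_in_image[of \<sigma> boxes]
  by (simp del: split_paired_All)

definition act :: "complex mat \<Rightarrow> tensor \<Rightarrow> tensor" where
  "act A t = (\<lambda>\<omega>. if \<omega> \<in> words
     then \<Sum>p\<in>boxes. \<Sum>j = 1..n. entry A (\<omega> p) j * t (\<omega>(p := j)) else 0)"

lemma act_word: "\<omega> \<in> words \<Longrightarrow>
    act A t \<omega> = (\<Sum>p\<in>boxes. \<Sum>j = 1..n. entry A (\<omega> p) j * t (\<omega>(p := j)))"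
  by (simp add: act_def)

lemma act_outside: "\<omega> \<notin> words \<Longrightarrow> act A t \<omega> = 0"
  by (simp add: act_def)

lemma act_cong: "(\<And>\<omega>. \<omega> \<in> words \<Longrightarrow> t \<omega> = s \<omega>) \<Longrightarrow> act A t = act A s"
  by (rule ext) (auto simp: act_def words_upd intro!: sum.cong)

lemma act_plus: "act A (t + s) = act A t + act A s"
  by (rule ext) (simp add: act_def distrib_left sum.distrib)

lemma act_scale: "act A (scale c t) = scale c (act A t)"
  by (rule ext) (simp add: act_def scale_def sum_distrib_left mult.left_commute)

lemma act_zero [simp]: "act A 0 = 0"
  by (rule ext) (simp add: act_def)

lemma act_add:
  assumes "A \<in> carrier_mat n n" "B \<in> carrier_mat n n"
  shows "act (A + B) t = act A t + act B t"
proof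
  fix \<omega> show "act (A + B) t \<omega> = (act A t + act B t) \<omega>"
  proof (cases "\<omega> \<in> words")
    case True
    have "act (A + B) t \<omega> = (\<Sum>p\<in>boxes. \<Sum>j = 1..n. entry A (\<omega> p) j * t (\<omega>(p := j)) + entry B (\<omega> p) j * t (\<omega>(p := j)))"
      unfolding act_word[OF True]
      by (intro sum.cong refl) (simp add: entry_add[OF assms wordsD[OF True]] distrib_right del: One_nat_def)
    then show ?thesis by (simp add: act_word[OF True] sum.distrib)
  qed (simp add: act_outside)
qed

lemma act_minus:
  assumes "A \<in> carrier_mat n n" "B \<in> carrier_mat n n"
  shows "act (A - B) t = act A t - act B t"
proof
  fix \<omega> show "act (A - B) t \<omega> = (act A t - act B t) \<omega>"
  proof (cases "\<omega> \<in> words")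
    case True
    have "act (A - B) t \<omega> = (\<Sum>p\<in>boxes. \<Sum>j = 1..n. entry A (\<omega> p) j * t (\<omega>(p := j)) - entry B (\<omega> p) j * t (\<omega>(p := j)))"
      unfolding act_word[OF True]
      by (intro sum.cong refl) (simp add: entry_minus[OF assms wordsD[OF True]] left_diff_distrib del: One_nat_def)
    then show ?thesis by (simp add: act_word[OF True] sum_subtractf)
  qed (simp add: act_outside)
qed

lemma act_smult:
  assumes "A \<in> carrier_mat n n" shows "act (c \<cdot>\<^sub>m A) t = scale c (act A t)"
proof
  fix \<omega> show "act (c \<cdot>\<^sub>m A) t \<omega> = scale c (act A t) \<omega>"
  proof (cases "\<omega> \<in> words")
    case True
    have "act (c \<cdot>\<^sub>m A) t \<omega> = (\<Sum>p\<in>boxes. \<Sum>j = 1..n. c * (entry A (\<omega> p) j * t (\<omega>(p := j))))"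
      unfolding act_word[OF True]
      by (intro sum.cong refl) (simp add: entry_smult[OF assms wordsD[OF True]] mult.assoc del: One_nat_def)
    then show ?thesis by (simp add: act_word[OF True] scale_def sum_distrib_left)
  qed (simp add: act_outside scale_def)
qed

text \<open>
  The part of a product of two operators in which they act on different boxes. Exchanging the operators
  together with the boxes does not change it, so it cancels in a commutator.
\<close>

definition cross :: "tensor \<Rightarrow> word \<Rightarrow> complex mat \<Rightarrow> complex mat \<Rightarrow> nat \<times> nat \<Rightarrow> nat \<times> nat \<Rightarrow> complex" where
  "cross t \<omega> A B p q = (if p = q then 0 else
    \<Sum>j = 1..n. \<Sum>l = 1..n. entry A (\<omega> p) j * (entry B (\<omega> q) l * t (\<omega>(p := j, q := l))))"

lemma act_act:
  assumes A: "A \<in> carrier_mat n n" and B: "B \<in> carrier_mat n n" and w: "\<omega> \<in> words"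
  shows "act A (act B t) \<omega> = act (A * B) t \<omega> + (\<Sum>p\<in>boxes. \<Sum>q\<in>boxes. cross t \<omega> A B p q)"
proof -
  let ?G = "cross t \<omega>"
  let ?F = "\<lambda>p q. \<Sum>j = 1..n. \<Sum>l = 1..n.
    entry A (\<omega> p) j * (entry B ((\<omega>(p := j)) q) l * t (\<omega>(p := j, q := l)))"
  have row: "(\<Sum>j = 1..n. entry A (\<omega> p) j * act B t (\<omega>(p := j))) = (\<Sum>q\<in>boxes. ?F p q)"
    if p: "p \<in> boxes" for p
  proof -
    have "(\<Sum>j = 1..n. entry A (\<omega> p) j * act B t (\<omega>(p := j))) = (\<Sum>j = 1..n. \<Sum>q\<in>boxes. \<Sum>l = 1..n.
      entry A (\<omega> p) j * (entry B ((\<omega>(p := j)) q) l * t (\<omega>(p := j, q := l))))"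
      by (intro sum.cong refl) (simp only: act_word[OF words_upd[OF w p]] sum_distrib_left)
    then show ?thesis by (simp only: sum.swap[of _ _ boxes])
  qed
  have diag: "?F p p = (\<Sum>l = 1..n. entry (A * B) (\<omega> p) l * t (\<omega>(p := l)))" if p: "p \<in> boxes" for p
  proof -
    have "?F p p = (\<Sum>l = 1..n. \<Sum>j = 1..n. entry A (\<omega> p) j * entry B j l * t (\<omega>(p := l)))"
      by (subst sum.swap) (simp add: mult.assoc)
    also have "\<dots> = (\<Sum>l = 1..n. entry (A * B) (\<omega> p) l * t (\<omega>(p := l)))"
      by (intro sum.cong refl) (simp only: entry_mult[OF A B wordsD[OF w p]] sum_distrib_right)
    finally show ?thesis .
  qed
  have "act A (act B t) \<omega> = (\<Sum>p\<in>boxes. \<Sum>q\<in>boxes. ?F p q)"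
    unfolding act_word[OF w] by (intro sum.cong refl row)
  also have "\<dots> = (\<Sum>p\<in>boxes. (\<Sum>q\<in>boxes. ?G A B p q) + ?F p p)"
  proof (intro sum.cong refl)
    fix p assume p: "p \<in> boxes"
    have "(\<Sum>q\<in>boxes. ?F p q) = (\<Sum>q\<in>boxes. ?G A B p q + (if q = p then ?F p p else 0))"
      by (intro sum.cong refl) (auto simp: cross_def)
    also have "\<dots> = (\<Sum>q\<in>boxes. ?G A B p q) + ?F p p"
      using p by (simp only: sum.distrib sum.delta finite_boxes if_True)
    finally show "(\<Sum>q\<in>boxes. ?F p q) = (\<Sum>q\<in>boxes. ?G A B p q) + ?F p p" .
  qed
  also have "\<dots> = (\<Sum>p\<in>boxes. \<Sum>q\<in>boxes. ?G A B p q) + (\<Sum>p\<in>boxes. ?F p p)"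
    by (rule sum.distrib)
  also have "(\<Sum>p\<in>boxes. ?F p p) = act (A * B) t \<omega>"
    unfolding act_word[OF w] by (intro sum.cong refl diag)
  finally show ?thesis by simp
qed

lemma act_bracket:
  assumes A: "A \<in> carrier_mat n n" and B: "B \<in> carrier_mat n n"
  shows "act (A * B - B * A) t = act A (act B t) - act B (act A t)"
proof
  fix \<omega>
  show "act (A * B - B * A) t \<omega> = (act A (act B t) - act B (act A t)) \<omega>"
  proof (cases "\<omega> \<in> words")
    case True
    let ?G = "cross t \<omega>"
    have sym: "?G A B p q = ?G B A q p" for p q
      unfolding cross_def
      by (auto simp: mult.left_commute fun_upd_twist intro: trans[OF sum.swap])
    have "(\<Sum>p\<in>boxes. \<Sum>q\<in>boxes. ?G A B p q) = (\<Sum>p\<in>boxes. \<Sum>q\<in>boxes. ?G B A p q)"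
      by (subst sum.swap) (simp only: sym)
    then show ?thesis
      using act_act[OF A B True, of t] act_act[OF B A True, of t]
        act_minus[OF mult_carrier_mat[OF A B] mult_carrier_mat[OF B A]]
      by simp
  qed (simp add: act_outside)
qed

lemma act_mat_unit:
  assumes "l \<in> {1..n}" "\<omega> \<in> words"
  shows "act (mat_unit n k l) t \<omega> = (\<Sum>p\<in>boxes. if \<omega> p = k then t (\<omega>(p := l)) else 0)"
proof -
  have "(\<Sum>j = 1..n. entry (mat_unit n k l) (\<omega> p) j * t (\<omega>(p := j)))
    = (if \<omega> p = k then t (\<omega>(p := l)) else 0)" if p: "p \<in> boxes" for p
  proof -
    have "(\<Sum>j = 1..n. entry (mat_unit n k l) (\<omega> p) j * t (\<omega>(p := j)))
      = (\<Sum>j = 1..n. if j = l then (if \<omega> p = k then t (\<omega>(p := l)) else 0) else 0)"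
      by (intro sum.cong refl) (simp add: entry_mat_unit[OF wordsD[OF assms(2) p]] del: One_nat_def)
    also have "\<dots> = (if \<omega> p = k then t (\<omega>(p := l)) else 0)"
      using assms(1) by (simp only: sum.delta finite_atLeastAtMost if_True)
    finally show ?thesis .
  qed
  then show ?thesis unfolding act_word[OF assms(2)] by (intro sum.cong refl)
qed

lemma act_diagonal:
  assumes "\<omega> \<in> words" and "\<And>i j. i \<in> {1..n} \<Longrightarrow> j \<in> {1..n} \<Longrightarrow> i \<noteq> j \<Longrightarrow> entry D i j = 0"
  shows "act D t \<omega> = (\<Sum>p\<in>boxes. entry D (\<omega> p) (\<omega> p)) * t \<omega>"
proof -
  have "(\<Sum>j = 1..n. entry D (\<omega> p) j * t (\<omega>(p := j))) = entry D (\<omega> p) (\<omega> p) * t \<omega>"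
    if p: "p \<in> boxes" for p
  proof -
    have "(\<Sum>j = 1..n. entry D (\<omega> p) j * t (\<omega>(p := j)))
      = (\<Sum>j = 1..n. if j = \<omega> p then entry D (\<omega> p) (\<omega> p) * t \<omega> else 0)"
      using assms(2) wordsD[OF assms(1) p] by (intro sum.cong refl) auto
    also have "\<dots> = entry D (\<omega> p) (\<omega> p) * t \<omega>"
      using wordsD[OF assms(1) p] by (simp only: sum.delta finite_atLeastAtMost if_True)
    finally show ?thesis .
  qed
  then show ?thesis unfolding act_word[OF assms(1)] sum_distrib_right by (intro sum.cong refl)
qed

definition form :: "tensor \<Rightarrow> tensor \<Rightarrow> complex" where
  "form t s = (\<Sum>\<omega>\<in>words. t \<omega> * cnj (s \<omega>))"

lemma form_plus_left: "form (t + t') s = form t s + form t' s"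
  and form_plus_right: "form t (s + s') = form t s + form t s'"
  and form_scale_left: "form (scale c t) s = c * form t s"
  and form_scale_right: "form t (scale c s) = cnj c * form t s"
  and form_zero_left [simp]: "form 0 s = 0"
  and form_zero_right [simp]: "form t 0 = 0"
  by (simp_all add: form_def scale_def sum.distrib sum_distrib_left algebra_simps)

lemma form_positive: "form t t = 0 \<Longrightarrow> \<omega> \<in> words \<Longrightarrow> t \<omega> = 0"
proof -
  assume 0: "form t t = 0" and w: "\<omega> \<in> words"
  have "form t t = of_real (\<Sum>\<omega>\<in>words. (cmod (t \<omega>))\<^sup>2)"
    by (simp only: form_def of_real_sum complex_norm_square)
  then have "(\<Sum>\<omega>\<in>words. (cmod (t \<omega>))\<^sup>2) = 0" using 0 of_real_eq_0_iff by metis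
  then have "(cmod (t \<omega>))\<^sup>2 = 0" using w by (subst (asm) sum_nonneg_eq_0_iff) auto
  then show ?thesis by simp
qed

text \<open>
  Elementary matrices are adjoint to their transposes; so for this Hermitian form raising operators are
  adjoint to lowering operators.
\<close>

lemma form_adjoint:
  assumes k: "k \<in> {1..n}" and l: "l \<in> {1..n}"
  shows "form (act (mat_unit n k l) t) s = form t (act (mat_unit n l k) s)"
proof -
  have "(\<Sum>\<omega>\<in>words. if \<omega> p = k then t (\<omega>(p := l)) * cnj (s \<omega>) else 0)
      = (\<Sum>\<omega>\<in>words. if \<omega> p = l then t \<omega> * cnj (s (\<omega>(p := k))) else 0)" if p: "p \<in> boxes" for p
  proof -
    have "(\<Sum>\<omega>\<in>words. if \<omega> p = k then t (\<omega>(p := l)) * cnj (s \<omega>) else 0)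
        = (\<Sum>\<omega>\<in>{\<omega> \<in> words. \<omega> p = k}. t (\<omega>(p := l)) * cnj (s \<omega>))"
      by (rule sum.inter_filter[symmetric]) simp
    also have "\<dots> = (\<Sum>\<omega>\<in>{\<omega> \<in> words. \<omega> p = l}. t \<omega> * cnj (s (\<omega>(p := k))))"
      by (rule sum.reindex_bij_witness[where i = "\<lambda>\<omega>. \<omega>(p := k)" and j = "\<lambda>\<omega>. \<omega>(p := l)"])
        (use words_upd[OF _ p] k l in auto)
    also have "\<dots> = (\<Sum>\<omega>\<in>words. if \<omega> p = l then t \<omega> * cnj (s (\<omega>(p := k))) else 0)"
      by (rule sum.inter_filter) simp
    finally show ?thesis .
  qed
  note flip = this
  have "form (act (mat_unit n k l) t) s
      = (\<Sum>\<omega>\<in>words. \<Sum>p\<in>boxes. if \<omega> p = k then t (\<omega>(p := l)) * cnj (s \<omega>) else 0)"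
    unfolding form_def
    by (intro sum.cong refl) (simp add: act_mat_unit[OF l] sum_distrib_right if_distrib[of "\<lambda>x. x * _"] cong: if_cong)
  also have "\<dots> = (\<Sum>p\<in>boxes. \<Sum>\<omega>\<in>words. if \<omega> p = l then t \<omega> * cnj (s (\<omega>(p := k))) else 0)"
    by (subst sum.swap) (intro sum.cong refl flip)
  also have "\<dots> = form t (act (mat_unit n l k) s)"
    unfolding form_def
    by (subst sum.swap, intro sum.cong refl)
      (simp add: act_mat_unit[OF k] sum_distrib_left if_distrib[of cnj] if_distrib[of "\<lambda>x. _ * x"] cong: if_cong)
  finally show ?thesis .
qed

section \<open>The highest weight tensor\<close>

text \<open>
  The coordinate of the highest weight tensor at a word is the product over the columns of the sign of
  the permutation that the word spells there, and 0 if some column is not a permutation of its row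
  numbers. One sign of a permutation of all boxes expresses this product.
\<close>

definition column_map :: "word \<Rightarrow> nat \<times> nat \<Rightarrow> nat \<times> nat" where
  "column_map \<omega> p = (if p \<in> boxes then (fst p, \<omega> p) else p)"

definition hw_tensor :: tensor where
  "hw_tensor \<omega> = (if \<omega> \<in> words \<and> column_map \<omega> permutes boxes then of_int (sign (column_map \<omega>)) else 0)"

lemma permutation_boxes: "\<sigma> permutes boxes \<Longrightarrow> permutation \<sigma>"
  using permutes_imp_permutation finite_boxes by blast

lemma hw_tensor_permute:
  assumes "\<omega> \<in> words" "\<sigma> permutes boxes" "\<And>p. fst (\<sigma> p) = fst p"
  shows "hw_tensor (\<omega> \<circ> \<sigma>) = of_int (sign \<sigma>) * hw_tensor \<omega>"
proof -
  have th: "column_map (\<omega> \<circ> \<sigma>) = column_map \<omega> \<circ> \<sigma>"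
    using assms(3) permutes_in_image[OF assms(2)] permutes_not_in[OF assms(2)]
    by (fastforce simp: column_map_def)
  have eq: "column_map \<omega> = column_map (\<omega> \<circ> \<sigma>) \<circ> inv_into UNIV \<sigma>"
    unfolding th comp_assoc permutes_inv_o(1)[OF assms(2)] by simp
  have iff: "column_map (\<omega> \<circ> \<sigma>) permutes boxes \<longleftrightarrow> column_map \<omega> permutes boxes"
    using permutes_compose[OF assms(2)] permutes_compose[OF permutes_inv[OF assms(2)]] th eq by metis
  show ?thesis
    using assms words_permute[OF assms(1,2)] permutation_boxes[of "column_map \<omega>"] permutation_boxes[of \<sigma>]
    by (simp add: hw_tensor_def iff) (simp add: th sign_compose)
qed

lemma column_swap_permutes:
  assumes "p \<in> boxes" "q \<in> boxes" shows "Transposition.transpose p q permutes boxes"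
  using assms by (rule permutes_swap_id)

lemma fst_transpose: "fst p = fst q \<Longrightarrow> fst (Transposition.transpose p q x) = fst x"
  by (auto simp: transpose_def)

lemma hw_tensor_swap:
  assumes "\<omega> \<in> words" "p \<in> boxes" "q \<in> boxes" "fst p = fst q" "p \<noteq> q"
  shows "hw_tensor (\<omega> \<circ> Transposition.transpose p q) = - hw_tensor \<omega>"
  using hw_tensor_permute[OF assms(1) column_swap_permutes[OF assms(2,3)] fst_transpose[OF assms(4)]] assms(5)
  by (simp add: sign_swap_id)

lemma hw_tensor_nonzeroD: "hw_tensor \<omega> \<noteq> 0 \<Longrightarrow> \<omega> \<in> words \<and> column_map \<omega> permutes boxes"
  by (auto simp: hw_tensor_def split: if_splits)

lemma boxes_down: "(t, j) \<in> boxes \<Longrightarrow> 1 \<le> i \<Longrightarrow> i \<le> j \<Longrightarrow> (t, i) \<in> boxes"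
  using row_len_antimono[of i j n a] by (auto simp: boxes_def)

text \<open>
  Replacing one entry \<open>i\<close> by \<open>j > i\<close> can give a permutation in that column only if the column contained
  \<open>i\<close> twice. The two ways to replace one of these entries differ by a swap of the boxes, so their
  contributions cancel.
\<close>

lemma hw_tensor_raising:
  assumes "1 \<le> i" "i < j" "j \<le> n"
  shows "act (mat_unit n i j) hw_tensor = 0"
proof
  fix \<omega>
  show "act (mat_unit n i j) hw_tensor \<omega> = 0 \<omega>"
  proof (cases "\<omega> \<in> words")
    case w: True
    (* \<open>S\<close> carries the nonzero terms; \<open>partner\<close> pairs them off with opposite signs *)
    define S where "S = {p \<in> boxes. \<omega> p = i \<and> hw_tensor (\<omega>(p := j)) \<noteq> 0}"
    define partner where "partner p = (SOME q. q \<in> boxes \<and> q \<noteq> p \<and> fst q = fst p \<and> \<omega> q = i)" for p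
    have ex: "\<exists>q. q \<in> boxes \<and> q \<noteq> p \<and> fst q = fst p \<and> \<omega> q = i" if "p \<in> S" for p
    proof -
      have p: "p \<in> boxes" "\<omega> p = i" and perm: "column_map (\<omega>(p := j)) permutes boxes"
        using that hw_tensor_nonzeroD by (auto simp: S_def)
      have "column_map (\<omega>(p := j)) p \<in> boxes"
        using permutes_in_image[OF perm] p by blast
      then have "(fst p, j) \<in> boxes" using p by (simp add: column_map_def)
      then have "(fst p, i) \<in> boxes" using boxes_down assms by auto
      then have "(fst p, i) \<in> column_map (\<omega>(p := j)) ` boxes" using permutes_image[OF perm] by simp
      then obtain q where q: "q \<in> boxes" "column_map (\<omega>(p := j)) q = (fst p, i)" by force
      then have "q \<noteq> p" using p assms by (auto simp: column_map_def)
      moreover have "fst q = fst p" "\<omega> q = i" using q \<open>q \<noteq> p\<close> by (simp_all add: column_map_def)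
      ultimately show ?thesis using q by blast
    qed
    have partner: "partner p \<in> boxes" "partner p \<noteq> p" "fst (partner p) = fst p" "\<omega> (partner p) = i"
      if "p \<in> S" for p
      using someI_ex[OF ex[OF that]] unfolding partner_def by blast+
    have uniq: "q = q'" if "p \<in> S" and q: "q \<in> boxes" "q \<noteq> p" "fst q = fst p" "\<omega> q = i"
      and q': "q' \<in> boxes" "q' \<noteq> p" "fst q' = fst p" "\<omega> q' = i" for p q q'
    proof -
      have "column_map (\<omega>(p := j)) permutes boxes" using that(1) hw_tensor_nonzeroD by (auto simp: S_def)
      then have "inj (column_map (\<omega>(p := j)))" by (rule permutes_inj)
      moreover have "column_map (\<omega>(p := j)) q = column_map (\<omega>(p := j)) q'"
        using q q' by (simp add: column_map_def)
      ultimately show ?thesis by (simp only: inj_eq)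
    qed
    have swap: "hw_tensor (\<omega>(partner p := j)) = - hw_tensor (\<omega>(p := j))" if "p \<in> S" for p
    proof -
      have p: "p \<in> boxes" "\<omega> p = i" using that by (auto simp: S_def)
      have "\<omega>(partner p := j) = \<omega>(p := j) \<circ> Transposition.transpose p (partner p)"
        using partner[OF that] p by (auto simp: transpose_def fun_eq_iff)
      then show ?thesis
        using hw_tensor_swap[OF words_upd[OF w p(1)] p(1) partner(1)[OF that]] partner[OF that] assms by simp
    qed
    have S_partner: "partner p \<in> S" if "p \<in> S" for p
      using swap[OF that] partner[OF that] that by (auto simp: S_def)
    have invol: "partner (partner p) = p" if "p \<in> S" for p
    proof -
      have "p \<in> boxes" "\<omega> p = i" using that by (auto simp: S_def)
      moreover have "p \<noteq> partner p" "fst p = fst (partner p)"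
        using partner(2,3)[OF that] by metis+
      ultimately show ?thesis
        by (intro uniq[OF S_partner[OF that] partner[OF S_partner[OF that]]])
    qed
    let ?f = "\<lambda>p. hw_tensor (\<omega>(p := j))"
    have "sum ?f S = (\<Sum>p\<in>S. ?f (partner p))"
      by (rule sum.reindex_bij_witness[where i = partner and j = partner]) (auto simp: invol S_partner)
    also have "\<dots> = - sum ?f S" by (simp add: swap sum_negf)
    finally have "sum ?f S = 0" by simp
    moreover have "act (mat_unit n i j) hw_tensor \<omega> = sum ?f S"
    proof -
      have "act (mat_unit n i j) hw_tensor \<omega> = (\<Sum>p\<in>boxes. if \<omega> p = i then ?f p else 0)"
        using assms by (intro act_mat_unit w) auto
      also have "\<dots> = (\<Sum>p\<in>S. if \<omega> p = i then ?f p else 0)"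
        by (rule sum.mono_neutral_right) (auto simp: S_def)
      also have "\<dots> = sum ?f S" by (rule sum.cong) (auto simp: S_def)
      finally show ?thesis .
    qed
    ultimately show ?thesis by simp
  qed (simp add: act_outside)
qed

lemma hw_tensor_diagonal:
  assumes "\<And>i j. i \<in> {1..n} \<Longrightarrow> j \<in> {1..n} \<Longrightarrow> i \<noteq> j \<Longrightarrow> entry D i j = 0"
  shows "act D hw_tensor = scale (\<Sum>p\<in>boxes. entry D (snd p) (snd p)) hw_tensor"
proof
  fix \<omega>
  show "act D hw_tensor \<omega> = scale (\<Sum>p\<in>boxes. entry D (snd p) (snd p)) hw_tensor \<omega>"
  proof (cases "hw_tensor \<omega> = 0")
    case True
    then show ?thesis using act_diagonal[OF _ assms, of \<omega> hw_tensor]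
      by (cases "\<omega> \<in> words") (simp_all add: scale_def act_outside)
  next
    case False
    then have w: "\<omega> \<in> words" and perm: "column_map \<omega> permutes boxes" using hw_tensor_nonzeroD by auto
    have "(\<Sum>p\<in>boxes. entry D (\<omega> p) (\<omega> p)) = (\<Sum>p\<in>boxes. entry D (snd (column_map \<omega> p)) (snd (column_map \<omega> p)))"
      by (intro sum.cong refl) (simp add: column_map_def)
    also have "\<dots> = (\<Sum>p\<in>boxes. entry D (snd p) (snd p))"
      by (rule sum.reindex_bij_betw[OF permutes_imp_bij[OF perm]])
    finally have eq: "(\<Sum>p\<in>boxes. entry D (\<omega> p) (\<omega> p)) = (\<Sum>p\<in>boxes. entry D (snd p) (snd p))" .
    have "act D hw_tensor \<omega> = (\<Sum>p\<in>boxes. entry D (\<omega> p) (\<omega> p)) * hw_tensor \<omega>"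
      by (rule act_diagonal[OF w]) (rule assms)
    then show ?thesis unfolding eq scale_def .
  qed
qed

definition base_word :: word where
  "base_word p = (if p \<in> boxes then snd p else 0)"

lemma base_word_words: "base_word \<in> words"
  by (auto simp: words_def base_word_def boxes_def)

lemma hw_tensor_base_word: "hw_tensor base_word = 1"
proof -
  have "column_map base_word = id" by (auto simp: column_map_def base_word_def)
  then show ?thesis by (simp add: hw_tensor_def base_word_words permutes_id)
qed

section \<open>Column antisymmetry and exchange relations\<close>

text \<open>
  The exchange relation antisymmetrises over a set \<open>Z\<close> of more than \<open>k\<close> boxes lying in columns of
  height at most \<open>k\<close>. The height condition is expressed by the absence of a box in row \<open>k + 1\<close>.
\<close>

definition exchange_space :: "tensor set" where
  "exchange_space = {t. (\<forall>\<omega>. \<omega> \<notin> words \<longrightarrow> t \<omega> = 0) \<and>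
     (\<forall>\<sigma>. \<sigma> permutes boxes \<longrightarrow> (\<forall>p. fst (\<sigma> p) = fst p) \<longrightarrow>
        (\<forall>\<omega>\<in>words. t (\<omega> \<circ> \<sigma>) = of_int (sign \<sigma>) * t \<omega>)) \<and>
     (\<forall>k Z. Z \<subseteq> boxes \<longrightarrow> (\<forall>t. (t, Suc k) \<in> boxes \<longrightarrow> t \<notin> fst ` Z) \<longrightarrow> k < card Z \<longrightarrow>
        (\<forall>\<omega>\<in>words. (\<Sum>\<sigma> | \<sigma> permutes Z. of_int (sign \<sigma>) * t (\<omega> \<circ> \<sigma>)) = 0))}"

lemma act_permute:
  assumes "\<sigma> permutes boxes" "\<omega> \<in> words"
  shows "act A t (\<omega> \<circ> \<sigma>) = act A (\<lambda>\<omega>. t (\<omega> \<circ> \<sigma>)) \<omega>"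
proof -
  have upd: "(\<omega> \<circ> \<sigma>)(p := j) = \<omega>(\<sigma> p := j) \<circ> \<sigma>" for p j
    using inj_eq[OF permutes_inj[OF assms(1)]] by (auto simp: fun_eq_iff)
  have "act A t (\<omega> \<circ> \<sigma>) = (\<Sum>p\<in>boxes. \<Sum>j = 1..n. entry A (\<omega> (\<sigma> p)) j * t (\<omega>(\<sigma> p := j) \<circ> \<sigma>))"
    by (simp only: act_word[OF words_permute[OF assms(2,1)]] upd) (simp only: comp_apply)
  also have "\<dots> = (\<Sum>p\<in>boxes. \<Sum>j = 1..n. entry A (\<omega> p) j * t (\<omega>(p := j) \<circ> \<sigma>))"
    by (rule sum.reindex_bij_betw[OF permutes_imp_bij[OF assms(1)]])
  finally show ?thesis by (simp only: act_word[OF assms(2)])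
qed

lemma act_sum_tensor: "act A (\<lambda>\<omega>. \<Sum>k\<in>K. t k \<omega>) \<omega> = (\<Sum>k\<in>K. act A (t k) \<omega>)"
  by (simp add: act_def sum_distrib_left sum.swap[of _ K])

text \<open>
  Permutations of the boxes commute with the action of matrices, so relations among places are preserved.
\<close>

lemma exchange_space_act:
  assumes "t \<in> exchange_space" shows "act A t \<in> exchange_space"
  unfolding exchange_space_def
proof (intro CollectI conjI allI impI ballI)
  fix \<omega> show "act A t \<omega> = 0" if "\<omega> \<notin> words" using that by (rule act_outside)
next
  fix \<sigma> \<omega> assume s: "\<sigma> permutes boxes" "\<forall>p. fst (\<sigma> p) = fst p" and w: "\<omega> \<in> words"
  have "act A t (\<omega> \<circ> \<sigma>) = act A (scale (of_int (sign \<sigma>)) t) \<omega>"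
    unfolding act_permute[OF s(1) w] using assms s
    by (intro fun_cong[OF act_cong]) (simp add: exchange_space_def scale_def)
  then show "act A t (\<omega> \<circ> \<sigma>) = of_int (sign \<sigma>) * act A t \<omega>"
    unfolding act_scale by (simp only: scale_def)
next
  fix k Z \<omega> assume Z: "Z \<subseteq> boxes" "\<forall>t. (t, Suc k) \<in> boxes \<longrightarrow> t \<notin> fst ` Z" "k < card Z" and w: "\<omega> \<in> words"
  have "(\<Sum>\<sigma> | \<sigma> permutes Z. of_int (sign \<sigma>) * act A t (\<omega> \<circ> \<sigma>))
      = (\<Sum>\<sigma> | \<sigma> permutes Z. act A (\<lambda>\<omega>. of_int (sign \<sigma>) * t (\<omega> \<circ> \<sigma>)) \<omega>)"
  proof (intro sum.cong refl)
    fix \<sigma> assume "\<sigma> \<in> {\<sigma>. \<sigma> permutes Z}"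
    then have s: "\<sigma> permutes boxes" using Z(1) permutes_subset by blast
    show "of_int (sign \<sigma>) * act A t (\<omega> \<circ> \<sigma>) = act A (\<lambda>\<omega>. of_int (sign \<sigma>) * t (\<omega> \<circ> \<sigma>)) \<omega>"
      unfolding act_permute[OF s w] using fun_cong[OF act_scale[of A "of_int (sign \<sigma>)" "\<lambda>\<omega>. t (\<omega> \<circ> \<sigma>)"], of \<omega>]
      by (simp only: scale_def)
  qed
  also have "\<dots> = act A (\<lambda>\<omega>. \<Sum>\<sigma> | \<sigma> permutes Z. of_int (sign \<sigma>) * t (\<omega> \<circ> \<sigma>)) \<omega>"
    by (rule act_sum_tensor[symmetric])
  also have "\<dots> = act A 0 \<omega>"
    using assms Z by (intro fun_cong[OF act_cong]) (simp add: exchange_space_def)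
  finally show "(\<Sum>\<sigma> | \<sigma> permutes Z. of_int (sign \<sigma>) * act A t (\<omega> \<circ> \<sigma>)) = 0" by simp
qed

lemma exchange_space_add:
  assumes "t \<in> exchange_space" "s \<in> exchange_space" shows "t + s \<in> exchange_space"
  using assms unfolding exchange_space_def
  by (simp add: distrib_left sum.distrib)

lemma exchange_space_scale:
  assumes "t \<in> exchange_space" shows "scale c t \<in> exchange_space"
proof -
  have "(\<Sum>\<sigma> | \<sigma> permutes Z. of_int (sign \<sigma>) * (c * t (\<omega> \<circ> \<sigma>)))
      = c * (\<Sum>\<sigma> | \<sigma> permutes Z. of_int (sign \<sigma>) * t (\<omega> \<circ> \<sigma>))" for Z \<omega>
    by (simp add: sum_distrib_left mult.left_commute)
  with assms show ?thesis
    unfolding exchange_space_def scale_def by (simp add: mult.left_commute)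
qed

lemma exchange_space_zero: "0 \<in> exchange_space"
  by (simp add: exchange_space_def)

text \<open>
  For the exchange relation: if a word repeats a value on \<open>Z\<close>, swapping the two places pairs off the
  terms of the sum with opposite signs; otherwise some value on \<open>Z\<close> exceeds \<open>k\<close> and lies, after any
  permutation of \<open>Z\<close>, in a column too short for it, so that every term is 0.
\<close>

lemma hw_tensor_exchange_space: "hw_tensor \<in> exchange_space"
  unfolding exchange_space_def
proof (intro CollectI conjI allI impI ballI)
  fix \<omega> show "hw_tensor \<omega> = 0" if "\<omega> \<notin> words" using that by (simp add: hw_tensor_def)
next
  fix \<sigma> \<omega> assume "\<sigma> permutes boxes" "\<forall>p. fst (\<sigma> p) = fst p" "\<omega> \<in> words"
  then show "hw_tensor (\<omega> \<circ> \<sigma>) = of_int (sign \<sigma>) * hw_tensor \<omega>" by (intro hw_tensor_permute) auto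
next
  fix k Z \<omega> assume Z: "Z \<subseteq> boxes" "\<forall>t. (t, Suc k) \<in> boxes \<longrightarrow> t \<notin> fst ` Z" "k < card Z" and w: "\<omega> \<in> words"
  have fin: "finite Z" using Z(1) finite_boxes finite_subset by blast
  let ?f = "\<lambda>\<sigma>. of_int (sign \<sigma>) * hw_tensor (\<omega> \<circ> \<sigma>)"
  show "sum ?f {\<sigma>. \<sigma> permutes Z} = 0"
  proof (cases "inj_on \<omega> Z")
    case True
    have "card (\<omega> ` Z) = card Z" using True by (rule card_image)
    have "\<not> \<omega> ` Z \<subseteq> {1..k}"
    proof
      assume "\<omega> ` Z \<subseteq> {1..k}"
      then have "card (\<omega> ` Z) \<le> card {1..k}" by (rule card_mono[rotated]) simp
      then show False using \<open>card (\<omega> ` Z) = card Z\<close> Z(3) by simp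
    qed
    then obtain r where r: "r \<in> Z" "\<omega> r \<notin> {1..k}" by blast
    then have r': "Suc k \<le> \<omega> r" using wordsD[OF w, of r] Z(1) by auto
    have "hw_tensor (\<omega> \<circ> \<sigma>) = 0" if sZ: "\<sigma> permutes Z" for \<sigma>
    proof (rule ccontr)
      assume "hw_tensor (\<omega> \<circ> \<sigma>) \<noteq> 0"
      then have perm: "column_map (\<omega> \<circ> \<sigma>) permutes boxes" using hw_tensor_nonzeroD by blast
      have "r \<in> \<sigma> ` Z" using r(1) by (simp only: permutes_image[OF sZ])
      then obtain q where q: "q \<in> Z" "\<sigma> q = r" by (elim imageE) simp
      have "column_map (\<omega> \<circ> \<sigma>) q \<in> boxes"
        using permutes_in_image[OF perm, of q] subsetD[OF Z(1) q(1)] by (rule iffD2)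
      then have "(fst q, \<omega> r) \<in> boxes"
        using q(2) subsetD[OF Z(1) q(1)] by (simp only: column_map_def if_True comp_apply)
      then have "(fst q, Suc k) \<in> boxes" by (rule boxes_down) (use r' in auto)
      then show False using Z(2) imageI[OF q(1), of fst] by blast
    qed
    then show ?thesis by (intro sum.neutral) auto
  next
    case False
    then obtain p q where pq: "p \<in> Z" "q \<in> Z" "p \<noteq> q" "\<omega> p = \<omega> q" by (auto simp: inj_on_def)
    let ?s = "Transposition.transpose p q"
    have s: "?s permutes Z" using pq by (intro permutes_swap_id)
    have inv: "\<omega> \<circ> ?s = \<omega>" using pq by (auto simp: transpose_def)
    have "sum ?f {\<sigma>. \<sigma> permutes Z} = (\<Sum>\<sigma> | \<sigma> permutes Z. ?f (?s \<circ> \<sigma>))"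
      by (rule sum.reindex_bij_witness[where i = "\<lambda>\<sigma>. ?s \<circ> \<sigma>" and j = "\<lambda>\<sigma>. ?s \<circ> \<sigma>"])
        (use s in \<open>auto simp: comp_assoc[symmetric] permutes_compose\<close>)
    also have "\<dots> = (\<Sum>\<sigma> | \<sigma> permutes Z. - ?f \<sigma>)"
    proof (intro sum.cong refl)
      fix \<sigma> assume "\<sigma> \<in> {\<sigma>. \<sigma> permutes Z}"
      then have "permutation \<sigma>" "permutation ?s"
        using fin s permutes_imp_permutation by blast+
      then have "sign (?s \<circ> \<sigma>) = - sign \<sigma>" using pq by (simp add: sign_compose sign_swap_id)
      then show "?f (?s \<circ> \<sigma>) = - ?f \<sigma>" by (simp add: comp_assoc[symmetric] inv)
    qed
    also have "\<dots> = - sum ?f {\<sigma>. \<sigma> permutes Z}" by (rule sum_negf)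
    finally show ?thesis by simp
  qed
qed

end

section \<open>Generators of the special linear Lie algebra\<close>

text \<open>
  Matrices of unspecified dimension have no zero, so their sums are taken over lists, starting from
  the zero matrix of the right size.
\<close>

definition mat_sum :: "nat \<Rightarrow> ('i \<Rightarrow> complex mat) \<Rightarrow> 'i list \<Rightarrow> complex mat" where
  "mat_sum n F xs = foldr (\<lambda>x M. F x + M) xs (0\<^sub>m n n)"

lemma mat_sum_carrier: "(\<And>x. F x \<in> carrier_mat n n) \<Longrightarrow> mat_sum n F xs \<in> carrier_mat n n"
  by (induction xs) (auto simp: mat_sum_def)

lemma mat_sum_index:
  assumes "\<And>x. F x \<in> carrier_mat n n" "i < n" "j < n" "distinct xs"
  shows "mat_sum n F xs $$ (i, j) = (\<Sum>x\<in>set xs. F x $$ (i, j))"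
  using assms(4)
proof (induction xs)
  case (Cons x xs)
  have "mat_sum n F xs \<in> carrier_mat n n" by (rule mat_sum_carrier[OF assms(1)])
  then show ?case using Cons assms(2,3) assms(1)[of x] by (simp add: mat_sum_def)
qed (use assms in \<open>simp add: mat_sum_def\<close>)

lemma sl_carrier: "A \<in> sl n \<Longrightarrow> A \<in> carrier_mat n n"
  by (simp add: sl_def)

lemma sl_zero: "0\<^sub>m n n \<in> sl n"
  by (simp add: sl_def)

lemma sl_add: "A \<in> sl n \<Longrightarrow> B \<in> sl n \<Longrightarrow> A + B \<in> sl n"
  by (auto simp: sl_def sum.distrib)

lemma sl_smult: "A \<in> sl n \<Longrightarrow> c \<cdot>\<^sub>m A \<in> sl n"
  by (auto simp: sl_def sum_distrib_left[symmetric])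

lemma sl_bracket:
  assumes "A \<in> sl n" "B \<in> sl n" shows "A * B - B * A \<in> sl n"
proof -
  have AB: "A \<in> carrier_mat n n" "B \<in> carrier_mat n n" using assms by (auto simp: sl_def)
  have tr: "(\<Sum>i<n. (X * Y) $$ (i, i)) = (\<Sum>i<n. \<Sum>j<n. X $$ (i, j) * Y $$ (j, i))"
    if "X \<in> carrier_mat n n" "Y \<in> carrier_mat n n" for X Y :: "complex mat"
    using that by (intro sum.cong) (auto simp: scalar_prod_def atLeast0LessThan)
  have "(\<Sum>i<n. (A * B) $$ (i, i)) = (\<Sum>i<n. (B * A) $$ (i, i))"
    unfolding tr[OF AB] tr[OF AB(2,1)] by (subst sum.swap) (simp add: mult.commute)
  then have "(\<Sum>i<n. (A * B - B * A) $$ (i, i)) = 0"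
    using AB by (simp add: sum_subtractf)
  moreover have "A * B - B * A \<in> carrier_mat n n"
    by (intro minus_carrier_mat mult_carrier_mat[OF AB(2,1)])
  ultimately show ?thesis unfolding sl_def by blast
qed

lemma sl_mat_unit: "i \<noteq> j \<Longrightarrow> mat_unit n i j \<in> sl n"
  by (auto simp: sl_def mat_unit_def intro!: sum.neutral)

abbreviation coroot :: "nat \<Rightarrow> nat \<Rightarrow> complex mat" where
  "coroot n i \<equiv> mat_unit n i i - mat_unit n (Suc i) (Suc i)"

lemma coroot_index: "r < n \<Longrightarrow> c < n \<Longrightarrow> coroot n i $$ (r, c) =
    (if r = c then (if Suc r = i then 1 else 0) - (if r = i then 1 else 0) else 0)"
  by (auto simp: mat_unit_def)

lemma coroot_carrier: "coroot n i \<in> carrier_mat n n"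
  by (intro minus_carrier_mat mat_unit_carrier)

lemma sl_coroot:
  assumes "1 \<le> i" "i < n" shows "coroot n i \<in> sl n"
proof -
  have "(\<Sum>r<n. coroot n i $$ (r, r))
      = (\<Sum>r<n. if r = i - 1 then 1 else 0) - (\<Sum>r<n. if r = i then 1 else 0)"
    unfolding sum_subtractf[symmetric]
    by (intro sum.cong refl) (use assms in \<open>auto simp: coroot_index simp del: index_minus_mat\<close>)
  also have "\<dots> = 0" using assms by simp
  finally show ?thesis unfolding sl_def using coroot_carrier by blast
qed

text \<open>
  A traceless diagonal matrix is the combination of the simple coroots with the partial sums of its
  diagonal as coefficients.
\<close>

lemma sl_diagonal_induct:
  assumes X: "X \<in> sl n" and diag: "\<And>i j. i < n \<Longrightarrow> j < n \<Longrightarrow> i \<noteq> j \<Longrightarrow> X $$ (i, j) = 0"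
    and zero: "P (0\<^sub>m n n)"
    and add: "\<And>A B. A \<in> sl n \<Longrightarrow> B \<in> sl n \<Longrightarrow> P A \<Longrightarrow> P B \<Longrightarrow> P (A + B)"
    and smult: "\<And>A c. A \<in> sl n \<Longrightarrow> P A \<Longrightarrow> P (c \<cdot>\<^sub>m A)"
    and coroot: "\<And>i. 1 \<le> i \<Longrightarrow> i < n \<Longrightarrow> P (coroot n i)"
  shows "P X"
proof -
  (* the last partial sum is the trace, hence 0 *)
  define s where "s i = (\<Sum>k<i. X $$ (k, k))" for i
  let ?F = "\<lambda>i. s i \<cdot>\<^sub>m coroot n i"
  have F: "?F i \<in> carrier_mat n n" for i by (intro smult_carrier_mat coroot_carrier)
  have X_eq: "X = mat_sum n ?F [1..<n]"
  proof (rule eq_matI)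
    fix i j assume ij: "i < dim_row (mat_sum n ?F [1..<n])" "j < dim_col (mat_sum n ?F [1..<n])"
    then have ij: "i < n" "j < n" using carrier_matD[OF mat_sum_carrier[of ?F n "[1..<n]", OF F]] by simp_all
    have "(\<Sum>k\<in>{1..<n}. ?F k $$ (i, j)) = X $$ (i, j)"
    proof (cases "i = j")
      case False
      then show ?thesis using diag[OF ij False] ij by (auto simp: mat_unit_def intro!: sum.neutral)
    next
      case True
      have "(\<Sum>k\<in>{1..<n}. ?F k $$ (i, j))
          = (\<Sum>k\<in>{1..<n}. (if k = Suc i then s k else 0) - (if k = i then s k else 0))"
        using ij True by (intro sum.cong refl) (auto simp: mat_unit_def)
      also have "\<dots> = (if Suc i < n then s (Suc i) else 0) - (if 1 \<le> i then s i else 0)"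
        using ij by (simp add: sum_subtractf)
      also have "\<dots> = s (Suc i) - s i"
      proof -
        have "s n = 0" using X by (simp add: s_def sl_def)
        moreover have "Suc i < n \<or> Suc i = n" using ij by auto
        moreover have "s 0 = 0" by (simp add: s_def)
        ultimately show ?thesis by (cases "i = 0") auto
      qed
      also have "\<dots> = X $$ (i, j)" using True by (simp add: s_def)
      finally show ?thesis .
    qed
    then show "X $$ (i, j) = mat_sum n ?F [1..<n] $$ (i, j)"
      unfolding mat_sum_index[of ?F n, OF F ij distinct_upt] by simp
  qed (simp_all only: carrier_matD[OF mat_sum_carrier[of ?F n "[1..<n]", OF F]] carrier_matD[OF sl_carrier[OF X]])
  have S: "mat_sum n ?F xs \<in> sl n \<and> P (mat_sum n ?F xs)" if "set xs \<subseteq> {1..<n}" for xs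
    using that
  proof (induction xs)
    case Nil
    then show ?case by (simp add: mat_sum_def zero sl_zero)
  next
    case (Cons i xs)
    then have "1 \<le> i" "i < n" by auto
    then have "?F i \<in> sl n" "P (?F i)" using sl_coroot coroot smult sl_smult by blast+
    with Cons show ?case
      using sl_add add by (auto simp: mat_sum_def)
  qed
  have "P (mat_sum n ?F [1..<n])" by (rule conjunct2[OF S]) simp
  then show ?thesis by (simp only: X_eq[symmetric])
qed

lemma sl_induct:
  assumes X: "X \<in> sl n"
    and zero: "P (0\<^sub>m n n)"
    and add: "\<And>A B. A \<in> sl n \<Longrightarrow> B \<in> sl n \<Longrightarrow> P A \<Longrightarrow> P B \<Longrightarrow> P (A + B)"
    and smult: "\<And>A c. A \<in> sl n \<Longrightarrow> P A \<Longrightarrow> P (c \<cdot>\<^sub>m A)"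
    and coroot: "\<And>i. 1 \<le> i \<Longrightarrow> i < n \<Longrightarrow> P (coroot n i)"
    and unit: "\<And>i j. 1 \<le> i \<Longrightarrow> i \<le> n \<Longrightarrow> 1 \<le> j \<Longrightarrow> j \<le> n \<Longrightarrow> i \<noteq> j \<Longrightarrow> P (mat_unit n i j)"
  shows "P X"
proof -
  define D where "D = mat n n (\<lambda>(i, j). if i = j then X $$ (i, j) else 0)"
  have D: "D \<in> sl n" using X by (simp add: D_def sl_def)
  have PD: "P D"
    by (rule sl_diagonal_induct[OF D _ zero add smult coroot]) (auto simp: D_def)
  let ?ps = "filter (\<lambda>(i, j). i \<noteq> j) (List.product [0..<n] [0..<n])"
  let ?F = "\<lambda>(i, j). X $$ (i, j) \<cdot>\<^sub>m mat_unit n (Suc i) (Suc j)"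
  have F: "?F p \<in> carrier_mat n n" for p by (cases p) (simp add: mat_unit_def)
  have S: "mat_sum n ?F xs \<in> sl n \<and> P (mat_sum n ?F xs)" if "set xs \<subseteq> set ?ps" for xs
    using that
  proof (induction xs)
    case Nil
    then show ?case by (simp add: mat_sum_def zero sl_zero)
  next
    case (Cons p xs)
    obtain i j where p: "p = (i, j)" by fastforce
    then have "i < n" "j < n" "i \<noteq> j" using Cons.prems by auto
    then have "?F p \<in> sl n" "P (?F p)"
      unfolding p prod.case by (intro smult sl_smult sl_mat_unit unit; simp)+
    with Cons show ?case
      using sl_add add by (auto simp: mat_sum_def)
  qed
  have X_eq: "X = D + mat_sum n ?F ?ps"
  proof (rule eq_matI)
    fix i j assume ij: "i < dim_row (D + mat_sum n ?F ?ps)" "j < dim_col (D + mat_sum n ?F ?ps)"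
    then have ij: "i < n" "j < n" using carrier_matD[OF mat_sum_carrier[of ?F n ?ps, OF F]] by simp_all
    have d: "distinct ?ps" by (intro distinct_filter distinct_product) auto
    have "mat_sum n ?F ?ps $$ (i, j) = (\<Sum>p\<in>set ?ps. if p = (i, j) then X $$ (i, j) else 0)"
      unfolding mat_sum_index[of ?F n, OF F ij d]
      by (intro sum.cong refl) (use ij in \<open>auto simp: mat_unit_def split: if_splits\<close>)
    also have "\<dots> = (if i \<noteq> j then X $$ (i, j) else 0)"
      using ij by (subst sum.delta) auto
    finally have M: "mat_sum n ?F ?ps $$ (i, j) = (if i \<noteq> j then X $$ (i, j) else 0)" .
    have "(D + mat_sum n ?F ?ps) $$ (i, j) = D $$ (i, j) + mat_sum n ?F ?ps $$ (i, j)"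
      by (rule index_add_mat(1)) (simp_all only: carrier_matD[OF mat_sum_carrier[of ?F n ?ps, OF F]] ij)
    then show "X $$ (i, j) = (D + mat_sum n ?F ?ps) $$ (i, j)"
      unfolding M D_def using ij by simp
  qed (simp_all only: index_add_mat carrier_matD[OF mat_sum_carrier[of ?F n ?ps, OF F]] carrier_matD[OF sl_carrier[OF X]])
  have "P (D + mat_sum n ?F ?ps)"
    using S[OF subset_refl] by (intro add D PD) simp_all
  then show ?thesis by (simp only: X_eq[symmetric])
qed

text \<open>
  Half the sum of the positive coroots: a diagonal matrix whose entries decrease by 1, so that
  lowering by \<open>f\<^bsub>i,j\<^esub>\<close> decreases its eigenvalue by \<open>j - i\<close>.
\<close>

definition grading :: "nat \<Rightarrow> complex mat" where
  "grading n = mat n n (\<lambda>(i, j). if i = j then of_nat (Suc n) / 2 - of_nat (Suc i) else 0)"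

lemma grading_carrier [simp]: "grading n \<in> carrier_mat n n"
  by (simp add: grading_def)

lemma entry_grading: "i \<in> {1..n} \<Longrightarrow> j \<in> {1..n} \<Longrightarrow>
    entry (grading n) i j = (if i = j then of_nat (Suc n) / 2 - of_nat i else 0)"
  by (auto simp: grading_def)

lemma sl_grading: "grading n \<in> sl n"
proof -
  have "(\<Sum>i<m. of_nat (Suc i)) = (of_nat m * of_nat (Suc m) / 2 :: complex)" for m
    by (induction m) (simp_all add: field_simps)
  then have "(\<Sum>i<n. grading n $$ (i, i)) = 0"
    by (simp add: grading_def sum_subtractf del: of_nat_Suc)
  then show ?thesis by (simp add: sl_def)
qed

lemma entry_eqI:
  assumes "A \<in> carrier_mat n n" "B \<in> carrier_mat n n"
    and "\<And>i j. i \<in> {1..n} \<Longrightarrow> j \<in> {1..n} \<Longrightarrow> entry A i j = entry B i j"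
  shows "A = B"
proof (rule eq_matI)
  fix i j assume "i < dim_row B" "j < dim_col B"
  then show "A $$ (i, j) = B $$ (i, j)" using assms(3)[of "Suc i" "Suc j"] assms(2) by simp
qed (use assms in auto)

lemma grading_bracket:
  assumes "k \<in> {1..n}" "l \<in> {1..n}"
  shows "grading n * mat_unit n k l - mat_unit n k l * grading n
    = (of_nat l - of_nat k) \<cdot>\<^sub>m mat_unit n k l"
proof (rule entry_eqI)
  fix i j assume ij: "i \<in> {1..n}" "j \<in> {1..n}"
  let ?h = "\<lambda>i. of_nat (Suc n) / 2 - of_nat i :: complex"
  have 1: "entry (grading n * mat_unit n k l) i j = ?h i * entry (mat_unit n k l) i j"
  proof -
    have "entry (grading n * mat_unit n k l) i j
        = (\<Sum>m = 1..n. if m = i then ?h i * entry (mat_unit n k l) i j else 0)"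
      unfolding entry_mult[OF grading_carrier mat_unit_carrier ij]
      by (intro sum.cong refl) (use ij in \<open>auto simp: entry_grading simp del: One_nat_def\<close>)
    then show ?thesis using ij by (simp only: sum.delta finite_atLeastAtMost if_True)
  qed
  have 2: "entry (mat_unit n k l * grading n) i j = entry (mat_unit n k l) i j * ?h j"
  proof -
    have "entry (mat_unit n k l * grading n) i j
        = (\<Sum>m = 1..n. if m = j then entry (mat_unit n k l) i j * ?h j else 0)"
      unfolding entry_mult[OF mat_unit_carrier grading_carrier ij]
      by (intro sum.cong refl) (use ij in \<open>auto simp: entry_grading simp del: One_nat_def\<close>)
    then show ?thesis using ij by (simp only: sum.delta finite_atLeastAtMost if_True)
  qed
  show "entry (grading n * mat_unit n k l - mat_unit n k l * grading n) i j
      = entry ((of_nat l - of_nat k) \<cdot>\<^sub>m mat_unit n k l) i j"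
    unfolding entry_minus[OF mult_carrier_mat[OF grading_carrier mat_unit_carrier]
        mult_carrier_mat[OF mat_unit_carrier grading_carrier] ij] 1 2
      entry_smult[OF mat_unit_carrier ij] entry_mat_unit[OF ij]
    by simp
qed (intro minus_carrier_mat mult_carrier_mat[OF mat_unit_carrier grading_carrier]
    smult_carrier_mat mat_unit_carrier)+

lemma (in young_shape) sum_boxes: "(\<Sum>p\<in>boxes. f (snd p)) = (\<Sum>i = 1..<n. of_nat (row_len n a i) * (f i :: complex))"
proof -
  have "(\<Sum>p\<in>boxes. f (snd p)) = (\<Sum>(i, t)\<in>(SIGMA i:{1..<n}. {..<row_len n a i}). f i)"
    by (rule sum.reindex_bij_witness[where i = "\<lambda>(i, t). (t, i)" and j = "\<lambda>(t, i). (i, t)"])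
      (auto simp: boxes_def)
  also have "\<dots> = (\<Sum>i = 1..<n. \<Sum>t<row_len n a i. f i)"
    by (rule sum.Sigma[symmetric]) simp_all
  also have "\<dots> = (\<Sum>i = 1..<n. of_nat (row_len n a i) * f i)"
    by (simp only: sum_constant card_lessThan)
  finally show ?thesis .
qed

section \<open>Embedding an irreducible representation\<close>

locale hw_model = irreducible_highest_weight_rep smul n \<rho> a v + young_shape n a
  for smul :: "complex \<Rightarrow> 'v :: ab_group_add \<Rightarrow> 'v"
    and n :: nat and \<rho> :: "complex mat \<Rightarrow> 'v \<Rightarrow> 'v" and a :: "nat \<Rightarrow> nat" and v :: 'v
begin

lemma rho_plus: "A \<in> sl n \<Longrightarrow> \<rho> A (x + y) = \<rho> A x + \<rho> A y"
  using rep_linear[of A] by (simp add: Vector_Spaces.linear_def module_hom_def module_hom_axioms_def)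

lemma rho_smul: "A \<in> sl n \<Longrightarrow> \<rho> A (smul c x) = smul c (\<rho> A x)"
  using rep_linear[of A] by (simp add: Vector_Spaces.linear_def module_hom_def module_hom_axioms_def)

lemma rho_zero: "A \<in> sl n \<Longrightarrow> \<rho> A 0 = 0"
  using rho_plus[of A 0 0] by simp

lemma rho_zero_mat: "\<rho> (0\<^sub>m n n) x = 0"
  using rep_smult[OF sl_zero, of 0 x] by simp

lemma lowering_sl: "i < j \<Longrightarrow> lowering n i j \<in> sl n"
  by (simp add: lowering_def sl_mat_unit)

text \<open>
  The submodule of \<open>V \<oplus> T\<close> generated by the pair of highest weight vectors, where \<open>T\<close> is the space of
  tensors. It turns out to be the graph of an injective homomorphism from \<open>V\<close> to \<open>T\<close>.
\<close>

inductive_set graph :: "('v \<times> tensor) set" where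
  base: "(v, hw_tensor) \<in> graph"
| zero: "(0, 0) \<in> graph"
| add: "(x, t) \<in> graph \<Longrightarrow> (y, s) \<in> graph \<Longrightarrow> (x + y, t + s) \<in> graph"
| smult: "(x, t) \<in> graph \<Longrightarrow> (smul c x, scale c t) \<in> graph"
| lower: "(x, t) \<in> graph \<Longrightarrow> 1 \<le> i \<Longrightarrow> i < j \<Longrightarrow> j \<le> n \<Longrightarrow>
    (\<rho> (lowering n i j) x, act (lowering n i j) t) \<in> graph"

lemma act_coroot_hw_tensor:
  assumes "1 \<le> i" "i < n" shows "act (coroot n i) hw_tensor = scale (of_nat (a i)) hw_tensor"
proof -
  have "(\<Sum>p\<in>boxes. entry (coroot n i) (snd p) (snd p))
      = (\<Sum>r = 1..<n. of_nat (row_len n a r) * entry (coroot n i) r r)"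
    by (rule sum_boxes)
  also have "\<dots> = (\<Sum>r = 1..<n. (if r = i then of_nat (row_len n a r) else 0)
      - (if r = Suc i then of_nat (row_len n a r) else 0))"
  proof (intro sum.cong refl)
    fix r assume "r \<in> {1..<n}"
    then have "r - 1 < n" "Suc (r - 1) = r" "r - 1 = i \<longleftrightarrow> r = Suc i" by auto
    then show "of_nat (row_len n a r) * entry (coroot n i) r r
      = (if r = i then of_nat (row_len n a r) else 0) - (if r = Suc i then of_nat (row_len n a r) else (0::complex))"
      by (simp only: coroot_index[OF \<open>r - 1 < n\<close> \<open>r - 1 < n\<close>] if_True split: if_split) simp
  qed
  also have "\<dots> = of_nat (row_len n a i) - (if Suc i < n then of_nat (row_len n a (Suc i)) else 0)"
    using assms by (simp add: sum_subtractf)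
  also have "\<dots> = of_nat (row_len n a i) - of_nat (row_len n a (Suc i))"
    using assms by (cases "Suc i = n") auto
  also have "\<dots> = of_nat (a i)" using row_len_Suc[of i n a] assms by simp
  finally have "(\<Sum>p\<in>boxes. entry (coroot n i) (snd p) (snd p)) = of_nat (a i)" .
  moreover have "act (coroot n i) hw_tensor = scale (\<Sum>p\<in>boxes. entry (coroot n i) (snd p) (snd p)) hw_tensor"
    by (rule hw_tensor_diagonal) (auto simp: mat_unit_def)
  ultimately show ?thesis by simp
qed

text \<open>
  Closure under lowering operators suffices for a submodule: any other operator can be commuted past
  them to the right until it meets the highest weight vectors.
\<close>

lemma graph_act:
  assumes "(x, t) \<in> graph" "X \<in> sl n" shows "(\<rho> X x, act X t) \<in> graph"
  using assms
proof (induction arbitrary: X)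
  case base
  then show ?case
  proof (rule sl_induct)
    have "act (0\<^sub>m n n) hw_tensor = 0"
      using act_smult[of "0\<^sub>m n n" 0 hw_tensor] by (auto simp: scale_def fun_eq_iff)
    then show "(\<rho> (0\<^sub>m n n) v, act (0\<^sub>m n n) hw_tensor) \<in> graph"
      using graph.zero by (simp only: rho_zero_mat)
    show "(\<rho> (A + B) v, act (A + B) hw_tensor) \<in> graph"
      if "A \<in> sl n" "B \<in> sl n" "(\<rho> A v, act A hw_tensor) \<in> graph" "(\<rho> B v, act B hw_tensor) \<in> graph" for A B
      using graph.add[OF that(3,4)] that(1,2)
      by (simp only: rep_add act_add[OF sl_carrier sl_carrier])
    show "(\<rho> (c \<cdot>\<^sub>m A) v, act (c \<cdot>\<^sub>m A) hw_tensor) \<in> graph"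
      if "A \<in> sl n" "(\<rho> A v, act A hw_tensor) \<in> graph" for A c
      using graph.smult[OF that(2)] that(1) by (simp only: rep_smult act_smult[OF sl_carrier])
    show "(\<rho> (coroot n i) v, act (coroot n i) hw_tensor) \<in> graph" if "1 \<le> i" "i < n" for i
      using graph.smult[OF graph.base] that by (simp only: hw_weight act_coroot_hw_tensor)
    show "(\<rho> (mat_unit n i j) v, act (mat_unit n i j) hw_tensor) \<in> graph"
      if ij: "1 \<le> i" "i \<le> n" "1 \<le> j" "j \<le> n" "i \<noteq> j" for i j
    proof (cases "i < j")
      case True
      then show ?thesis using ij graph.zero by (simp only: hw_raising hw_tensor_raising)
    next
      case False
      then have "j < i" using ij by simp
      from graph.lower[OF graph.base ij(3) this ij(2)] show ?thesis by (simp only: lowering_def)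
    qed
  qed
next
  case zero
  then show ?case using graph.zero by (simp only: rho_zero act_zero)
next
  case (add x t y s)
  then show ?case using graph.add by (simp only: rho_plus act_plus)
next
  case (smult x t c)
  then show ?case using graph.smult by (simp only: rho_smul act_scale)
next
  case (lower x t i j)
  let ?f = "lowering n i j"
  have f: "?f \<in> sl n" using lower.hyps by (intro lowering_sl)
  have br: "X * ?f - ?f * X \<in> sl n" by (rule sl_bracket[OF lower.prems f])
  have "\<rho> X (\<rho> ?f x) = \<rho> ?f (\<rho> X x) + \<rho> (X * ?f - ?f * X) x"
    by (simp add: rep_bracket[OF lower.prems f])
  moreover have "act X (act ?f t) = act ?f (act X t) + act (X * ?f - ?f * X) t"
    using act_bracket[OF sl_carrier[OF lower.prems] sl_carrier[OF f], of t] by simp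
  ultimately show ?case
    using graph.add[OF graph.lower[OF lower.IH[OF lower.prems] lower.hyps(2-4)] lower.IH[OF br]]
    by (simp only:)
qed

lemma graph_exchange_space: "(x, t) \<in> graph \<Longrightarrow> t \<in> exchange_space"
  by (induction rule: graph.induct)
    (simp_all only: hw_tensor_exchange_space exchange_space_zero exchange_space_add exchange_space_scale exchange_space_act)

lemma grading_v: "\<exists>\<mu>. \<rho> (grading n) v = smul \<mu> v"
proof (rule sl_diagonal_induct[OF sl_grading])
  show "grading n $$ (i, j) = 0" if "i < n" "j < n" "i \<noteq> j" for i j
    using that by (simp add: grading_def)
  show "\<exists>\<mu>. \<rho> (0\<^sub>m n n) v = smul \<mu> v"
    using rho_zero_mat scale_zero_left by metis
  show "\<exists>\<mu>. \<rho> (A + B) v = smul \<mu> v"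
    if "A \<in> sl n" "B \<in> sl n" "\<exists>\<mu>. \<rho> A v = smul \<mu> v" "\<exists>\<mu>. \<rho> B v = smul \<mu> v" for A B
    using that rep_add scale_left_distrib by metis
  show "\<exists>\<mu>. \<rho> (c \<cdot>\<^sub>m A) v = smul \<mu> v" if "A \<in> sl n" "\<exists>\<mu>. \<rho> A v = smul \<mu> v" for A c
    using that rep_smult scale_scale by metis
  show "\<exists>\<mu>. \<rho> (coroot n i) v = smul \<mu> v" if "1 \<le> i" "i < n" for i
    using hw_weight[OF that] by blast
qed

definition top_grade :: complex where
  "top_grade = (SOME \<mu>. \<rho> (grading n) v = smul \<mu> v)"

lemma grading_top: "\<rho> (grading n) v = smul top_grade v"
  unfolding top_grade_def using grading_v by (rule someI_ex)

text \<open>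
  The sum of the eigenspaces of the grading for eigenvalues below that of \<open>v\<close>.
\<close>

inductive_set low :: "'v set" where
  eigen: "\<rho> (grading n) x = smul (top_grade - of_nat d) x \<Longrightarrow> 1 \<le> d \<Longrightarrow> x \<in> low"
| plus: "x \<in> low \<Longrightarrow> y \<in> low \<Longrightarrow> x + y \<in> low"

lemma low_smul: "x \<in> low \<Longrightarrow> smul c x \<in> low"
proof (induction rule: low.induct)
  case (eigen x d)
  then have "\<rho> (grading n) (smul c x) = smul (top_grade - of_nat d) (smul c x)"
    by (simp add: rho_smul[OF sl_grading] scale_left_commute)
  then show ?case using eigen(2) by (rule low.eigen)
next
  case (plus x y)
  then show ?case by (simp add: scale_right_distrib low.plus)
qed

lemma low_zero: "0 \<in> low"
  by (rule low.eigen[of _ 1]) (simp_all add: rho_zero[OF sl_grading])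

lemma grading_lowering:
  assumes "1 \<le> i" "i < j" "j \<le> n" and x: "\<rho> (grading n) x = smul (top_grade - of_nat d) x"
  shows "\<rho> (lowering n i j) x \<in> low"
proof (rule low.eigen)
  let ?f = "lowering n i j" and ?g = "grading n"
  have f: "?f \<in> sl n" using assms by (intro lowering_sl)
  have br: "?g * ?f - ?f * ?g = (of_nat i - of_nat j) \<cdot>\<^sub>m ?f"
    unfolding lowering_def using assms by (intro grading_bracket) auto
  have "\<rho> ?g (\<rho> ?f x) = \<rho> ?f (\<rho> ?g x) + \<rho> (?g * ?f - ?f * ?g) x"
    by (simp add: rep_bracket[OF sl_grading f])
  also have "\<dots> = smul (top_grade - of_nat d) (\<rho> ?f x) + smul (of_nat i - of_nat j) (\<rho> ?f x)"
    unfolding br x by (simp add: rep_smult[OF f] rho_smul[OF f])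
  also have "\<dots> = smul (top_grade - of_nat (d + (j - i))) (\<rho> ?f x)"
  proof -
    have "(top_grade - of_nat d) + (of_nat i - of_nat j) = top_grade - of_nat (d + (j - i))"
      using assms(2) by (simp add: of_nat_diff)
    then show ?thesis by (simp only: scale_left_distrib[symmetric])
  qed
  finally show "\<rho> ?g (\<rho> ?f x) = smul (top_grade - of_nat (d + (j - i))) (\<rho> ?f x)" .
  show "1 \<le> d + (j - i)" using assms by simp
qed

lemma lowering_low:
  assumes "1 \<le> i" "i < j" "j \<le> n" "x \<in> low" shows "\<rho> (lowering n i j) x \<in> low"
  using assms(4)
proof (induction rule: low.induct)
  case (eigen x d)
  then show ?case by (intro grading_lowering[OF assms(1-3)])
next
  case (plus x y)
  have f: "lowering n i j \<in> sl n" using assms by (intro lowering_sl)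
  show ?case unfolding rho_plus[OF f] using plus.IH by (rule low.plus)
qed

text \<open>
  The product of \<open>H - (\<mu> - e)\<close> for \<open>e\<close> from 1 to \<open>d\<close>, with \<open>H\<close> the grading and \<open>\<mu>\<close> its eigenvalue at \<open>v\<close>.
  For large \<open>d\<close> it annihilates a given vector of \<open>low\<close>, but it multiplies \<open>v\<close> by \<open>d!\<close>; hence \<open>v\<close> is
  not in \<open>low\<close>.
\<close>

primrec lower_grades :: "nat \<Rightarrow> 'v \<Rightarrow> 'v" where
  "lower_grades 0 x = x"
| "lower_grades (Suc d) x = \<rho> (grading n) (lower_grades d x) - smul (top_grade - of_nat (Suc d)) (lower_grades d x)"

lemma lower_grades_plus: "lower_grades d (x + y) = lower_grades d x + lower_grades d y"
  by (induction d) (simp_all add: rho_plus[OF sl_grading] scale_right_distrib)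

lemma lower_grades_eigen:
  assumes "\<rho> (grading n) x = smul (top_grade - of_nat e) x"
  shows "lower_grades d x = smul (\<Prod>k = 1..d. of_nat k - of_nat e) x"
proof (induction d)
  case (Suc d)
  let ?c = "\<Prod>k = 1..d. of_nat k - of_nat e :: complex"
  have "lower_grades (Suc d) x = smul (?c * (top_grade - of_nat e) - (top_grade - of_nat (Suc d)) * ?c) x"
    unfolding lower_grades.simps Suc by (simp only: rho_smul[OF sl_grading] assms scale_scale scale_left_diff_distrib[symmetric])
  also have "?c * (top_grade - of_nat e) - (top_grade - of_nat (Suc d)) * ?c
      = (\<Prod>k = 1..Suc d. of_nat k - of_nat e)"
    by (simp add: algebra_simps)
  finally show ?case .
qed simp

lemma lower_grades_low: "x \<in> low \<Longrightarrow> \<exists>M. \<forall>d\<ge>M. lower_grades d x = 0"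
proof (induction rule: low.induct)
  case (eigen x e)
  have "lower_grades d x = 0" if "d \<ge> e" for d
  proof -
    have "(\<Prod>k = 1..d. of_nat k - of_nat e :: complex) = 0"
      using that eigen(2) by (intro prod_zero) auto
    then show ?thesis using lower_grades_eigen[OF eigen(1), of d] by simp
  qed
  then show ?case by blast
next
  case (plus x y)
  then obtain M M' where "\<forall>d\<ge>M. lower_grades d x = 0" "\<forall>d\<ge>M'. lower_grades d y = 0" by blast
  then have "\<forall>d\<ge>max M M'. lower_grades d (x + y) = 0" by (simp add: lower_grades_plus)
  then show ?case by blast
qed

lemma v_low_independent:
  assumes "smul c v + l = 0" "l \<in> low" shows "c = 0"
proof -
  obtain M where M: "\<forall>d\<ge>M. lower_grades d l = 0" using lower_grades_low[OF assms(2)] by blast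
  have "\<rho> (grading n) (smul c v) = smul (top_grade - of_nat 0) (smul c v)"
    by (simp add: rho_smul[OF sl_grading] grading_top scale_left_commute)
  from lower_grades_eigen[OF this] have "lower_grades M (smul c v) = smul (\<Prod>k = 1..M. of_nat k) (smul c v)"
    by simp
  moreover have "lower_grades M (smul c v) = 0"
  proof -
    have "lower_grades M (smul c v + l) = lower_grades M (smul c v) + lower_grades M l" by (rule lower_grades_plus)
    moreover have "lower_grades M 0 = 0" using lower_grades_plus[of M 0 0] by simp
    ultimately show ?thesis using assms(1) M by simp
  qed
  moreover have "(\<Prod>k = 1..M. of_nat k :: complex) \<noteq> 0" by simp
  ultimately show "c = 0" using hw_nonzero by simp
qed

text \<open>
  The coefficient of \<open>v\<close> in the first component is seen in the second one by pairing with the highest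
  weight tensor, which is orthogonal to everything lowered.
\<close>

lemma graph_top_component:
  "(x, t) \<in> graph \<Longrightarrow> \<exists>c l. l \<in> low \<and> x = smul c v + l \<and> form t hw_tensor = c * form hw_tensor hw_tensor"
proof (induction rule: graph.induct)
  case base
  then show ?case using low_zero by (intro exI[of _ 1] exI[of _ 0]) simp
next
  case zero
  then show ?case using low_zero
    by (intro exI[of _ 0] exI[of _ 0]) (simp only: form_zero_left scale_zero_left mult_zero_left add_0 HOL.simp_thms)
next
  case (add x t y s)
  then obtain c l c' l' where *: "l \<in> low" "x = smul c v + l" "form t hw_tensor = c * form hw_tensor hw_tensor"
    "l' \<in> low" "y = smul c' v + l'" "form s hw_tensor = c' * form hw_tensor hw_tensor" by blast
  have "l + l' \<in> low" using *(1,4) by (rule low.plus)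
  moreover have "x + y = smul (c + c') v + (l + l')" using *(2,5) by (simp add: scale_left_distrib)
  moreover have "form (t + s) hw_tensor = (c + c') * form hw_tensor hw_tensor"
    by (simp only: form_plus_left *(3,6) distrib_right)
  ultimately show ?case by blast
next
  case (smult x t d)
  then obtain c l where *: "l \<in> low" "x = smul c v + l" "form t hw_tensor = c * form hw_tensor hw_tensor" by blast
  have "smul d l \<in> low" using *(1) by (rule low_smul)
  moreover have "smul d x = smul (d * c) v + smul d l"
    by (simp only: *(2) scale_right_distrib scale_scale)
  moreover have "form (scale d t) hw_tensor = (d * c) * form hw_tensor hw_tensor"
    by (simp only: form_scale_left *(3) mult.assoc)
  ultimately show ?case by blast
next
  case (lower x t i j)
  then obtain c l where *: "l \<in> low" "x = smul c v + l" by blast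
  have f: "lowering n i j \<in> sl n" using lower.hyps by (intro lowering_sl)
  have "\<rho> (lowering n i j) v \<in> low"
    using grading_lowering[OF lower.hyps(2-4), of v 0] grading_top by simp
  then have "\<rho> (lowering n i j) x \<in> low"
    using * lowering_low[OF lower.hyps(2-4)] by (simp add: rho_plus[OF f] rho_smul[OF f] low.plus low_smul)
  moreover have "form (act (lowering n i j) t) hw_tensor = 0"
  proof -
    have "form (act (mat_unit n j i) t) hw_tensor = form t (act (mat_unit n i j) hw_tensor)"
      using lower.hyps by (intro form_adjoint) auto
    then show ?thesis
      by (simp only: lowering_def hw_tensor_raising[OF lower.hyps(2-4)] form_zero_right)
  qed
  ultimately show ?case
    by (intro exI[of _ 0] exI[of _ "\<rho> (lowering n i j) x"])
      (simp only: scale_zero_left add_0 mult_zero_left HOL.simp_thms)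
qed

text \<open>
  The tensors paired with 0 form a submodule that is orthogonal to the highest weight tensor, hence, by
  adjointness, to all tensors occurring in the graph and in particular to themselves. Positivity of the
  form leaves only 0.
\<close>

lemma graph_right_kernel:
  assumes "(0, t) \<in> graph" shows "t = 0"
proof -
  have orth: "form t hw_tensor = 0" if zt: "(0, t) \<in> graph" for t
  proof -
    obtain c l where *: "l \<in> low" "0 = smul c v + l" "form t hw_tensor = c * form hw_tensor hw_tensor"
      using graph_top_component[OF zt] by blast
    then have "c = 0" using v_low_independent[of c l] by simp
    then show ?thesis using * by simp
  qed
  have "(x, s) \<in> graph \<Longrightarrow> (0, t) \<in> graph \<Longrightarrow> form t s = 0" for x s t
  proof (induction arbitrary: t rule: graph.induct)
    case (lower x s i j)
    have "mat_unit n i j \<in> sl n" using lower.hyps by (intro sl_mat_unit) auto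
    then have "(0, act (mat_unit n i j) t) \<in> graph"
      using graph_act[OF lower.prems, of "mat_unit n i j"] by (simp add: rho_zero)
    then have "form (act (mat_unit n i j) t) s = 0" by (rule lower.IH)
    then show ?case using lower.hyps by (simp add: lowering_def form_adjoint)
  next
    case zero
    show ?case by (rule form_zero_right)
  qed (simp_all only: orth form_plus_right form_scale_right add_0 mult_zero_right)
  then have "form t t = 0" using assms by blast
  then have "t \<omega> = 0" if "\<omega> \<in> words" for \<omega> using that by (rule form_positive)
  moreover have "t \<omega> = 0" if "\<omega> \<notin> words" for \<omega>
    using graph_exchange_space[OF assms] that unfolding exchange_space_def by blast
  ultimately show ?thesis by (metis ext zero_fun_apply)
qed

lemma graph_diff: "(x, t) \<in> graph \<Longrightarrow> (x, s) \<in> graph \<Longrightarrow> t = s"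
proof -
  assume "(x, t) \<in> graph" "(x, s) \<in> graph"
  then have "(x + smul (- 1) x, t + scale (- 1) s) \<in> graph" by (intro graph.add graph.smult)
  moreover have "x + smul (- 1) x = 0" by simp
  ultimately have "(0, t + scale (- 1) s) \<in> graph" by (simp only:)
  then have "t + scale (- 1) s = 0" by (rule graph_right_kernel)
  then show "t = s" by (simp add: scale_def fun_eq_iff)
qed

text \<open>
  The vectors paired with 0 form a submodule, which is not all of \<open>V\<close> because the highest weight tensor
  is not 0.
\<close>

lemma graph_left_kernel:
  assumes "(x, 0) \<in> graph" shows "x = 0"
proof -
  let ?U = "{x. (x, 0) \<in> graph}"
  have "?U = {0} \<or> ?U = UNIV"
  proof (rule irreducible)
    show "subspace ?U"
      unfolding subspace_def mem_Collect_eq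
    proof (intro conjI allI ballI)
      have "scale c 0 = 0" for c by (rule ext) (simp add: scale_def)
      then show "(smul c x, 0) \<in> graph" if "x \<in> ?U" for c x
        using graph.smult[of x 0 c] that by (simp only: mem_Collect_eq)
      show "(x + y, 0) \<in> graph" if "x \<in> ?U" "y \<in> ?U" for x y
        using graph.add[of x 0 y 0] that by (simp only: mem_Collect_eq add_0)
    qed (rule graph.zero)
    show "\<rho> A u \<in> ?U" if "A \<in> sl n" "u \<in> ?U" for A u
      using graph_act[of u 0 A] that by (simp only: mem_Collect_eq act_zero)
  qed
  moreover have "(v, 0) \<notin> graph"
  proof
    assume "(v, 0) \<in> graph"
    then have "hw_tensor = 0" by (rule graph_diff[OF graph.base])
    then show False using hw_tensor_base_word by simp
  qed
  ultimately show ?thesis using assms by blast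
qed

lemma graph_total: "\<exists>t. (x, t) \<in> graph"
proof -
  let ?U = "{x. \<exists>t. (x, t) \<in> graph}"
  have "?U = {0} \<or> ?U = UNIV"
  proof (rule irreducible)
    show "subspace ?U"
      unfolding subspace_def mem_Collect_eq
    proof (intro conjI allI ballI)
      show "\<exists>t. (0, t) \<in> graph" by (intro exI[of _ 0] graph.zero)
      show "\<exists>t. (x + y, t) \<in> graph" if "x \<in> ?U" "y \<in> ?U" for x y
        using that graph.add unfolding mem_Collect_eq by meson
      show "\<exists>t. (smul c x, t) \<in> graph" if "x \<in> ?U" for c x
        using that graph.smult unfolding mem_Collect_eq by meson
    qed
    show "\<rho> A u \<in> ?U" if "A \<in> sl n" "u \<in> ?U" for A u
      using graph_act that by blast
  qed
  moreover have "v \<in> ?U" using graph.base by blast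
  ultimately show ?thesis using hw_nonzero by blast
qed

definition model :: "'v \<Rightarrow> tensor" where
  "model x = (THE t. (x, t) \<in> graph)"

lemma model_graph: "(x, model x) \<in> graph"
proof -
  obtain t where t: "(x, t) \<in> graph" using graph_total by blast
  have "model x = t"
    unfolding model_def by (rule the_equality, rule t, rule graph_diff[OF _ t])
  then show ?thesis using t by simp
qed

lemma model_eqI: "(x, t) \<in> graph \<Longrightarrow> model x = t"
  by (rule graph_diff[OF model_graph])

lemma model_plus: "model (x + y) = model x + model y"
  by (intro model_eqI graph.add model_graph)

lemma model_smul: "model (smul c x) = scale c (model x)"
  by (intro model_eqI graph.smult model_graph)

lemma model_zero: "model 0 = 0"
  by (intro model_eqI graph.zero)

lemma model_v: "model v = hw_tensor"
  by (intro model_eqI graph.base)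

lemma model_lowering:
  "1 \<le> i \<Longrightarrow> i < j \<Longrightarrow> j \<le> n \<Longrightarrow> model (\<rho> (lowering n i j) x) = act (lowering n i j) (model x)"
  by (intro model_eqI graph.lower model_graph)

lemma model_exchange_space: "model x \<in> exchange_space"
  by (rule graph_exchange_space[OF model_graph])

lemma model_eq_0_iff: "model x = 0 \<longleftrightarrow> x = 0"
proof
  assume "model x = 0"
  with model_graph[of x] have "(x, 0) \<in> graph" by (simp only:)
  then show "x = 0" by (rule graph_left_kernel)
qed (simp only: model_zero)

end

section \<open>Straightening to standard words\<close>

context young_shape
begin

text \<open>
  Entries decrease strictly down the columns and weakly along the rows, so that adding \<open>i - 1\<close> to the
  entry in row \<open>i\<close> gives the row lengths of an order ideal (see \<open>word_ideal\<close>).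
\<close>

definition standard :: "word \<Rightarrow> bool" where
  "standard \<omega> \<longleftrightarrow> \<omega> \<in> words \<and>
     (\<forall>t i. (t, i) \<in> boxes \<longrightarrow> (t, Suc i) \<in> boxes \<longrightarrow> \<omega> (t, Suc i) < \<omega> (t, i)) \<and>
     (\<forall>t i. (Suc t, i) \<in> boxes \<longrightarrow> \<omega> (Suc t, i) \<le> \<omega> (t, i))"

text \<open>
  Straightening increases these two measures lexicographically: the first one when a larger value moves
  to a column further left, the second one when a larger value moves up inside a column.
\<close>

definition column_measure :: "word \<Rightarrow> nat" where
  "column_measure \<omega> = (\<Sum>p\<in>boxes. (row_len n a 1 - fst p) * \<omega> p)"

definition row_measure :: "word \<Rightarrow> nat" where
  "row_measure \<omega> = (\<Sum>p\<in>boxes. (n - snd p) * \<omega> p)"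

lemma boxes_bounds: "(t, i) \<in> boxes \<Longrightarrow> 1 \<le> i \<and> i < n \<and> t < row_len n a 1"
  using row_len_antimono[of 1 i n a] by (auto simp: boxes_def)

lemma boxes_left: "(Suc t, i) \<in> boxes \<Longrightarrow> (t, i) \<in> boxes"
  by (auto simp: boxes_def)

lemma column_measure_le: "\<omega> \<in> words \<Longrightarrow> column_measure \<omega> \<le> (\<Sum>p\<in>boxes. (row_len n a 1 - fst p) * n)"
  unfolding column_measure_def by (intro sum_mono mult_le_mono2) (use wordsD in auto)

lemma row_measure_le: "\<omega> \<in> words \<Longrightarrow> row_measure \<omega> \<le> (\<Sum>p\<in>boxes. (n - snd p) * n)"
  unfolding row_measure_def by (intro sum_mono mult_le_mono2) (use wordsD in auto)

lemma exchange_space_column: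
  "t \<in> exchange_space \<Longrightarrow> \<sigma> permutes boxes \<Longrightarrow> (\<And>p. fst (\<sigma> p) = fst p) \<Longrightarrow> \<omega> \<in> words \<Longrightarrow>
    t (\<omega> \<circ> \<sigma>) = of_int (sign \<sigma>) * t \<omega>"
  unfolding exchange_space_def by blast

lemma exchange_space_relation:
  "t \<in> exchange_space \<Longrightarrow> Z \<subseteq> boxes \<Longrightarrow> (\<And>c. (c, Suc k) \<in> boxes \<Longrightarrow> c \<notin> fst ` Z) \<Longrightarrow> k < card Z \<Longrightarrow>
    \<omega> \<in> words \<Longrightarrow> (\<Sum>\<sigma> | \<sigma> permutes Z. of_int (sign \<sigma>) * t (\<omega> \<circ> \<sigma>)) = 0"
  unfolding exchange_space_def by blast

lemma swap_column_measure:
  assumes pq: "(c, i) \<in> boxes" "(c, Suc i) \<in> boxes" and lt: "\<omega> (c, i) < \<omega> (c, Suc i)"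
  defines "\<sigma> \<equiv> Transposition.transpose (c, i) (c, Suc i)"
  shows "column_measure (\<omega> \<circ> \<sigma>) = column_measure \<omega>" "row_measure \<omega> < row_measure (\<omega> \<circ> \<sigma>)"
proof -
  let ?p = "(c, i)" and ?q = "(c, Suc i)" and ?R = "boxes - {(c, i), (c, Suc i)}"
  have boxes: "boxes = insert ?p (insert ?q ?R)" using pq by auto
  have split: "(\<Sum>x\<in>boxes. f x * \<eta> x) = f ?p * \<eta> ?p + (f ?q * \<eta> ?q + (\<Sum>x\<in>?R. f x * \<eta> x))"
    for f \<eta> :: "nat \<times> nat \<Rightarrow> nat"
    by (subst boxes) (simp add: finite_boxes)
  have R: "(\<Sum>x\<in>?R. f x * (\<omega> \<circ> \<sigma>) x) = (\<Sum>x\<in>?R. f x * \<omega> x)" for f :: "nat \<times> nat \<Rightarrow> nat"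
    unfolding \<sigma>_def by (intro sum.cong refl) (auto simp: transpose_def)
  have pq': "(\<omega> \<circ> \<sigma>) ?p = \<omega> ?q" "(\<omega> \<circ> \<sigma>) ?q = \<omega> ?p"
    by (simp_all add: \<sigma>_def)
  show "column_measure (\<omega> \<circ> \<sigma>) = column_measure \<omega>"
    unfolding column_measure_def split R pq' by simp
  have "n - i = Suc (n - Suc i)" using boxes_bounds[OF pq(2)] by arith
  then show "row_measure \<omega> < row_measure (\<omega> \<circ> \<sigma>)"
    unfolding row_measure_def split R pq' using lt by simp
qed

lemma sum_exchange_greater:
  fixes \<omega> :: "'b \<Rightarrow> nat"
  assumes fin: "finite X" "finite Y" and disj: "X \<inter> Y = {}"
    and s: "\<sigma> permutes X \<union> Y" and x: "\<And>x. x \<in> X \<Longrightarrow> \<omega> x \<le> c" and y: "\<And>y. y \<in> Y \<Longrightarrow> c < \<omega> y"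
    and moved: "\<not> \<sigma> ` X \<subseteq> X"
  shows "sum \<omega> X < (\<Sum>x\<in>X. \<omega> (\<sigma> x))"
proof -
  let ?A = "\<sigma> ` X"
  have inj: "inj_on \<sigma> X" using permutes_inj_on[OF s] .
  have A: "?A \<subseteq> X \<union> Y" using permutes_in_image[OF s] by auto
  have finA: "finite ?A" using fin by simp
  have AY: "?A - X \<subseteq> Y" using A by auto
  have ne: "?A - X \<noteq> {}" using moved by auto
  have "card ?A = card X" by (rule card_image[OF inj])
  then have card: "card (?A - X) = card (X - ?A)"
    using card_Diff_subset_Int[of ?A X] card_Diff_subset_Int[of X ?A] fin finA by (simp add: Int_commute)
  have "sum \<omega> (X - ?A) \<le> card (X - ?A) * c"
    using sum_bounded_above[of "X - ?A" \<omega> c] x by simp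
  also have "\<dots> = (\<Sum>z\<in>?A - X. c)" by (simp add: card)
  also have "\<dots> < sum \<omega> (?A - X)"
    using ne finA AY y by (intro sum_strict_mono) auto
  finally have "sum \<omega> (X \<inter> ?A) + sum \<omega> (X - ?A) < sum \<omega> (?A \<inter> X) + sum \<omega> (?A - X)"
    by (simp add: Int_commute)
  then have "sum \<omega> X < sum \<omega> ?A"
    using sum.Int_Diff[of X \<omega> ?A] sum.Int_Diff[of ?A \<omega> X] fin finA by simp
  also have "sum \<omega> ?A = (\<Sum>x\<in>X. \<omega> (\<sigma> x))"
    by (simp add: sum.reindex[OF inj])
  finally show ?thesis .
qed

lemma column_decreasing:
  assumes dec: "\<And>i. (c, i) \<in> boxes \<Longrightarrow> (c, Suc i) \<in> boxes \<Longrightarrow> \<omega> (c, Suc i) < \<omega> (c, i)"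
    and "(c, j) \<in> boxes" "1 \<le> i" "i \<le> j"
  shows "\<omega> (c, j) + (j - i) \<le> (\<omega> (c, i) :: nat)"
  using assms(4,2)
proof (induction j rule: dec_induct)
  case (step m)
  have "(c, m) \<in> boxes" using boxes_down[OF step.prems, of m] step.hyps assms(3) by simp
  then show ?case using step.IH dec[OF _ step.prems] step.hyps by (simp add: Suc_diff_le)
qed simp

text \<open>
  The boxes from row \<open>i\<close> downwards in column \<open>c\<close> and the boxes up to row \<open>i\<close> in the next column are
  one more than the height of column \<open>c\<close>, so there is an exchange relation for them. All values in the
  first set are smaller than all values in the second, so every permutation mixing the two sets
  increases \<open>column_measure\<close> and contributes 0 by induction. The other permutations act inside the columns and
  contribute \<open>T \<omega>\<close> each.
\<close>

lemma row_exchange: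
  assumes T: "T \<in> exchange_space" and w: "\<omega> \<in> words"
    and box: "(Suc c, i) \<in> boxes" and viol: "\<omega> (c, i) < \<omega> (Suc c, i)"
    and dec: "\<And>c i. (c, i) \<in> boxes \<Longrightarrow> (c, Suc i) \<in> boxes \<Longrightarrow> \<omega> (c, Suc i) < \<omega> (c, i)"
    and IH: "\<And>\<omega>'. \<omega>' \<in> words \<Longrightarrow> column_measure \<omega> < column_measure \<omega>' \<Longrightarrow> T \<omega>' = 0"
  shows "T \<omega> = 0"
proof -
  define k where "k = height n a c"
  have col: "(c, j) \<in> boxes \<longleftrightarrow> 1 \<le> j \<and> j \<le> k" for j
    using le_height_iff[of j n a c] by (cases "1 \<le> j") (auto simp: boxes_def k_def)
  define X where "X = Pair c ` {i..k}"
  define Y where "Y = Pair (Suc c) ` {1..i}"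
  have i: "1 \<le> i" "i \<le> k" using boxes_bounds[OF box] boxes_left[OF box] col by auto
  have XY: "X \<subseteq> boxes" "Y \<subseteq> boxes" using i col boxes_down[OF box] by (auto simp: X_def Y_def)
  have fin: "finite X" "finite Y" by (simp_all add: X_def Y_def)
  have disj: "X \<inter> Y = {}" by (auto simp: X_def Y_def)
  have "card X = Suc k - i" "card Y = i"
    by (simp_all add: X_def Y_def card_image inj_on_def)
  then have card: "k < card (X \<union> Y)" using i disj fin by (simp add: card_Un_disjoint)
  have short: "c' \<notin> fst ` (X \<union> Y)" if "(c', Suc k) \<in> boxes" for c'
  proof
    assume "c' \<in> fst ` (X \<union> Y)"
    then have "c' = c \<or> c' = Suc c" by (auto simp: X_def Y_def)
    then have "(c, Suc k) \<in> boxes" using that boxes_left by blast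
    then show False using col by simp
  qed
  have exch: "(\<Sum>\<sigma> | \<sigma> permutes X \<union> Y. of_int (sign \<sigma>) * T (\<omega> \<circ> \<sigma>)) = 0"
    using XY by (intro exchange_space_relation[OF T _ short card w]) auto
  have fin_perm: "finite {\<sigma>. \<sigma> permutes X \<union> Y}" using fin by (intro finite_permutations) simp
  let ?G = "{\<sigma>. \<sigma> permutes X \<union> Y \<and> \<sigma> ` X \<subseteq> X}"
  have good: "of_int (sign \<sigma>) * T (\<omega> \<circ> \<sigma>) = T \<omega>" if "\<sigma> \<in> ?G" for \<sigma>
  proof -
    have s: "\<sigma> permutes X \<union> Y" and sX: "\<sigma> ` X \<subseteq> X" using that by auto
    have "\<sigma> ` X = X" using endo_inj_surj[OF fin(1) sX permutes_inj_on[OF s]] .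
    have fst: "fst (\<sigma> p) = fst p" for p
    proof -
      consider "p \<in> X" | "p \<in> Y" | "p \<notin> X \<union> Y" by blast
      then show ?thesis
      proof cases
        case 1
        then have "\<sigma> p \<in> X" using sX by blast
        then show ?thesis using 1 by (auto simp: X_def)
      next
        case 2
        have "\<sigma> p \<notin> X"
        proof
          assume "\<sigma> p \<in> X"
          then obtain q where "q \<in> X" "\<sigma> q = \<sigma> p" using \<open>\<sigma> ` X = X\<close> by (metis imageE)
          then have "q = p" using inj_eq[OF permutes_inj[OF s]] by blast
          then show False using \<open>q \<in> X\<close> 2 disj by blast
        qed
        then have "\<sigma> p \<in> Y" using permutes_in_image[OF s, of p] 2 by blast
        then show ?thesis using 2 by (auto simp: Y_def)
      next
        case 3
        then show ?thesis using permutes_not_in[OF s] by simp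
      qed
    qed
    have "\<sigma> permutes boxes" using permutes_subset[OF s] XY by blast
    then have "T (\<omega> \<circ> \<sigma>) = of_int (sign \<sigma>) * T \<omega>" by (rule exchange_space_column[OF T _ fst w])
    moreover have "of_int (sign \<sigma>) * (of_int (sign \<sigma>) * T \<omega>) = of_int (sign \<sigma> * sign \<sigma>) * T \<omega>"
      by (simp only: of_int_mult mult.assoc)
    ultimately show ?thesis by simp
  qed
  have bad: "T (\<omega> \<circ> \<sigma>) = 0" if s: "\<sigma> permutes X \<union> Y" and "\<not> \<sigma> ` X \<subseteq> X" for \<sigma>
  proof (rule IH)
    have sb: "\<sigma> permutes boxes" using permutes_subset[OF s] XY by blast
    show "\<omega> \<circ> \<sigma> \<in> words" by (rule words_permute[OF w sb])
    have le: "\<omega> x \<le> \<omega> (c, i)" if xX: "x \<in> X" for x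
    proof -
      obtain j where j: "x = (c, j)" "i \<le> j" "j \<le> k" using xX by (auto simp: X_def)
      have "(c, j) \<in> boxes" using i j by (simp add: col)
      then have "\<omega> (c, j) + (j - i) \<le> \<omega> (c, i)"
        using i j by (intro column_decreasing[of c \<omega>, OF dec])
      then show ?thesis by (simp add: j(1))
    qed
    have ge: "\<omega> (c, i) < \<omega> y" if yY: "y \<in> Y" for y
    proof -
      obtain j where j: "y = (Suc c, j)" "1 \<le> j" "j \<le> i" using yY by (auto simp: Y_def)
      have "\<omega> (Suc c, i) + (i - j) \<le> \<omega> (Suc c, j)"
        by (rule column_decreasing[OF dec box j(2,3)])
      then show ?thesis using viol j by simp
    qed
    have gt: "sum \<omega> X < (\<Sum>x\<in>X. \<omega> (\<sigma> x))"
      by (rule sum_exchange_greater[OF fin disj s le ge that(2)])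
    let ?R = "boxes - (X \<union> Y)" and ?W = "row_len n a 1 - Suc c"
    have W: "row_len n a 1 - c = Suc ?W" using boxes_bounds[OF box] by arith
    have split: "column_measure \<eta> = (\<Sum>p\<in>?R. (row_len n a 1 - fst p) * \<eta> p) + (?W * sum \<eta> (X \<union> Y) + sum \<eta> X)" for \<eta>
    proof -
      have "column_measure \<eta> = (\<Sum>p\<in>?R. (row_len n a 1 - fst p) * \<eta> p)
          + (\<Sum>p\<in>X \<union> Y. (row_len n a 1 - fst p) * \<eta> p)"
        unfolding column_measure_def using XY by (intro sum.subset_diff) auto
      also have "(\<Sum>p\<in>X \<union> Y. (row_len n a 1 - fst p) * \<eta> p)
          = (\<Sum>p\<in>X. (row_len n a 1 - fst p) * \<eta> p) + (\<Sum>p\<in>Y. (row_len n a 1 - fst p) * \<eta> p)"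
        by (rule sum.union_disjoint[OF fin disj])
      also have "(\<Sum>p\<in>X. (row_len n a 1 - fst p) * \<eta> p) = Suc ?W * sum \<eta> X"
        unfolding sum_distrib_left using W by (intro sum.cong refl) (auto simp: X_def)
      also have "(\<Sum>p\<in>Y. (row_len n a 1 - fst p) * \<eta> p) = ?W * sum \<eta> Y"
        unfolding sum_distrib_left by (intro sum.cong refl) (auto simp: Y_def)
      finally show ?thesis
        by (simp add: sum.union_disjoint[OF fin disj] distrib_left)
    qed
    have "sum (\<omega> \<circ> \<sigma>) (X \<union> Y) = sum \<omega> (X \<union> Y)"
      using sum.permute[OF s, of \<omega>] by simp
    moreover have "(\<Sum>p\<in>?R. (row_len n a 1 - fst p) * (\<omega> \<circ> \<sigma>) p) = (\<Sum>p\<in>?R. (row_len n a 1 - fst p) * \<omega> p)"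
      using permutes_not_in[OF s] by (intro sum.cong refl) auto
    ultimately show "column_measure \<omega> < column_measure (\<omega> \<circ> \<sigma>)"
      unfolding split using gt by simp
  qed
  have "(\<Sum>\<sigma> | \<sigma> permutes X \<union> Y. of_int (sign \<sigma>) * T (\<omega> \<circ> \<sigma>))
      = (\<Sum>\<sigma>\<in>?G. of_int (sign \<sigma>) * T (\<omega> \<circ> \<sigma>))"
    using bad fin_perm by (intro sum.mono_neutral_right) auto
  also have "\<dots> = (\<Sum>\<sigma>\<in>?G. T \<omega>)" by (intro sum.cong refl good)
  also have "\<dots> = of_nat (card ?G) * T \<omega>" by simp
  finally have "of_nat (card ?G) * T \<omega> = 0" using exch by simp
  moreover have "card ?G \<noteq> 0"
  proof -
    have fin_G: "finite ?G" by (rule finite_subset[OF _ fin_perm]) auto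
    have "id \<in> ?G" by (simp add: permutes_id)
    then have "?G \<noteq> {}" by blast
    then show ?thesis unfolding card_0_eq[OF fin_G] .
  qed
  ultimately show ?thesis by simp
qed

theorem exchange_space_determined:
  assumes T: "T \<in> exchange_space" and standard: "\<And>\<omega>. standard \<omega> \<Longrightarrow> T \<omega> = 0"
  shows "T = 0"
proof -
  let ?B = "\<Sum>p\<in>boxes. (row_len n a 1 - fst p) * n" and ?C = "\<Sum>p\<in>boxes. (n - snd p) * n"
  let ?ms = "[\<lambda>\<omega>. ?B - column_measure \<omega>, \<lambda>\<omega>. ?C - row_measure \<omega>]"
  have zero: "T \<omega> = 0" if "\<omega> \<in> words" for \<omega>
    using that
  proof (induction \<omega> rule: wf_induct_rule[OF wf_measures[of ?ms]])
    case (1 \<omega>)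
    have IH1: "T \<omega>' = 0" if "\<omega>' \<in> words" "column_measure \<omega> < column_measure \<omega>'" for \<omega>'
    proof -
      have "?B - column_measure \<omega>' < ?B - column_measure \<omega>" using that column_measure_le[OF that(1)] by linarith
      then show ?thesis using 1(1)[of \<omega>'] that(1) by simp
    qed
    have IH2: "T \<omega>' = 0" if "\<omega>' \<in> words" "column_measure \<omega>' = column_measure \<omega>" "row_measure \<omega> < row_measure \<omega>'" for \<omega>'
    proof -
      have "?C - row_measure \<omega>' < ?C - row_measure \<omega>" using that row_measure_le[OF that(1)] by linarith
      then show ?thesis using 1(1)[of \<omega>'] that(1,2) by simp
    qed
    show ?case
    proof (cases "\<exists>c i. (c, i) \<in> boxes \<and> (c, Suc i) \<in> boxes \<and> \<omega> (c, i) \<le> \<omega> (c, Suc i)")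
      case True
      then obtain c i where ci: "(c, i) \<in> boxes" "(c, Suc i) \<in> boxes" "\<omega> (c, i) \<le> \<omega> (c, Suc i)" by blast
      let ?s = "Transposition.transpose (c, i) (c, Suc i)"
      have s: "?s permutes boxes" by (rule column_swap_permutes[OF ci(1,2)])
      have T_swap: "T (\<omega> \<circ> ?s) = - T \<omega>"
        using exchange_space_column[OF T s fst_transpose 1(2)] by (simp add: sign_swap_id)
      show ?thesis
      proof (cases "\<omega> (c, i) = \<omega> (c, Suc i)")
        case True
        then have "\<omega> \<circ> ?s = \<omega>" by (auto simp: fun_eq_iff transpose_def)
        then show ?thesis using T_swap by simp
      next
        case False
        then have lt: "\<omega> (c, i) < \<omega> (c, Suc i)" using ci(3) by simp
        have "T (\<omega> \<circ> ?s) = 0"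
          by (rule IH2[OF words_permute[OF 1(2) s] swap_column_measure[OF ci(1,2) lt]])
        then show ?thesis using T_swap by simp
      qed
    next
      case False
      then have dec: "\<omega> (c, Suc i) < \<omega> (c, i)" if "(c, i) \<in> boxes" "(c, Suc i) \<in> boxes" for c i
        using that by (meson not_le)
      show ?thesis
      proof (cases "\<exists>c i. (Suc c, i) \<in> boxes \<and> \<omega> (c, i) < \<omega> (Suc c, i)")
        case True
        then obtain c i where "(Suc c, i) \<in> boxes" "\<omega> (c, i) < \<omega> (Suc c, i)" by blast
        then show ?thesis by (rule row_exchange[OF T 1(2) _ _ dec IH1])
      next
        case False
        then have "standard \<omega>" unfolding standard_def using 1(2) dec by (meson not_le)
        then show ?thesis by (rule standard)
      qed
    qed
  qed
  have "T \<omega> = 0" if "\<omega> \<notin> words" for \<omega>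
    using T that unfolding exchange_space_def by blast
  with zero have "T \<omega> = 0 \<omega>" for \<omega> by (cases "\<omega> \<in> words") simp_all
  then show ?thesis by (rule ext)
qed

end

section \<open>Standard words as chains of ideals\<close>

locale marked_shape = marked_triangle n \<O> + young_shape n a for n \<O> a
begin

definition word_ideal :: "word \<Rightarrow> nat \<Rightarrow> (nat \<times> nat) set" where
  "word_ideal \<omega> t = {(i, j). (t, i) \<in> boxes \<and> i \<le> j \<and> j < \<omega> (t, i) + i}"

lemma standard_column:
  assumes "standard \<omega>" "(t, j) \<in> boxes" "1 \<le> i" "i \<le> j"
  shows "\<omega> (t, j) + j \<le> \<omega> (t, i) + i"
proof -
  have "\<omega> (t, j) + (j - i) \<le> \<omega> (t, i)"
    using assms(1) unfolding standard_def by (intro column_decreasing[OF _ assms(2-4)]) blast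
  then show ?thesis using assms(4) by simp
qed

lemma word_ideal_ideals_of:
  assumes "standard \<omega>" shows "word_ideal \<omega> t \<in> ideals_of n (height n a t)"
proof (rule ideals_ofI)
  have w: "\<omega> \<in> words" using assms by (simp add: standard_def)
  show "word_ideal \<omega> t \<in> ideals n"
    unfolding ideals_def
  proof (intro CollectI conjI subsetI ballI impI)
    fix q assume "q \<in> word_ideal \<omega> t"
    then obtain i j where q: "q = (i, j)" "(t, i) \<in> boxes" "i \<le> j" "j < \<omega> (t, i) + i"
      by (auto simp: word_ideal_def)
    have i: "1 \<le> i" using boxes_bounds[OF q(2)] by simp
    have "(t, 1) \<in> boxes" using boxes_down[OF q(2)] i by simp
    then have "\<omega> (t, i) + i \<le> n + 1" using standard_column[OF assms q(2) _ i] wordsD[OF w, of "(t, 1)"] by simp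
    then show "q \<in> tri n" using q i by simp
  next
    fix q p assume "q \<in> word_ideal \<omega> t" and p: "p \<in> tri n" "tri_le p q"
    then obtain i j where q: "q = (i, j)" "(t, i) \<in> boxes" "i \<le> j" "j < \<omega> (t, i) + i"
      by (auto simp: word_ideal_def)
    obtain i' j' where p': "p = (i', j')" by fastforce
    have le: "1 \<le> i'" "i' \<le> i" "i' \<le> j'" "j' \<le> j" using p unfolding p' q(1) by (auto simp: tri_le_def)
    show "p \<in> word_ideal \<omega> t"
      using standard_column[OF assms q(2) le(1,2)] boxes_down[OF q(2) le(1,2)] le q(4)
      by (simp add: word_ideal_def p')
  qed
  show "height n a t \<le> n"
    using le_height_iff[of "height n a t" n a t] by (cases "height n a t = 0") auto
  fix i assume i: "1 \<le> i" "i \<le> n"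
  have "(i, i) \<in> word_ideal \<omega> t \<longleftrightarrow> (t, i) \<in> boxes"
    using wordsD[OF w, of "(t, i)"] by (auto simp: word_ideal_def)
  then show "(i, i) \<in> word_ideal \<omega> t \<longleftrightarrow> i \<le> height n a t"
    using le_height_iff[OF i(1), of n a t] i by (auto simp: boxes_def)
qed

lemma word_ideal_chain:
  assumes "standard \<omega>" "s \<le> t" shows "word_ideal \<omega> t \<subseteq> word_ideal \<omega> s"
  using assms(2)
proof (induction t rule: dec_induct)
  case (step m)
  have "word_ideal \<omega> (Suc m) \<subseteq> word_ideal \<omega> m"
  proof
    fix p assume "p \<in> word_ideal \<omega> (Suc m)"
    then obtain i j where p: "p = (i, j)" "(Suc m, i) \<in> boxes" "i \<le> j" "j < \<omega> (Suc m, i) + i"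
      by (auto simp: word_ideal_def)
    have "\<omega> (Suc m, i) \<le> \<omega> (m, i)" using assms(1) p(2) unfolding standard_def by blast
    then show "p \<in> word_ideal \<omega> m"
      using p boxes_left[OF p(2)] by (simp add: word_ideal_def)
  qed
  then show ?case using step.IH by blast
qed simp

definition word_point :: "word \<Rightarrow> point" where
  "word_point \<omega> = (\<Sum>t<row_len n a 1. indicator (marked n \<O> (word_ideal \<omega> t)))"

lemma ideals_of_ideal: "J \<in> ideals_of n k \<Longrightarrow> J \<in> ideals n"
  by (simp add: ideals_of_def)

lemma word_point_in:
  assumes "standard \<omega>" shows "word_point \<omega> \<in> chain_order n \<O> a \<inter> int_lattice n"
proof
  show "word_point \<omega> \<in> chain_order n \<O> a"
    unfolding word_point_def
    by (rule sum_indicator_marked_in_chain_order[OF n_gt_1 word_ideal_ideals_of[OF assms]])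
  show "word_point \<omega> \<in> int_lattice n"
    unfolding word_point_def
    by (intro int_lattice_sum_unscaled indicator_marked_lattice ideals_of_ideal[OF word_ideal_ideals_of[OF assms]])
qed

lemma chain_count:
  assumes chain: "\<And>s t. s \<le> t \<Longrightarrow> J t \<subseteq> (J s :: 'b set)" and t: "t < (M::nat)"
  shows "p \<in> J t \<longleftrightarrow> real t < (\<Sum>s<M. indicator (J s) p)"
proof -
  have sum: "(\<Sum>s<M. indicator (J s) p) = real (card {s. s < M \<and> p \<in> J s})"
  proof -
    have "(\<Sum>s<M. indicator (J s) p) = (\<Sum>s<M. if p \<in> J s then 1 else (0::real))"
      by (intro sum.cong refl) (simp add: indicator_def)
    also have "\<dots> = real (card ({..<M} \<inter> {s. p \<in> J s}))" by (simp add: sum.If_cases)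
    also have "{..<M} \<inter> {s. p \<in> J s} = {s. s < M \<and> p \<in> J s}" by auto
    finally show ?thesis .
  qed
  show ?thesis
  proof
    assume "p \<in> J t"
    then have "{..t} \<subseteq> {s. s < M \<and> p \<in> J s}" using chain t by fastforce
    then have "card {..t} \<le> card {s. s < M \<and> p \<in> J s}" by (intro card_mono) auto
    then show "real t < (\<Sum>s<M. indicator (J s) p)" unfolding sum by simp
  next
    assume lt: "real t < (\<Sum>s<M. indicator (J s) p)"
    show "p \<in> J t"
    proof (rule ccontr)
      assume "p \<notin> J t"
      then have "{s. s < M \<and> p \<in> J s} \<subseteq> {..<t}" using chain by (force simp: not_le[symmetric])
      then have "card {s. s < M \<and> p \<in> J s} \<le> card {..<t}" by (intro card_mono) auto
      then show False using lt unfolding sum by simp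
    qed
  qed
qed

text \<open>
  The inverse transfer of the point recovers the number of ideals of the chain containing a given cell,
  and a chain is determined by these numbers.
\<close>

lemma inj_on_word_point: "inj_on word_point {\<omega>. standard \<omega>}"
proof (rule inj_onI)
  have le: "\<omega> p \<le> \<omega>' p" if s: "standard \<omega>" "standard \<omega>'" and eq: "word_point \<omega> = word_point \<omega>'" for \<omega> \<omega>' p
  proof (cases "p \<in> boxes")
    case False
    then show ?thesis using s unfolding standard_def by (simp add: words_outside)
  next
    case True
    obtain t i where p: "p = (t, i)" by fastforce
    have t: "t < row_len n a 1" using boxes_bounds True p by blast
    have pos: "1 \<le> \<omega> p" using s(1) wordsD[OF _ True] by (auto simp: standard_def)
    have transfer_inv: "transfer_inv (word_point \<omega>) i j = (\<Sum>t<row_len n a 1. indicator (word_ideal \<omega> t) (i, j))"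
      if "standard \<omega>" for \<omega> i j
      unfolding word_point_def
      by (rule transfer_inv_chain_sum[OF ideals_of_ideal[OF word_ideal_ideals_of[OF that]] word_ideal_chain[OF that]])
    have count: "q \<in> word_ideal \<omega> t \<longleftrightarrow> real t < (\<Sum>t<row_len n a 1. indicator (word_ideal \<omega> t) q)"
      if "standard \<omega>" for \<omega> q
      by (rule chain_count[OF _ t]) (rule word_ideal_chain[OF that])
    have "(i, \<omega> p + i - 1) \<in> word_ideal \<omega> t"
      using True pos by (simp add: word_ideal_def p)
    then have "real t < transfer_inv (word_point \<omega>) i (\<omega> p + i - 1)"
      unfolding transfer_inv[OF s(1)] by (rule iffD1[OF count[OF s(1)]])
    then have "real t < (\<Sum>t<row_len n a 1. indicator (word_ideal \<omega>' t) (i, \<omega> p + i - 1))"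
      unfolding eq transfer_inv[OF s(2)] .
    then have "(i, \<omega> p + i - 1) \<in> word_ideal \<omega>' t"
      by (rule iffD2[OF count[OF s(2)]])
    then have "\<omega> p + i - 1 < \<omega>' p + i" by (simp add: word_ideal_def p)
    then show ?thesis using pos by linarith
  qed
  fix \<omega> \<omega>' assume "\<omega> \<in> {\<omega>. standard \<omega>}" "\<omega>' \<in> {\<omega>. standard \<omega>}" "word_point \<omega> = word_point \<omega>'"
  then show "\<omega> = \<omega>'" using le[of \<omega> \<omega>'] le[of \<omega>' \<omega>] by (intro ext le_antisym) auto
qed

end

section \<open>Lowering a word step by step\<close>

text \<open>
  The product \<open>f\<^sup>c\<close> is spelled out as a list of single lowering operators, the leftmost factor first.
\<close>

definition pbw_ops :: "nat \<Rightarrow> point \<Rightarrow> (nat \<times> nat) list" where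
  "pbw_ops n c = concat (map (\<lambda>p. replicate (nat \<lfloor>c p\<rfloor>) p) (filter (\<lambda>(i, j). i < j) (tri_list n)))"

lemma foldr_concat_replicate:
  "foldr f (concat (map (\<lambda>p. replicate (k p) p) ps)) u = foldr (\<lambda>p. f p ^^ k p) ps u"
  by (induction ps) simp_all

lemma pbw_act_eq_ops:
  "pbw_act n r c u = foldr (\<lambda>p. r (lowering n (fst p) (snd p))) (pbw_ops n c) u"
proof -
  have "(\<lambda>p. r (lowering n (fst p) (snd p)) ^^ nat \<lfloor>c p\<rfloor>)
      = (\<lambda>(i, j). r (lowering n i j) ^^ nat \<lfloor>c (i, j)\<rfloor>)"
    by (rule ext) (simp add: split_def)
  then show ?thesis
    unfolding pbw_ops_def foldr_concat_replicate pbw_act_def by (simp only:)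
qed

lemma set_tri_list: "set (tri_list n) = tri n"
  by (force simp: tri_list_eq tri_def simp del: upt_Suc)

lemma distinct_tri_list: "distinct (tri_list n)"
proof -
  have "distinct (concat (map (\<lambda>i. map (Pair i) [i..<Suc n]) is))" if "distinct is" for "is"
    using that by (induction "is") (auto simp: distinct_map inj_on_def simp del: upt_Suc)
  then show ?thesis unfolding tri_list_eq by (simp only: distinct_upt)
qed

lemma sorted_tri_list: "sorted (map fst (tri_list n))"
proof -
  have "sorted (map fst (concat (map (\<lambda>i. map (Pair i) [i..<Suc n]) is)))" if "sorted is" for "is"
    using that
  proof (induction "is")
    case (Cons i "is")
    have "map fst (map (Pair i) [i..<Suc n]) = replicate (length [i..<Suc n]) i"
      unfolding map_map by (rule nth_equalityI) (simp_all del: upt_Suc)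
    moreover have "\<forall>x\<in>set (map fst (concat (map (\<lambda>i. map (Pair i) [i..<Suc n]) is))). i \<le> x"
      using Cons.prems by (auto simp del: upt_Suc)
    ultimately show ?case
      using Cons by (simp add: sorted_append del: upt_Suc)
  qed simp
  then show ?thesis unfolding tri_list_eq by (simp only: sorted_upt)
qed

lemma count_list_replicate_eq: "count_list (replicate m x) y = (if x = y then m else 0)"
  by (induction m) auto

lemma count_pbw_ops:
  "count_list (pbw_ops n c) (i, j) = (if (i, j) \<in> tri n \<and> i < j then nat \<lfloor>c (i, j)\<rfloor> else 0)"
proof -
  have "count_list (concat (map (\<lambda>p. replicate (k p) p) ps)) q = (if q \<in> set ps then k q else 0)"
    if "distinct ps" for ps :: "(nat \<times> nat) list" and k q
    using that by (induction ps) (auto simp: count_list_replicate_eq)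
  then show ?thesis
    unfolding pbw_ops_def using distinct_tri_list[of n] by (simp add: set_tri_list)
qed

lemma set_pbw_ops: "set (pbw_ops n c) \<subseteq> {(i, j). 1 \<le> i \<and> i < j \<and> j \<le> n}"
  unfolding pbw_ops_def by (auto simp: set_tri_list tri_def)

lemma sorted_pbw_ops: "sorted (map fst (pbw_ops n c))"
proof -
  have blocks: "sorted (map fst (concat (map (\<lambda>p. replicate (k p) p) ps)))" if "sorted (map fst ps)"
    for ps :: "(nat \<times> nat) list" and k
    using that
  proof (induction ps)
    case (Cons p ps)
    then have "\<forall>x\<in>set (map fst (concat (map (\<lambda>p. replicate (k p) p) ps))). fst p \<le> x" by auto
    with Cons show ?case by (auto simp: sorted_append)
  qed simp
  show ?thesis unfolding pbw_ops_def by (intro blocks sorted_filter sorted_tri_list)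
qed

lemma sum_fibers:
  fixes g :: "'b \<Rightarrow> int"
  assumes "finite B" "finite T" "\<phi> ` B \<subseteq> T"
  shows "(\<Sum>q\<in>B. g (\<phi> q)) = (\<Sum>p\<in>T. int (card {q \<in> B. \<phi> q = p}) * g p)"
proof -
  have "(\<Sum>q\<in>B. g (\<phi> q)) = (\<Sum>p\<in>T. \<Sum>q | q \<in> B \<and> \<phi> q = p. g (\<phi> q))"
    by (rule sum.group[symmetric, OF assms])
  also have "\<dots> = (\<Sum>p\<in>T. \<Sum>q | q \<in> B \<and> \<phi> q = p. g p)"
    by (intro sum.cong refl) auto
  finally show ?thesis by simp
qed

context young_shape
begin

text \<open>
  The terms of a product of lowering operators, evaluated at a word: each operator \<open>f\<^bsub>i,j\<^esub>\<close> replaces one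
  entry \<open>j\<close> of the word by \<open>i\<close>.
\<close>

primrec reach :: "(nat \<times> nat) list \<Rightarrow> word \<Rightarrow> word \<Rightarrow> bool" where
  "reach [] \<omega> \<omega>' \<longleftrightarrow> \<omega> = \<omega>'"
| "reach (p # L) \<omega> \<omega>' \<longleftrightarrow> (\<exists>q\<in>boxes. \<omega> q = snd p \<and> reach L (\<omega>(q := fst p)) \<omega>')"

abbreviation run :: "(nat \<times> nat) list \<Rightarrow> tensor \<Rightarrow> tensor" where
  "run L t \<equiv> foldr (\<lambda>p. act (lowering n (fst p) (snd p))) L t"

abbreviation valid_ops :: "(nat \<times> nat) list \<Rightarrow> bool" where
  "valid_ops L \<equiv> set L \<subseteq> {(i, j). 1 \<le> i \<and> i < j \<and> j \<le> n}"

lemma run_Cons: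
  assumes "\<omega> \<in> words" "1 \<le> fst p" "fst p \<le> n"
  shows "run (p # L) t \<omega> = (\<Sum>q\<in>boxes. if \<omega> q = snd p then run L t (\<omega>(q := fst p)) else 0)"
  using act_mat_unit[of "fst p" \<omega> "snd p" "run L t"] assms by (simp add: lowering_def)

lemma run_nonzero:
  assumes "valid_ops L" "\<omega> \<in> words" "run L t \<omega> \<noteq> 0"
  shows "\<exists>\<omega>'. reach L \<omega> \<omega>' \<and> t \<omega>' \<noteq> 0"
  using assms
proof (induction L arbitrary: \<omega>)
  case (Cons p L)
  have p: "1 \<le> fst p" "fst p \<le> n" using Cons.prems(1) by auto
  have "(\<Sum>q\<in>boxes. if \<omega> q = snd p then run L t (\<omega>(q := fst p)) else 0) \<noteq> 0"
    using Cons.prems(3) unfolding run_Cons[OF Cons.prems(2) p] .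
  then obtain q where q: "q \<in> boxes" "(if \<omega> q = snd p then run L t (\<omega>(q := fst p)) else 0) \<noteq> 0"
    by (rule sum.not_neutral_contains_not_neutral)
  then have eq: "\<omega> q = snd p" and nz: "run L t (\<omega>(q := fst p)) \<noteq> 0" by (auto split: if_splits)
  have "\<omega>(q := fst p) \<in> words" using p by (intro words_upd[OF Cons.prems(2) q(1)]) auto
  then obtain \<omega>' where "reach L (\<omega>(q := fst p)) \<omega>'" "t \<omega>' \<noteq> 0"
    using Cons.IH nz Cons.prems(1) by auto
  then show ?case using q(1) eq by auto
qed auto

text \<open>
  If only the values 0 and 1 are reached, all terms are nonnegative and nothing cancels.
\<close>

lemma run_count:
  assumes "valid_ops L" "\<omega> \<in> words" "\<And>\<omega>'. reach L \<omega> \<omega>' \<Longrightarrow> t \<omega>' \<in> {0, 1}"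
  shows "\<exists>m. run L t \<omega> = of_nat m \<and> ((\<exists>\<omega>'. reach L \<omega> \<omega>' \<and> t \<omega>' = 1) \<longrightarrow> 0 < m)"
  using assms
proof (induction L arbitrary: \<omega>)
  case Nil
  then have "t \<omega> = of_nat 0 \<or> t \<omega> = of_nat 1" by simp
  then show ?case by (elim disjE) (auto intro: exI[of _ 0] exI[of _ 1])
next
  case (Cons p L)
  have p: "1 \<le> fst p" "fst p \<le> n" and L: "valid_ops L" using Cons.prems(1) by auto
  have step: "\<exists>m. (if \<omega> q = snd p then run L t (\<omega>(q := fst p)) else 0) = of_nat m \<and>
      (\<omega> q = snd p \<longrightarrow> (\<exists>\<omega>'. reach L (\<omega>(q := fst p)) \<omega>' \<and> t \<omega>' = 1) \<longrightarrow> 0 < m)" if q: "q \<in> boxes" for q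
  proof (cases "\<omega> q = snd p")
    case True
    have w: "\<omega>(q := fst p) \<in> words" using p by (intro words_upd[OF Cons.prems(2) q]) auto
    have t01: "t \<omega>' \<in> {0, 1}" if "reach L (\<omega>(q := fst p)) \<omega>'" for \<omega>'
      using that q True by (intro Cons.prems(3)) auto
    have "\<exists>m. run L t (\<omega>(q := fst p)) = of_nat m \<and>
        ((\<exists>\<omega>'. reach L (\<omega>(q := fst p)) \<omega>' \<and> t \<omega>' = 1) \<longrightarrow> 0 < m)"
      by (rule Cons.IH[OF L w t01])
    then show ?thesis using True by simp
  next
    case False
    then show ?thesis by (auto intro: exI[of _ 0])
  qed
  have "\<exists>m. \<forall>q\<in>boxes. (if \<omega> q = snd p then run L t (\<omega>(q := fst p)) else 0) = of_nat (m q) \<and>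
      (\<omega> q = snd p \<longrightarrow> (\<exists>\<omega>'. reach L (\<omega>(q := fst p)) \<omega>' \<and> t \<omega>' = 1) \<longrightarrow> 0 < m q)"
    by (intro bchoice ballI step)
  then obtain m where m: "\<forall>q\<in>boxes. (if \<omega> q = snd p then run L t (\<omega>(q := fst p)) else 0) = of_nat (m q) \<and>
      (\<omega> q = snd p \<longrightarrow> (\<exists>\<omega>'. reach L (\<omega>(q := fst p)) \<omega>' \<and> t \<omega>' = 1) \<longrightarrow> 0 < m q)" ..
  have "run (p # L) t \<omega> = (\<Sum>q\<in>boxes. of_nat (m q))"
    unfolding run_Cons[OF Cons.prems(2) p] using m by (intro sum.cong) auto
  also have "\<dots> = of_nat (\<Sum>q\<in>boxes. m q)" by simp
  finally have eq: "run (p # L) t \<omega> = of_nat (\<Sum>q\<in>boxes. m q)" .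
  have pos: "0 < (\<Sum>q\<in>boxes. m q)" if "\<exists>\<omega>'. reach (p # L) \<omega> \<omega>' \<and> t \<omega>' = 1"
  proof -
    from that obtain q where "q \<in> boxes" "\<omega> q = snd p" "\<exists>\<omega>'. reach L (\<omega>(q := fst p)) \<omega>' \<and> t \<omega>' = 1"
      by auto
    then have "q \<in> boxes" "0 < m q" using m by blast+
    then show ?thesis by (intro sum_pos2[of boxes q]) auto
  qed
  show ?case using eq pos by blast
qed

lemma card_fiber_upd:
  fixes \<omega> \<omega>' :: word
  assumes q: "q \<in> boxes" "\<omega> q = j" "\<omega>' q = i" and kl: "k < l"
  shows "card {x \<in> boxes. \<omega> x = l \<and> \<omega>' x = k}
    = card {x \<in> boxes. (\<omega>(q := i)) x = l \<and> \<omega>' x = k} + (if (i, j) = (k, l) then 1 else 0)"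
proof -
  let ?S = "{x \<in> boxes. (\<omega>(q := i)) x = l \<and> \<omega>' x = k}"
  have fin: "finite ?S" and q_notin: "q \<notin> ?S" using q kl by auto
  have eq: "{x \<in> boxes. \<omega> x = l \<and> \<omega>' x = k} = (if (i, j) = (k, l) then insert q ?S else ?S)"
    using q kl by auto
  show ?thesis
    unfolding eq using card_insert_disjoint[OF fin q_notin] by (cases "(i, j) = (k, l)") (simp_all only: HOL.simp_thms if_True if_False Suc_eq_plus1 add_0_right)
qed

text \<open>
  Since the operators are sorted by their first index \<open>i\<close>, an entry that has been lowered to \<open>i\<close> is too
  small to be changed again. Every entry is thus changed at most once, and the operators used can be read
  off by comparing the initial and the final word.
\<close>

lemma reach_counts:
  assumes "valid_ops L" "sorted (map fst L)" "reach L \<omega> \<omega>'"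
  shows "(\<forall>q. \<omega>' q \<le> \<omega> q) \<and> (\<forall>q. q \<notin> boxes \<longrightarrow> \<omega>' q = \<omega> q) \<and>
    (\<forall>q b. (\<forall>p\<in>set L. b \<le> fst p) \<longrightarrow> \<omega> q \<le> b \<longrightarrow> \<omega>' q = \<omega> q) \<and>
    (\<forall>k l. k < l \<longrightarrow> card {x \<in> boxes. \<omega> x = l \<and> \<omega>' x = k} = count_list L (k, l))"
  using assms
proof (induction L arbitrary: \<omega>)
  case Nil
  then show ?case by auto
next
  case (Cons p L)
  obtain i j where p: "p = (i, j)" by fastforce
  have ij: "1 \<le> i" "i < j" using Cons.prems(1) p by auto
  from Cons.prems(3) obtain q where q: "q \<in> boxes" "\<omega> q = j" "reach L (\<omega>(q := i)) \<omega>'"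
    by (auto simp: p)
  have L: "valid_ops L" "sorted (map fst L)" "\<forall>p\<in>set L. i \<le> fst p" using Cons.prems p by auto
  have le: "\<And>x. \<omega>' x \<le> (\<omega>(q := i)) x" and out: "\<And>x. x \<notin> boxes \<Longrightarrow> \<omega>' x = (\<omega>(q := i)) x"
    and low: "\<And>x b. \<forall>p\<in>set L. b \<le> fst p \<Longrightarrow> (\<omega>(q := i)) x \<le> b \<Longrightarrow> \<omega>' x = (\<omega>(q := i)) x"
    and cnt: "\<And>k l. k < l \<Longrightarrow> card {x \<in> boxes. (\<omega>(q := i)) x = l \<and> \<omega>' x = k} = count_list L (k, l)"
    using Cons.IH[OF L(1,2) q(3)] by blast+
  have q_i: "\<omega>' q = i" using low[OF L(3), of q] by simp
  have "\<omega>' x \<le> \<omega> x" for x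
    using le[of x] q ij by (cases "x = q") auto
  moreover have "\<omega>' x = \<omega> x" if "x \<notin> boxes" for x
    using out[OF that] that q by (cases "x = q") auto
  moreover have "\<omega>' x = \<omega> x" if "\<forall>p\<in>set (p # L). b \<le> fst p" "\<omega> x \<le> b" for x b
  proof -
    have "x \<noteq> q" using that q ij p by auto
    then show ?thesis using low[of b x] that by auto
  qed
  moreover have "card {x \<in> boxes. \<omega> x = l \<and> \<omega>' x = k} = count_list (p # L) (k, l)" if "k < l" for k l
    using card_fiber_upd[of q \<omega> j \<omega>' i k l, OF q(1,2) q_i that] cnt[OF that] by (simp add: p)
  ultimately show ?case by blast
qed

lemma reach_exists:
  assumes "\<And>q. \<omega>' q \<le> \<omega> q" "\<And>q. q \<notin> boxes \<Longrightarrow> \<omega>' q = \<omega> q"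
    and "\<And>k l. k < l \<Longrightarrow> card {x \<in> boxes. \<omega> x = l \<and> \<omega>' x = k} = count_list L (k, l)"
    and "valid_ops L"
  shows "reach L \<omega> \<omega>'"
  using assms
proof (induction L arbitrary: \<omega>)
  case Nil
  have "\<omega> q = \<omega>' q" for q
  proof (rule ccontr)
    assume neq: "\<omega> q \<noteq> \<omega>' q"
    then have q: "q \<in> boxes" and lt: "\<omega>' q < \<omega> q" using Nil(1,2)[of q] by force+
    have "card {x \<in> boxes. \<omega> x = \<omega> q \<and> \<omega>' x = \<omega>' q} = 0" using Nil(3)[OF lt] by simp
    moreover have "finite {x \<in> boxes. \<omega> x = \<omega> q \<and> \<omega>' x = \<omega>' q}" by simp
    ultimately have "{x \<in> boxes. \<omega> x = \<omega> q \<and> \<omega>' x = \<omega>' q} = {}" by (simp only: card_0_eq)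
    then show False using q by blast
  qed
  then show ?case by (simp add: fun_eq_iff)
next
  case (Cons p L)
  obtain i j where p: "p = (i, j)" by fastforce
  have ij: "i < j" using Cons.prems(4) p by auto
  have "card {x \<in> boxes. \<omega> x = j \<and> \<omega>' x = i} \<noteq> 0"
    using Cons.prems(3)[OF ij] by (simp add: p)
  then have "{x \<in> boxes. \<omega> x = j \<and> \<omega>' x = i} \<noteq> {}" by force
  then obtain q where q: "q \<in> boxes" "\<omega> q = j" "\<omega>' q = i" by blast
  have "reach L (\<omega>(q := i)) \<omega>'"
  proof (rule Cons.IH)
    show "\<omega>' x \<le> (\<omega>(q := i)) x" for x using Cons.prems(1)[of x] q by simp
    show "\<omega>' x = (\<omega>(q := i)) x" if "x \<notin> boxes" for x using Cons.prems(2)[OF that] that q by auto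
    show "card {x \<in> boxes. (\<omega>(q := i)) x = l \<and> \<omega>' x = k} = count_list L (k, l)" if "k < l" for k l
      using card_fiber_upd[of q \<omega> j \<omega>' i k l, OF q that] Cons.prems(3)[OF that] by (simp add: p split: if_splits)
    show "valid_ops L" using Cons.prems(4) by simp
  qed
  then show ?case using q by (auto simp: p)
qed

lemma boxes_Sigma: "boxes = (SIGMA t:{..<row_len n a 1}. {1..height n a t})"
proof (rule Set.set_eqI)
  fix p :: "nat \<times> nat"
  obtain t i where p: "p = (t, i)" by fastforce
  have "(t, i) \<in> boxes \<longleftrightarrow> t < row_len n a 1 \<and> 1 \<le> i \<and> i \<le> height n a t"
    using le_height_iff[of i n a t] boxes_bounds[of t i] by (auto simp: boxes_def)
  then show "p \<in> boxes \<longleftrightarrow> p \<in> (SIGMA t:{..<row_len n a 1}. {1..height n a t})"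
    by (simp add: p)
qed

lemma sum_boxes_columns:
  "(\<Sum>p\<in>boxes. f p) = (\<Sum>t<row_len n a 1. \<Sum>i = 1..height n a t. f (t, i))"
  unfolding boxes_Sigma by (subst sum.Sigma) (simp_all add: split_def)

end

section \<open>The leading term in one column\<close>

context marked_triangle
begin

text \<open>
  A numerical form of the lexicographic order that compares later rows first and, within a row \<open>i\<close>,
  prefers the entry with the smaller value of \<open>tail i\<close>. The base \<open>n + 1\<close> exceeds all the values, so
  a difference in one row outweighs the rows before it.
\<close>

definition weight :: "nat \<Rightarrow> nat \<Rightarrow> int" where
  "weight i e = (int n + 1) ^ i * int (n - tail i e)"

lemma geometric_bound: "(\<Sum>i = 1..<l. (int n + 1) ^ i * int n) < (int n + 1) ^ l"
proof (induction l)
  case (Suc l)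
  show ?case
  proof (cases "l = 0")
    case False
    then have "(\<Sum>i = 1..<Suc l. (int n + 1) ^ i * int n) = (\<Sum>i = 1..<l. (int n + 1) ^ i * int n) + (int n + 1) ^ l * int n"
      by simp
    also have "\<dots> < (int n + 1) ^ l + (int n + 1) ^ l * int n" using Suc.IH by simp
    also have "\<dots> = (int n + 1) ^ Suc l" by (simp add: algebra_simps)
    finally show ?thesis .
  qed simp
qed simp

lemma weight_bounds: "0 \<le> weight i e" "weight i e \<le> (int n + 1) ^ i * int n"
  unfolding weight_def by (auto intro!: mult_left_mono)

text \<open>
  Let \<open>l\<close> be the last row where the assignment deviates. It then uses there the entry belonging to an
  earlier row, and by \<open>row_max_less_tail\<close> this entry has a larger value of \<open>tail l\<close> than the entry
  belonging to row \<open>l\<close>.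
\<close>

lemma weight_maximal:
  assumes J: "J \<in> ideals_of n k" and perm: "\<pi> permutes {1..k}"
    and le: "\<And>b. b \<in> {1..k} \<Longrightarrow> \<pi> b \<le> target b (row_max J b)" and neq: "\<pi> \<noteq> id"
  shows "(\<Sum>b = 1..k. weight (\<pi> b) (target b (row_max J b))) < (\<Sum>b = 1..k. weight b (target b (row_max J b)))"
proof -
  let ?e = "\<lambda>b. target b (row_max J b)"
  define \<rho> where "\<rho> = inv_into UNIV \<pi>"
  have \<rho>: "\<rho> permutes {1..k}" unfolding \<rho>_def by (rule permutes_inv[OF perm])
  have \<pi>\<rho>: "\<pi> (\<rho> x) = x" for x unfolding \<rho>_def by (rule permutes_inverses(1)[OF perm])
  have reindex: "(\<Sum>b = 1..k. weight (\<pi> b) (?e b)) = (\<Sum>i = 1..k. weight i (?e (\<rho> i)))"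
  proof -
    have "(\<Sum>b = 1..k. weight (\<pi> b) (?e b)) = (\<Sum>i = 1..k. weight (\<pi> (\<rho> i)) (?e (\<rho> i)))"
      by (rule sum.permute[OF \<rho>, unfolded comp_def])
    then show ?thesis by (simp only: \<pi>\<rho>)
  qed
  have JI: "J \<in> ideals n" using J by (simp add: ideals_of_def)
  have diag: "(b, b) \<in> J" if "1 \<le> b" "b \<le> k" for b using ideals_of_diag[OF J] that by simp
  let ?D = "{i. \<rho> i \<noteq> i}"
  have D_sub: "?D \<subseteq> {1..k}" using permutes_not_in[OF \<rho>] by blast
  then have fin: "finite ?D" by (rule finite_subset) simp
  have "?D \<noteq> {}"
  proof
    assume "?D = {}"
    then have "\<rho> x = x" for x by blast
    then have "\<pi> x = x" for x using \<pi>\<rho>[of x] by simp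
    then have "\<pi> = id" by auto
    then show False using neq by simp
  qed
  define l where "l = Max ?D"
  have l: "\<rho> l \<noteq> l" and l_max: "\<And>i. l < i \<Longrightarrow> \<rho> i = i"
    using Max_in[OF fin \<open>?D \<noteq> {}\<close>] Max_ge[OF fin] unfolding l_def by fastforce+
  have lk: "1 \<le> l" "l \<le> k" using D_sub l by auto
  have \<rho>lk: "\<rho> l \<in> {1..k}" using permutes_in_image[OF \<rho>, of l] lk by simp
  have \<rho>l: "\<rho> l < l"
  proof (rule ccontr)
    assume "\<not> \<rho> l < l"
    then have "l < \<rho> l" using l by simp
    then have "\<rho> (\<rho> l) = \<rho> l" by (rule l_max)
    then show False using inj_eq[OF permutes_inj[OF \<rho>], of "\<rho> l" l] l by simp
  qed
  have "l \<le> ?e (\<rho> l)" using le[OF \<rho>lk] by (simp add: \<pi>\<rho>)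
  then have tl: "row_max J l < tail l (?e (\<rho> l))"
    using row_max_less_tail[OF JI diag diag[OF lk] refl \<rho>l] \<rho>lk by simp
  have tl_n: "tail l (?e (\<rho> l)) \<le> n"
    using tail_ge[of l "?e (\<rho> l)"] \<open>l \<le> ?e (\<rho> l)\<close> target_ge[of "\<rho> l" "row_max J (\<rho> l)"]
      row_max_in[OF JI diag, of "\<rho> l"] \<rho>lk by simp
  have main: "weight l (?e (\<rho> l)) + (int n + 1) ^ l \<le> weight l (?e l)"
  proof -
    have "int (n - tail l (?e (\<rho> l))) + 1 \<le> int (n - row_max J l)" using tl tl_n by simp
    then have "(int n + 1) ^ l * (int (n - tail l (?e (\<rho> l))) + 1) \<le> (int n + 1) ^ l * int (n - row_max J l)"
      by (intro mult_left_mono) auto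
    then show ?thesis by (simp add: weight_def distrib_left)
  qed
  have split: "(\<Sum>i = 1..k. f i) = (\<Sum>i = 1..<l. f i) + (f l + (\<Sum>i = Suc l..k. f i))" for f :: "nat \<Rightarrow> int"
  proof -
    have "{1..k} = {1..<l} \<union> insert l {Suc l..k}" using lk by auto
    then have "(\<Sum>i = 1..k. f i) = (\<Sum>i\<in>{1..<l} \<union> insert l {Suc l..k}. f i)" by (simp only:)
    also have "\<dots> = (\<Sum>i = 1..<l. f i) + (\<Sum>i\<in>insert l {Suc l..k}. f i)"
      by (rule sum.union_disjoint) auto
    finally show ?thesis by simp
  qed
  have high: "(\<Sum>i = Suc l..k. weight i (?e (\<rho> i))) = (\<Sum>i = Suc l..k. weight i (?e i))"
    by (intro sum.cong refl) (simp add: l_max)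
  have low: "(\<Sum>i = 1..<l. weight i (?e (\<rho> i))) \<le> (\<Sum>i = 1..<l. (int n + 1) ^ i * int n)"
    by (intro sum_mono weight_bounds)
  have low': "0 \<le> (\<Sum>i = 1..<l. weight i (?e i))" by (intro sum_nonneg weight_bounds)
  show ?thesis
    unfolding reindex split high using low low' main geometric_bound[of l] by linarith
qed

end

section \<open>The basis\<close>

global_interpretation tensor: vector_space scale
  by unfold_locales (auto simp: scale_def fun_eq_iff algebra_simps)

locale marked_hw_model = marked_triangle n \<O> + hw_model smul n \<rho> a v
  for \<O> :: "(nat \<times> nat) set" and smul :: "complex \<Rightarrow> 'v :: ab_group_add \<Rightarrow> 'v"
    and n :: nat and \<rho> :: "complex mat \<Rightarrow> 'v \<Rightarrow> 'v" and a :: "nat \<Rightarrow> nat" and v :: 'v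

sublocale marked_hw_model \<subseteq> marked_shape n \<O> a
  by unfold_locales

context marked_hw_model
begin

abbreviation lattice_points :: "point set" where
  "lattice_points \<equiv> Pi_polytope n \<O> a \<inter> int_lattice n"

abbreviation ideal_family :: "(nat \<Rightarrow> (nat \<times> nat) set) \<Rightarrow> bool" where
  "ideal_family J \<equiv> \<forall>t<row_len n a 1. J t \<in> ideals_of n (height n a t)"

text \<open>
  For the column filled by an ideal \<open>J\<close>, this is the image of the row number under \<open>\<tau> w\<^sup>J\<close>.
\<close>

definition word_of :: "(nat \<Rightarrow> (nat \<times> nat) set) \<Rightarrow> word" where
  "word_of J p = (if p \<in> boxes then target (snd p) (row_max (J (fst p)) (snd p)) else 0)"

lemma chain_order_coord_space: "chain_order n \<O> a \<subseteq> coord_space n"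
proof
  fix x assume "x \<in> chain_order n \<O> a"
  then obtain y where y: "x = (\<Sum>k = 1..<n. real (a k) *\<^sub>R y k)"
    "\<And>k. k \<in> {1..<n} \<Longrightarrow> y k \<in> fund_chain_order n \<O> k"
    using chain_order_decompose by blast
  have "x p = 0" if p: "p \<notin> tri n" for p
  proof -
    have "fund_chain_order n \<O> k \<subseteq> {x. x p = 0}" for k
      unfolding fund_chain_order_def
    proof (rule hull_minimal)
      have "p \<notin> marked n \<O> J" if "J \<in> ideals_of n k" for J
        using that p marked_sub[of J] by (auto simp: ideals_of_def ideals_def)
      then show "(\<lambda>J. indicator (marked n \<O> J)) ` ideals_of n k \<subseteq> {x. x p = (0::real)}"
        by (auto simp: indicator_def)
      show "convex {x :: point. x p = 0}"
        unfolding convex_def by (auto simp: scaleR_fun_def)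
    qed
    then have "y k p = 0" if "k \<in> {1..<n}" for k using y(2)[OF that] by blast
    then show ?thesis
      unfolding y(1) sum_fun_apply scaleR_fun_def by (intro sum.neutral ballI) simp
  qed
  then show "x \<in> coord_space n" unfolding coord_space_def by blast
qed

lemma xi_bij_lattice_points: "xi n \<O> ` (chain_order n \<O> a \<inter> int_lattice n) = lattice_points"
proof (intro equalityI subsetI)
  fix c assume "c \<in> xi n \<O> ` (chain_order n \<O> a \<inter> int_lattice n)"
  then show "c \<in> lattice_points" using xi_chain_order[of a] xi_lattice by blast
next
  fix c assume c: "c \<in> lattice_points"
  then have "c \<in> xi n \<O> ` chain_order n \<O> a" by (simp only: xi_chain_order Int_iff)
  then obtain x where x: "x \<in> chain_order n \<O> a" "c = xi n \<O> x" by blast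
  have "x = xi_inv c" using xi_inv_xi[of x] x chain_order_coord_space by auto
  then have "x \<in> int_lattice n" using xi_inv_lattice c by blast
  then show "c \<in> xi n \<O> ` (chain_order n \<O> a \<inter> int_lattice n)" using x by blast
qed

lemma row_max_box:
  assumes J: "ideal_family J" and p: "(t, i) \<in> boxes"
  shows "(i, row_max (J t) i) \<in> tri n"
proof -
  have t: "t < row_len n a 1" "1 \<le> i" "i \<le> height n a t" using p unfolding boxes_Sigma by auto
  then have "J t \<in> ideals_of n (height n a t)" using J by blast
  then show ?thesis using t(2,3) by (rule row_max_tri)
qed

lemma word_of_box:
  assumes J: "ideal_family J" and p: "p \<in> boxes"
  shows "snd p \<le> word_of J p" "word_of J p \<le> n" "1 \<le> snd p"
proof -
  obtain t i where ti: "p = (t, i)" by fastforce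
  have "(i, row_max (J t) i) \<in> tri n" using row_max_box[OF J] p ti by blast
  then have "(i, target i (row_max (J t) i)) \<in> tri n" by (rule target_tri)
  then show "snd p \<le> word_of J p" "word_of J p \<le> n" "1 \<le> snd p"
    using p by (simp_all add: word_of_def ti)
qed

lemma word_of_words: "ideal_family J \<Longrightarrow> word_of J \<in> words"
  unfolding words_def using word_of_box[of J] by (force simp: word_of_def simp del: split_paired_All)

lemma lattice_point_word:
  assumes c: "c \<in> lattice_points"
  shows "\<exists>J. ideal_family J \<and> (\<forall>i j. c (i, j) = real (card {p \<in> boxes. snd p = i \<and> word_of J p = j}))"
proof -
  obtain x where x: "x \<in> chain_order n \<O> a" "x \<in> int_lattice n" "c = xi n \<O> x"
    using c xi_bij_lattice_points by blast
  let ?J = "level x"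
  have fam: "ideal_family ?J" using level_ideals_of[OF x(1) n_gt_1] by blast
  have "c = (\<Sum>t<row_len n a 1. xi n \<O> (indicator (marked n \<O> (?J t))))"
    unfolding x(3) by (subst lattice_point_decompose[OF x(1,2) n_gt_1]) (rule linear_sum[OF linear_xi])
  also have "\<dots> = (\<Sum>t<row_len n a 1. \<Sum>i = 1..height n a t. eps i (target i (row_max (?J t) i)))"
    using fam by (intro sum.cong refl xi_indicator_marked) simp
  also have "\<dots> = (\<Sum>t<row_len n a 1. \<Sum>i = 1..height n a t. eps (snd (t, i)) (word_of ?J (t, i)))"
    by (intro sum.cong refl) (simp add: word_of_def boxes_Sigma)
  also have "\<dots> = (\<Sum>p\<in>boxes. eps (snd p) (word_of ?J p))"
    unfolding boxes_Sigma by (subst sum.Sigma) (simp_all add: split_def)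
  finally have c_eq: "c = (\<Sum>p\<in>boxes. eps (snd p) (word_of ?J p))" .
  have "c (i, j) = real (card {p \<in> boxes. snd p = i \<and> word_of ?J p = j})" for i j
  proof -
    have "c (i, j) = (\<Sum>p\<in>boxes. if snd p = i \<and> word_of ?J p = j then 1 else 0)"
      unfolding c_eq sum_fun_apply by (intro sum.cong refl) (auto simp: eps_apply)
    also have "\<dots> = real (card (boxes \<inter> {p. snd p = i \<and> word_of ?J p = j}))"
      by (subst sum.If_cases) simp_all
    also have "boxes \<inter> {p. snd p = i \<and> word_of ?J p = j} = {p \<in> boxes. snd p = i \<and> word_of ?J p = j}"
      by blast
    finally show ?thesis .
  qed
  then show ?thesis using fam by blast
qed

definition family_of :: "point \<Rightarrow> nat \<Rightarrow> (nat \<times> nat) set" where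
  "family_of c = (SOME J. ideal_family J \<and>
     (\<forall>i j. c (i, j) = real (card {p \<in> boxes. snd p = i \<and> word_of J p = j})))"

definition top_word :: "point \<Rightarrow> word" where
  "top_word c = word_of (family_of c)"

lemma family_of: "c \<in> lattice_points \<Longrightarrow> ideal_family (family_of c)"
  and top_word_count: "c \<in> lattice_points \<Longrightarrow>
    c (i, j) = real (card {p \<in> boxes. snd p = i \<and> top_word c p = j})"
  using someI_ex[OF lattice_point_word[of c]] unfolding top_word_def family_of_def by blast+

lemma top_word_words: "c \<in> lattice_points \<Longrightarrow> top_word c \<in> words"
  unfolding top_word_def by (intro word_of_words family_of)

lemma top_word_ge: "c \<in> lattice_points \<Longrightarrow> p \<in> boxes \<Longrightarrow> snd p \<le> top_word c p"
  unfolding top_word_def by (intro word_of_box family_of)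

text \<open>
  The sums of the coordinates over a row are fixed by \<open>\<lambda>\<close>; this recovers the diagonal coordinates,
  on which \<open>f\<^sup>c\<close> does not depend.
\<close>

lemma lattice_point_row_sum:
  assumes c: "c \<in> lattice_points" and i: "1 \<le> i" "i \<le> n"
  shows "c (i, i) = real (card {p \<in> boxes. snd p = i}) - (\<Sum>j = Suc i..n. c (i, j))"
proof -
  have "card {p \<in> boxes. snd p = i} = (\<Sum>j = i..n. card {p \<in> boxes. snd p = i \<and> top_word c p = j})"
  proof -
    have "card {p \<in> boxes. snd p = i} = (\<Sum>p\<in>{p \<in> boxes. snd p = i}. 1)" by simp
    also have "\<dots> = (\<Sum>j\<in>{i..n}. \<Sum>p | p \<in> {p \<in> boxes. snd p = i} \<and> top_word c p = j. 1)"
      using top_word_ge[OF c] wordsD[OF top_word_words[OF c]]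
      by (intro sum.group[symmetric]) auto
    also have "\<dots> = (\<Sum>j = i..n. card {p \<in> boxes. snd p = i \<and> top_word c p = j})"
      by (simp add: conj_assoc)
    finally show ?thesis .
  qed
  then have "real (card {p \<in> boxes. snd p = i}) = (\<Sum>j = i..n. c (i, j))"
    by (simp only: top_word_count[OF c] of_nat_sum)
  also have "\<dots> = c (i, i) + (\<Sum>j = Suc i..n. c (i, j))"
    using i by (intro sum.atLeast_Suc_atMost)
  finally show ?thesis by simp
qed

text \<open>
  Subtracting the weight of the diagonal cell makes the diagonal coordinates irrelevant.
\<close>

definition rel_weight :: "nat \<times> nat \<Rightarrow> int" where
  "rel_weight p = weight (fst p) (snd p) - weight (fst p) (fst p)"

definition point_weight :: "point \<Rightarrow> int" where
  "point_weight c = (\<Sum>p\<in>tri n. int (nat \<lfloor>c p\<rfloor>) * rel_weight p)"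

lemma point_weight_eq:
  assumes le: "\<And>q. q \<in> boxes \<Longrightarrow> (\<omega>' q, \<omega> q) \<in> tri n"
    and cnt: "\<And>i j. (i, j) \<in> tri n \<Longrightarrow> i < j \<Longrightarrow> card {q \<in> boxes. \<omega> q = j \<and> \<omega>' q = i} = nat \<lfloor>c (i, j)\<rfloor>"
  shows "point_weight c = (\<Sum>q\<in>boxes. rel_weight (\<omega>' q, \<omega> q))"
proof -
  have "(\<Sum>q\<in>boxes. rel_weight (\<omega>' q, \<omega> q))
      = (\<Sum>p\<in>tri n. int (card {q \<in> boxes. (\<omega>' q, \<omega> q) = p}) * rel_weight p)"
    using le by (intro sum_fibers) auto
  also have "\<dots> = (\<Sum>p\<in>tri n. int (nat \<lfloor>c p\<rfloor>) * rel_weight p)"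
  proof (intro sum.cong refl)
    fix p assume p: "p \<in> tri n"
    obtain i j where ij: "p = (i, j)" by fastforce
    show "int (card {q \<in> boxes. (\<omega>' q, \<omega> q) = p}) * rel_weight p = int (nat \<lfloor>c p\<rfloor>) * rel_weight p"
    proof (cases "i = j")
      case True
      then show ?thesis by (simp add: ij rel_weight_def)
    next
      case False
      then have "i < j" using p ij by auto
      have "{q \<in> boxes. (\<omega>' q, \<omega> q) = p} = {q \<in> boxes. \<omega> q = j \<and> \<omega>' q = i}" by (auto simp: ij)
      then show ?thesis using cnt[of i j] p \<open>i < j\<close> by (simp only: ij)
    qed
  qed
  finally show ?thesis by (simp only: point_weight_def)
qed

lemma base_word_counts:
  assumes c: "c \<in> lattice_points"
  shows "card {q \<in> boxes. top_word c q = j \<and> base_word q = i} = nat \<lfloor>c (i, j)\<rfloor>"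
proof -
  have "{q \<in> boxes. top_word c q = j \<and> base_word q = i} = {q \<in> boxes. snd q = i \<and> top_word c q = j}"
    by (auto simp: base_word_def)
  then show ?thesis by (simp add: top_word_count[OF c])
qed

lemma reach_base_word:
  assumes c: "c \<in> lattice_points" shows "reach (pbw_ops n c) (top_word c) base_word"
proof (rule reach_exists)
  show "base_word q \<le> top_word c q" for q
    using top_word_ge[OF c, of q] by (cases "q \<in> boxes") (simp_all add: base_word_def)
  show "base_word q = top_word c q" if "q \<notin> boxes" for q
    using that words_outside[OF top_word_words[OF c] that] by (simp add: base_word_def)
  show "card {x \<in> boxes. top_word c x = l \<and> base_word x = k} = count_list (pbw_ops n c) (k, l)"
    if "k < l" for k l
  proof -
    have "c (k, l) = 0" if "(k, l) \<notin> tri n"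
      using c that int_lattice_sub coord_spaceD by blast
    then show ?thesis using that by (simp add: base_word_counts[OF c] count_pbw_ops del: tri_iff)
  qed
qed (rule set_pbw_ops)

text \<open>
  A word at which the highest weight tensor does not vanish permutes the row numbers in each column.
  Unless all these permutations are trivial, the additive weight is strictly smaller than for the
  filling by row numbers.
\<close>

lemma reach_hw_tensor:
  assumes c: "c \<in> lattice_points" and c': "c' \<in> lattice_points"
    and reach: "reach (pbw_ops n c') (top_word c) \<omega>'" and nz: "hw_tensor \<omega>' \<noteq> 0"
  shows "(\<omega>' = base_word \<and> c' = c) \<or> point_weight c' < point_weight c"
proof -
  let ?\<omega> = "top_word c" and ?J = "family_of c"
  have J: "ideal_family ?J" by (rule family_of[OF c])
  have le: "\<And>q. \<omega>' q \<le> ?\<omega> q" and out: "\<And>q. q \<notin> boxes \<Longrightarrow> \<omega>' q = ?\<omega> q"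
    and cnt: "\<And>k l. k < l \<Longrightarrow> card {x \<in> boxes. ?\<omega> x = l \<and> \<omega>' x = k} = count_list (pbw_ops n c') (k, l)"
    using reach_counts[OF set_pbw_ops sorted_pbw_ops reach] by blast+
  have w': "\<omega>' \<in> words" and perm: "column_map \<omega>' permutes boxes" using hw_tensor_nonzeroD[OF nz] by auto
  have in_tri: "(\<omega>' q, ?\<omega> q) \<in> tri n" if "q \<in> boxes" for q
    using le[of q] wordsD[OF w' that] wordsD[OF top_word_words[OF c] that] by simp
  have in_tri0: "(base_word q, ?\<omega> q) \<in> tri n" if "q \<in> boxes" for q
    using top_word_ge[OF c that] wordsD[OF base_word_words that] wordsD[OF top_word_words[OF c] that] that
    by (simp add: base_word_def)
  have W': "point_weight c' = (\<Sum>q\<in>boxes. rel_weight (\<omega>' q, ?\<omega> q))"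
  proof (intro point_weight_eq in_tri)
    fix i j assume ij: "(i, j) \<in> tri n" "i < j"
    show "card {q \<in> boxes. ?\<omega> q = j \<and> \<omega>' q = i} = nat \<lfloor>c' (i, j)\<rfloor>"
      unfolding cnt[OF ij(2)] count_pbw_ops using ij by (simp del: tri_iff)
  qed
  have W: "point_weight c = (\<Sum>q\<in>boxes. rel_weight (base_word q, ?\<omega> q))"
    by (intro point_weight_eq in_tri0 base_word_counts[OF c])
  have diag_eq: "(\<Sum>q\<in>boxes. weight (\<omega>' q) (\<omega>' q)) = (\<Sum>q\<in>boxes. weight (base_word q) (base_word q))"
  proof -
    have "(\<Sum>q\<in>boxes. weight (\<omega>' q) (\<omega>' q)) = (\<Sum>q\<in>boxes. weight (snd (column_map \<omega>' q)) (snd (column_map \<omega>' q)))"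
      by (intro sum.cong refl) (simp add: column_map_def)
    also have "\<dots> = (\<Sum>q\<in>boxes. weight (snd q) (snd q))"
      by (rule sum.reindex_bij_betw[OF permutes_imp_bij[OF perm]])
    also have "\<dots> = (\<Sum>q\<in>boxes. weight (base_word q) (base_word q))"
      by (intro sum.cong refl) (simp add: base_word_def)
    finally show ?thesis .
  qed
  (* the permutation spelled by the final word in column \<open>t\<close> *)
  define \<pi> where "\<pi> t b = (if b \<in> {1..height n a t} then \<omega>' (t, b) else b)" for t b
  have box: "(t, b) \<in> boxes" if "t < row_len n a 1" "b \<in> {1..height n a t}" for t b
    using that by (simp add: boxes_Sigma)
  have \<pi>: "\<pi> t permutes {1..height n a t}" if t: "t < row_len n a 1" for t
  proof (rule inj_imp_permutes)
    show "inj_on (\<pi> t) {1..height n a t}"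
    proof (rule inj_onI)
      fix b d assume bd: "b \<in> {1..height n a t}" "d \<in> {1..height n a t}" "\<pi> t b = \<pi> t d"
      then have "column_map \<omega>' (t, b) = column_map \<omega>' (t, d)"
        using box[OF t] by (simp add: column_map_def \<pi>_def)
      then show "b = d" using inj_eq[OF permutes_inj[OF perm], of "(t, b)" "(t, d)"] by simp
    qed
    show "finite {1..height n a t}" by simp
    show "\<pi> t b \<in> {1..height n a t}" if b: "b \<in> {1..height n a t}" for b
    proof -
      have "column_map \<omega>' (t, b) \<in> boxes" using permutes_in_image[OF perm] box[OF t b] by blast
      then have "(t, \<omega>' (t, b)) \<in> boxes" using box[OF t b] by (simp add: column_map_def)
      then show ?thesis using b unfolding boxes_Sigma by (simp add: \<pi>_def)
    qed
    show "\<pi> t b = b" if "b \<notin> {1..height n a t}" for b by (simp only: \<pi>_def that if_False)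
  qed
  let ?L = "\<lambda>t. \<Sum>b = 1..height n a t. weight (\<omega>' (t, b)) (?\<omega> (t, b))"
  let ?R = "\<lambda>t. \<Sum>b = 1..height n a t. weight (base_word (t, b)) (?\<omega> (t, b))"
  have L: "?L t = (\<Sum>b = 1..height n a t. weight (\<pi> t b) (target b (row_max (?J t) b)))"
    and R: "?R t = (\<Sum>b = 1..height n a t. weight b (target b (row_max (?J t) b)))" if "t < row_len n a 1" for t
    using box[OF that] by (auto intro!: sum.cong simp: \<pi>_def top_word_def word_of_def base_word_def)
  have strict: "?L t < ?R t" if t: "t < row_len n a 1" and "\<pi> t \<noteq> id" for t
    unfolding L[OF t] R[OF t]
  proof (rule weight_maximal)
    show "?J t \<in> ideals_of n (height n a t)" using J t by blast
    show "\<pi> t b \<le> target b (row_max (?J t) b)" if "b \<in> {1..height n a t}" for b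
      using le[of "(t, b)"] box[OF t that] that by (simp add: \<pi>_def top_word_def word_of_def)
  qed (fact \<pi>[OF t] that)+
  have weak: "?L t \<le> ?R t" if t: "t < row_len n a 1" for t
  proof (cases "\<pi> t = id")
    case True
    then show ?thesis unfolding L[OF t] R[OF t] by simp
  next
    case False
    then show ?thesis using strict[OF t] by simp
  qed
  show ?thesis
  proof (cases "\<exists>t<row_len n a 1. \<pi> t \<noteq> id")
    case True
    then have "(\<Sum>t<row_len n a 1. ?L t) < (\<Sum>t<row_len n a 1. ?R t)"
      using strict weak by (intro sum_strict_mono_ex1) auto
    then have "(\<Sum>q\<in>boxes. weight (\<omega>' q) (?\<omega> q)) < (\<Sum>q\<in>boxes. weight (base_word q) (?\<omega> q))"
      by (simp only: sum_boxes_columns)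
    then have "point_weight c' < point_weight c"
      unfolding W W' rel_weight_def fst_conv snd_conv sum_subtractf diag_eq by simp
    then show ?thesis ..
  next
    case False
    have "\<omega>' q = base_word q" for q
    proof (cases "q \<in> boxes")
      case True
      obtain t b where q: "q = (t, b)" by fastforce
      have tb: "t < row_len n a 1" "b \<in> {1..height n a t}" using True unfolding q boxes_Sigma by auto
      have "\<pi> t b = b" using False tb(1) by simp
      then show ?thesis using tb(2) True by (simp add: \<pi>_def q base_word_def)
    next
      case False
      then show ?thesis using words_outside[OF w'] words_outside[OF base_word_words] by simp
    qed
    then have eq: "\<omega>' = base_word" by (rule ext)
    have off: "c' (i, j) = c (i, j)" if "(i, j) \<in> tri n" "i < j" for i j
    proof -
      have "nat \<lfloor>c (i, j)\<rfloor> = nat \<lfloor>c' (i, j)\<rfloor>"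
        using cnt[OF that(2)] that unfolding eq base_word_counts[OF c] by (simp add: count_pbw_ops del: tri_iff)
      then show ?thesis unfolding top_word_count[OF c] top_word_count[OF c'] by simp
    qed
    have "c' (i, j) = c (i, j)" for i j
    proof -
      consider "(i, j) \<notin> tri n" | "(i, j) \<in> tri n" "i < j" | "(i, j) \<in> tri n" "i = j" by fastforce
      then show ?thesis
      proof cases
        case 1
        then have "c (i, j) = 0" "c' (i, j) = 0"
          using c c' int_lattice_sub coord_spaceD by blast+
        then show ?thesis by simp
      next
        case 2
        then show ?thesis by (rule off)
      next
        case 3
        then have i: "1 \<le> i" "i \<le> n" by auto
        have "(\<Sum>j = Suc i..n. c' (i, j)) = (\<Sum>j = Suc i..n. c (i, j))"
          using i by (intro sum.cong refl off) auto
        then show ?thesis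
          using lattice_point_row_sum[OF c i] lattice_point_row_sum[OF c' i] 3 by simp
      qed
    qed
    then have "c' = c" by (auto simp: fun_eq_iff)
    then show ?thesis using eq by blast
  qed
qed

definition basis_vector :: "point \<Rightarrow> 'v" where
  "basis_vector c = pbw_act n \<rho> c v"

lemma model_basis_vector: "model (basis_vector c) = run (pbw_ops n c) hw_tensor"
proof -
  have "model (foldr (\<lambda>p. \<rho> (lowering n (fst p) (snd p))) L v) = run L hw_tensor" if "valid_ops L" for L
    using that
  proof (induction L)
    case Nil
    show ?case by (simp only: foldr_Nil id_apply model_v)
  next
    case (Cons p L)
    then have "1 \<le> fst p" "fst p < snd p" "snd p \<le> n" "valid_ops L" by auto
    then show ?case using Cons.IH by (simp only: foldr_Cons comp_apply model_lowering)
  qed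
  then show ?thesis
    unfolding basis_vector_def pbw_act_eq_ops using set_pbw_ops by blast
qed

lemma model_basis_vector_diagonal:
  assumes c: "c \<in> lattice_points" shows "model (basis_vector c) (top_word c) \<noteq> 0"
proof -
  have t01: "hw_tensor \<omega>' \<in> {0, 1}" if "reach (pbw_ops n c) (top_word c) \<omega>'" for \<omega>'
    using reach_hw_tensor[OF c c that] hw_tensor_base_word by (cases "hw_tensor \<omega>' = 0") auto
  have "\<exists>m. run (pbw_ops n c) hw_tensor (top_word c) = of_nat m \<and>
      ((\<exists>\<omega>'. reach (pbw_ops n c) (top_word c) \<omega>' \<and> hw_tensor \<omega>' = 1) \<longrightarrow> 0 < m)"
    by (rule run_count[OF set_pbw_ops top_word_words[OF c] t01])
  then obtain m where "run (pbw_ops n c) hw_tensor (top_word c) = of_nat m"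
    "(\<exists>\<omega>'. reach (pbw_ops n c) (top_word c) \<omega>' \<and> hw_tensor \<omega>' = 1) \<longrightarrow> 0 < m" by blast
  then show ?thesis
    unfolding model_basis_vector using reach_base_word[OF c] hw_tensor_base_word by auto
qed

lemma model_basis_vector_triangular:
  assumes c: "c \<in> lattice_points" "c' \<in> lattice_points"
    and "model (basis_vector c') (top_word c) \<noteq> 0" "c' \<noteq> c"
  shows "point_weight c' < point_weight c"
proof -
  obtain \<omega>' where "reach (pbw_ops n c') (top_word c) \<omega>'" "hw_tensor \<omega>' \<noteq> 0"
    using run_nonzero[OF set_pbw_ops top_word_words[OF c(1)]] assms(3) unfolding model_basis_vector by blast
  then show ?thesis using reach_hw_tensor[OF c] assms(4) by blast
qed

lemma model_sum: "model (\<Sum>c\<in>F. smul (\<alpha> c) (b c)) \<omega> = (\<Sum>c\<in>F. \<alpha> c * model (b c) \<omega>)"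
proof (induction F rule: infinite_finite_induct)
  case (insert x F)
  then show ?case
    by (simp only: sum.insert model_plus model_smul plus_fun_apply scale_def insert_iff not_False_eq_True)
qed (simp_all only: sum.infinite sum.empty model_zero zero_fun_apply not_False_eq_True)

text \<open>
  In a linear relation, evaluate at the word of a point of least weight among those with nonzero
  coefficient; by triangularity only its own term survives.
\<close>

lemma basis_vectors_independent:
  assumes F: "finite F" "F \<subseteq> lattice_points" and zero: "(\<Sum>c\<in>F. smul (\<alpha> c) (basis_vector c)) = 0"
  shows "\<forall>c\<in>F. \<alpha> c = 0"
proof (rule ccontr)
  assume neg: "\<not> (\<forall>c\<in>F. \<alpha> c = 0)"
  let ?G = "{c \<in> F. \<alpha> c \<noteq> 0}"
  have "finite (point_weight ` ?G)" "point_weight ` ?G \<noteq> {}"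
    using F neg by auto
  then have "Min (point_weight ` ?G) \<in> point_weight ` ?G" by (rule Min_in)
  then obtain c0 where c0: "c0 \<in> ?G" "point_weight c0 = Min (point_weight ` ?G)" by auto
  have least: "point_weight c0 \<le> point_weight c" if "c \<in> ?G" for c
    unfolding c0(2) using \<open>finite (point_weight ` ?G)\<close> that by (intro Min_le) auto
  have c0_pt: "c0 \<in> lattice_points" using c0(1) F(2) by blast
  have "0 = model (\<Sum>c\<in>F. smul (\<alpha> c) (basis_vector c)) (top_word c0)"
    by (simp only: zero model_zero zero_fun_apply)
  also have "\<dots> = (\<Sum>c\<in>F. \<alpha> c * model (basis_vector c) (top_word c0))" by (rule model_sum)
  also have "\<dots> = (\<Sum>c\<in>F. if c = c0 then \<alpha> c0 * model (basis_vector c0) (top_word c0) else 0)"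
  proof (intro sum.cong refl)
    fix c assume cF: "c \<in> F"
    show "\<alpha> c * model (basis_vector c) (top_word c0)
      = (if c = c0 then \<alpha> c0 * model (basis_vector c0) (top_word c0) else 0)"
    proof (cases "c = c0 \<or> \<alpha> c = 0")
      case False
      then have "c \<in> ?G" using cF by blast
      have "model (basis_vector c) (top_word c0) = 0"
      proof (rule ccontr)
        assume "model (basis_vector c) (top_word c0) \<noteq> 0"
        then have "point_weight c < point_weight c0"
          using False cF F(2) by (intro model_basis_vector_triangular[OF c0_pt]) blast+
        then show False using least[OF \<open>c \<in> ?G\<close>] by simp
      qed
      then show ?thesis using False by simp
    qed auto
  qed
  also have "\<dots> = \<alpha> c0 * model (basis_vector c0) (top_word c0)"
    using F(1) c0(1) by (simp add: sum.delta)
  finally show False using c0(1) model_basis_vector_diagonal[OF c0_pt] by simp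
qed

lemma inj_on_basis_vector: "inj_on basis_vector lattice_points"
proof (rule inj_onI, rule ccontr)
  fix c c' assume cc: "c \<in> lattice_points" "c' \<in> lattice_points" "basis_vector c = basis_vector c'" "c \<noteq> c'"
  let ?\<alpha> = "\<lambda>d. if d = c then 1 else - 1 :: complex"
  have "(\<Sum>d\<in>{c, c'}. smul (?\<alpha> d) (basis_vector d)) = 0"
    using cc(3,4) by simp
  then have "\<forall>d\<in>{c, c'}. ?\<alpha> d = 0" using cc by (intro basis_vectors_independent) auto
  then show False by simp
qed

lemma independent_basis_vectors: "\<not> dependent (basis_vector ` lattice_points)"
proof
  assume "dependent (basis_vector ` lattice_points)"
  then obtain T u where T: "finite T" "T \<subseteq> basis_vector ` lattice_points"
    "(\<Sum>x\<in>T. smul (u x) x) = 0" "\<exists>x\<in>T. u x \<noteq> 0"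
    unfolding dependent_explicit by blast
  obtain F where F: "F \<subseteq> lattice_points" "finite F" "T = basis_vector ` F"
    using finite_subset_image[OF T(1,2)] by blast
  have "(\<Sum>c\<in>F. smul (u (basis_vector c)) (basis_vector c)) = 0"
    using T(3) unfolding F(3) by (subst (asm) sum.reindex) (auto intro: inj_on_subset[OF inj_on_basis_vector F(1)])
  from basis_vectors_independent[OF F(2,1) this] T(4) F(3) show False by blast
qed

text \<open>
  The coordinates at standard words determine the vector and embed \<open>V\<close> into a space whose dimension is
  the number of standard words.
\<close>

definition standard_coords :: "'v \<Rightarrow> tensor" where
  "standard_coords x = (\<lambda>\<omega>. if standard \<omega> then model x \<omega> else 0)"

definition delta :: "word \<Rightarrow> tensor" where
  "delta \<omega> = (\<lambda>\<eta>. if \<eta> = \<omega> then 1 else 0)"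

lemma finite_standard: "finite {\<omega>. standard \<omega>}"
  by (rule finite_subset[OF _ finite_words]) (auto simp: standard_def)

lemma standard_coords_span: "standard_coords x \<in> tensor.span (delta ` {\<omega>. standard \<omega>})"
proof -
  have "standard_coords x = (\<Sum>\<omega> | standard \<omega>. scale (model x \<omega>) (delta \<omega>))"
  proof
    fix \<eta>
    have "(\<Sum>\<omega> | standard \<omega>. scale (model x \<omega>) (delta \<omega>)) \<eta> = (\<Sum>\<omega> | standard \<omega>. if \<omega> = \<eta> then model x \<eta> else 0)"
      unfolding sum_fun_apply by (intro sum.cong refl) (auto simp: scale_def delta_def)
    then show "standard_coords x \<eta> = (\<Sum>\<omega> | standard \<omega>. scale (model x \<omega>) (delta \<omega>)) \<eta>"
      using finite_standard by (simp add: standard_coords_def sum.delta)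
  qed
  then show ?thesis
    by (simp only:) (intro tensor.span_sum tensor.span_scale tensor.span_base imageI)
qed

lemma independent_card:
  assumes "\<not> dependent B" shows "finite B \<and> card B \<le> card {\<omega>. standard \<omega>}"
proof -
  interpret pair: vector_space_pair smul scale ..
  have lin: "Vector_Spaces.linear smul scale standard_coords"
    unfolding Vector_Spaces.linear_iff
  proof (intro conjI allI)
    show "standard_coords (x + y) = standard_coords x + standard_coords y" for x y
      by (rule ext) (simp add: standard_coords_def model_plus)
    show "standard_coords (smul c x) = scale c (standard_coords x)" for c x
      by (rule ext) (simp add: standard_coords_def model_smul scale_def)
  qed (fact vector_space_axioms tensor.vector_space_axioms)+
  have "inj standard_coords"
  proof (rule injI)
    fix x y assume "standard_coords x = standard_coords y"
    then have eq: "model x \<omega> = model y \<omega>" if "standard \<omega>" for \<omega>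
      using that unfolding standard_coords_def by (meson)
    have "model (x + smul (- 1) y) \<omega> = 0" if "standard \<omega>" for \<omega>
      using eq[OF that] by (simp only: model_plus model_smul scale_def plus_fun_apply) simp
    then have "model (x + smul (- 1) y) = 0"
      by (rule exchange_space_determined[OF model_exchange_space])
    then have "x + smul (- 1) y = 0" by (simp only: model_eq_0_iff)
    then show "x = y" by simp
  qed
  then have inj: "inj_on standard_coords S" for S by (rule inj_on_subset) simp
  have "\<not> tensor.dependent (standard_coords ` B)"
    by (rule pair.linear_independent_injective_image[OF lin assms inj])
  moreover have "standard_coords ` B \<subseteq> tensor.span (delta ` {\<omega>. standard \<omega>})" using standard_coords_span by blast
  ultimately have *: "finite (standard_coords ` B) \<and> card (standard_coords ` B) \<le> card (delta ` {\<omega>. standard \<omega>})"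
    by (intro tensor.independent_span_bound finite_imageI finite_standard)
  have "card (delta ` {\<omega>. standard \<omega>}) \<le> card {\<omega>. standard \<omega>}" by (rule card_image_le[OF finite_standard])
  then have "card B \<le> card {\<omega>. standard \<omega>}" using * card_image[OF inj[of B]] by linarith
  moreover have "finite B" by (rule finite_imageD[OF conjunct1[OF *] inj])
  ultimately show ?thesis by blast
qed

lemma span_basis_vectors: "span (basis_vector ` lattice_points) = UNIV"
proof (rule ccontr)
  let ?B = "basis_vector ` lattice_points"
  assume "span ?B \<noteq> UNIV"
  then obtain x where x: "x \<notin> span ?B" by blast
  have x_notin: "x \<notin> ?B"
  proof
    assume "x \<in> ?B"
    then have "x \<in> span ?B" by (rule span_base)
    with x show False by (rule notE)
  qed
  have fin_B: "finite ?B" by (rule conjunct1[OF independent_card[OF independent_basis_vectors]])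
  then have fin: "finite lattice_points" by (rule finite_imageD[OF _ inj_on_basis_vector])
  have "\<not> dependent (insert x ?B)"
    by (simp only: independent_insert x_notin x independent_basis_vectors if_False not_False_eq_True HOL.simp_thms)
  then have "card (insert x ?B) \<le> card {\<omega>. standard \<omega>}" by (rule conjunct2[OF independent_card])
  also have "\<dots> = card ((xi n \<O> \<circ> word_point) ` {\<omega>. standard \<omega>})"
  proof (rule card_image[symmetric], rule comp_inj_on[OF inj_on_word_point])
    show "inj_on (xi n \<O>) (word_point ` {\<omega>. standard \<omega>})"
      using word_point_in chain_order_coord_space by (intro inj_on_subset[OF inj_on_xi]) blast
  qed
  also have "\<dots> \<le> card lattice_points"
  proof (rule card_mono[OF fin])
    show "(xi n \<O> \<circ> word_point) ` {\<omega>. standard \<omega>} \<subseteq> lattice_points"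
      unfolding xi_bij_lattice_points[symmetric] image_comp[symmetric] using word_point_in by blast
  qed
  also have "\<dots> = card ?B" by (rule card_image[OF inj_on_basis_vector, symmetric])
  also have "\<dots> < card (insert x ?B)" using card_insert_disjoint[OF fin_B x_notin] by simp
  finally show False by simp
qed

lemma basis_Pi: "is_basis_family smul (\<lambda>c. pbw_act n \<rho> c v) lattice_points"
  using inj_on_basis_vector independent_basis_vectors span_basis_vectors
  unfolding is_basis_family_def basis_vector_def[abs_def] by blast

lemma basis_chain_order:
  "is_basis_family smul (\<lambda>x. pbw_act n \<rho> (xi n \<O> x) v) (chain_order n \<O> a \<inter> int_lattice n)"
proof -
  have inj: "inj_on (xi n \<O>) (chain_order n \<O> a \<inter> int_lattice n)"
    using chain_order_coord_space by (intro inj_on_subset[OF inj_on_xi]) blast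
  have im: "(\<lambda>x. pbw_act n \<rho> (xi n \<O> x) v) ` (chain_order n \<O> a \<inter> int_lattice n)
      = (\<lambda>c. pbw_act n \<rho> c v) ` lattice_points"
    by (simp only: xi_bij_lattice_points[symmetric] image_image)
  have "inj_on ((\<lambda>c. pbw_act n \<rho> c v) \<circ> xi n \<O>) (chain_order n \<O> a \<inter> int_lattice n)"
    using basis_Pi unfolding is_basis_family_def xi_bij_lattice_points[symmetric]
    by (intro comp_inj_on[OF inj]) blast
  then show ?thesis
    using basis_Pi unfolding is_basis_family_def im comp_def by blast
qed

end

theorem theoremC:
  fixes n :: nat
    and \<O> \<C> :: "(nat \<times> nat) set"
    and a :: "nat \<Rightarrow> nat"
    and smul :: "complex \<Rightarrow> 'v :: ab_group_add \<Rightarrow> 'v"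
    and \<rho> :: "complex mat \<Rightarrow> 'v \<Rightarrow> 'v"
    and v :: 'v
  assumes "n > 1"
    and "\<O> \<union> \<C> = tri n - diag n" and "\<O> \<inter> \<C> = {}"
    and "irreducible_highest_weight_rep smul n \<rho> a v"
  shows "unimodular n (xi n \<O>)
    \<and> xi n \<O> ` chain_order n \<O> a = Pi_polytope n \<O> a
    \<and> is_basis_family smul (\<lambda>c. pbw_act n \<rho> c v) (Pi_polytope n \<O> a \<inter> int_lattice n)
    \<and> is_basis_family smul (\<lambda>x. pbw_act n \<rho> (xi n \<O> x) v) (chain_order n \<O> a \<inter> int_lattice n)"
proof -
  interpret irreducible_highest_weight_rep smul n \<rho> a v by fact
  interpret marked_hw_model \<O> smul n \<rho> a v
    using assms(1,2) by unfold_locales auto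
  show ?thesis
    using unimodular_xi xi_chain_order basis_Pi basis_chain_order by blast
qed

end
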